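(* Let $r>2$ and $M_0>0$. Assume that the solution map $y\mapsto u(y)$ from $Y$ to $V$ belongs to $\mathcal{A}^r$ with $\|u\|_{\mathcal{A}^r}\le M_0$, and let $\mathcal{M}=\{u(y): y\in Y\}$. Let $\varepsilon>0$ be an error tolerance and $\eta\in(0,1)$ a prescribed failure probability. Run the randomized greedy algorithm described in the context with these parameters $(r,M_0,\varepsilon,\eta)$. Then, with probability greater than $1-\eta$, the following hold: (i) The algorithm produces a reduced basis space $V_n$ such that $\mathrm{dist}(\mathcal{M},V_n)\le \varepsilon$. (ii) If for some $s>0$ and $C_0>0$ we have $d_n(\mathcal{M})\le C_0\max\{1,n\}^{-s}$ for all $n\ge 0$, then the algorithm terminates in $n(\varepsilon)$ steps, where $$n(\varepsilon)\le C\,\varepsilon^{-\left(\frac1s+\frac{3}{s(r-2)}\right)},$$ and requires $N(\varepsilon)$ error bound evaluations, where $$N(\varepsilon)\le C\,\varepsilon^{-\frac{2s+r+1}{s(r-2)}}\left(|\ln\eta|+|\ln\varepsilon|\right).$$ The constants $C$ in these bounds depend only on $(r,s,C_0,M_0)$.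
   Context: **Setting.** $V$ is a Hilbert space with norm $\|\cdot\|_V$. $Y=[-1,1]^d$, where $d\in\{1,2,\dots\}$ or $d=\infty$ (countably many parameters), and $\rho$ is the uniform probability measure on $Y$ (the product of the measures $dt/2$ on $[-1,1]$). For a finite-dimensional subspace $E\subset V$, $P_E$ is the $V$-orthogonal projection onto $E$, and $\mathrm{dist}(\mathcal{M},E):=\sup_{w\in\mathcal{M}}\|w-P_Ew\|_V$. The Kolmogorov $n$-width is $d_n(\mathcal{M}):=\inf_{\dim(E)=n}\ \sup_{w\in\mathcal{M}}\|w-P_Ew\|_V$, the infimum being over $n$-dimensional linear subspaces $E$ of $V$. **Approximation class $\mathcal{A}^r$.** Let $\mathcal{F}=\{0,1,2,\dots\}^d$ if $d<\infty$; if $d=\infty$, let $\mathcal{F}$ be the set of finitely supported sequences $\nu=(\nu_j)_{j\ge1}$ of nonnegative integers. Write $y^\nu=\prod_j y_j^{\nu_j}$. A set $\Lambda\subset\mathcal{F}$ is downward closed if $\nu\in\Lambda$ and $\mu\le\nu$ componentwise imply $\mu\in\Lambda$. Let $\mathcal{P}_\Lambda$ be the space of $V$-valued polynomials $P(y)=\sum_{\nu\in\Lambda}a_\nu y^\nu$, $a_\nu\in V$, and for $m\ge1$ let $\Sigma_m:=\bigcup_{\#(\Lambda)=m}\mathcal{P}_\Lambda$, the union being over all downward closed sets $\Lambda$ of cardinality $m$. For $v\in L^\infty(Y,V)$, put $\delta_m(v):=\inf_{P\in\Sigma_m}\sup_{y\in Y}\|v(y)-P(y)\|_V$. For $r>0$,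 $v\in\mathcal{A}^r$ means that $v\in L^\infty(Y,V)$ and there is $C$ with $\delta_m(v)\le Cm^{-r}$ for all $m\ge1$; the smallest such $C$ is denoted $|v|_{\mathcal{A}^r}$, and $\|v\|_{\mathcal{A}^r}:=\max\{\|v\|_{L^\infty(Y,V)},|v|_{\mathcal{A}^r}\}$. Here $\|v\|_{L^\infty(Y,V)}=\sup_{y\in Y}\|v(y)\|_V$. **The randomized greedy algorithm.** Let $m$ be the smallest (positive) integer such that $$32M_0m^{-r+2}\le\varepsilon\quad\text{and}\quad 2^{4r+2}m^{-r}\le1,$$ and let $N$ be the smallest integer such that $$\left(1-\frac{3}{4m^2}\right)^N\le\frac{\eta}{m^2}.$$ Set $V_0=\{0\}$. At step $n=0,1,2,\dots$, given $u^0,\dots,u^{n-1}$ and $V_n:=\mathrm{span}\{u^0,\dots,u^{n-1}\}$, make $N$ independent draws of the parameter $y$ according to $\rho$ (independent also of all previous draws), producing the training set $\widetilde Y_n\subset Y$. With $e_n(y):=\|u(y)-P_{V_n}u(y)\|_V$, define $$u^n:=u(y^n),\qquad y^n:=\mathrm{argmax}_{y\in\widetilde Y_n}e_n(y)$$ (any maximizer). Let $\hat\sigma_n:=\max_{y\in\widetilde Y_n}e_n(y)$ be the computed error. The algorithm is terminated at the smallest integer $n\le m^2$ for which $\hat\sigma_n\le\frac{\varepsilon}{8m}$; if this does not occur before $m^2$ steps, it is terminated after step $n=m^2$ has been completed. The output is $V_n$ for the terminal $n$, and $n(\varepsilon)$ denotes this terminal number of steps. It is assumed that $e_n(y)$ can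 be evaluated exactly for each individual $y$. An error bound evaluation is the evaluation of $e_n(y)$ at one sampled $y$. The algorithm terminating in $n(\varepsilon)$ steps is counted as drawing $n(\varepsilon)$ training sets of size $N$, so that $N(\varepsilon)=n(\varepsilon)N$.
   Formalization: The bound on N(ε) is proved with max{1, |ln η|+|ln ε|} in place of |ln η|+|ln ε|; the original fails for constant u of norm 1, M_0=ε=1, η→1, where N(ε)≥1 but the sum tends to 0. *)

theory Defs
  imports "HOL-Probability.Infinite_Product_Measure"
begin

text \<open>
  The Hilbert space \<open>V\<close> is a complete linear subspace (as a set) of an arbitrary real inner product
  space type. Carrying \<open>V\<close> as a set makes it possible to quantify over Hilbert spaces
  inside a formula, and so to state that a constant does not depend on \<open>V\<close>: any set of Hilbert
  spaces embeds isometrically in one inner product space, namely their \<open>\<ell>\<^sup>2\<close>-sum.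

  Suprema and infima that are not known in advance to be finite or over nonempty sets are taken
  in \<^typ>\<open>ereal\<close>.
\<close>

type_synonym param = "nat \<Rightarrow> real"

definition hilbert_subspace :: "'v::real_inner set \<Rightarrow> bool" where
  "hilbert_subspace V \<longleftrightarrow> subspace V \<and> complete V"


subsection \<open>Projections and widths\<close>

definition orth_proj :: "'v::real_inner set \<Rightarrow> 'v \<Rightarrow> 'v" where
  "orth_proj E w = (THE p. p \<in> E \<and> (\<forall>v\<in>E. orthogonal (w - p) v))"

definition dist_set :: "'v::real_inner set \<Rightarrow> 'v set \<Rightarrow> ereal" where
  "dist_set M E = (SUP w\<in>M. ereal (norm (w - orth_proj E w)))"

text \<open>Not \<^const>\<open>dim\<close>, which is 0 for infinite-dimensional subspaces.\<close>

definition has_dim :: "'v::real_vector set \<Rightarrow> nat \<Rightarrow> bool" where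
  "has_dim E n \<longleftrightarrow> (\<exists>B. finite B \<and> independent B \<and> card B = n \<and> span B = E)"

text \<open>
  If \<open>dim V < n\<close> there are no \<open>n\<close>-dimensional subspaces of \<open>V\<close>; the convention is then that \<open>V\<close>
  itself is admitted, so that the width is 0 for subsets of \<open>V\<close> (and not the infimum of the empty set).
\<close>

definition kolmogorov_width :: "'v::real_inner set \<Rightarrow> nat \<Rightarrow> 'v set \<Rightarrow> ereal" where
  "kolmogorov_width V n M =
     (INF E \<in> {E. E \<subseteq> V \<and> (has_dim E n \<or> E = V \<and> (\<exists>k<n. has_dim V k))}. dist_set M E)"


subsection \<open>Parameter domain\<close>

text \<open>
  Coordinates are numbered from 0; \<open>d = \<infinity>\<close> is the case of countably many parameters.
  Points of the domain are extensional functions, as usual for \<^const>\<open>PiE\<close> and \<^const>\<open>PiM\<close>.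
\<close>

definition coords :: "enat \<Rightarrow> nat set" where
  "coords d = {j. enat j < d}"

definition param_domain :: "enat \<Rightarrow> param set" where
  "param_domain d = (\<Pi>\<^sub>E j\<in>coords d. {-1..1})"

text \<open>The one-dimensional factor lives on the space \<open>[-1,1]\<close>, not on all of \<open>\<real>\<close>.\<close>

definition param_measure :: "enat \<Rightarrow> param measure" where
  "param_measure d = (\<Pi>\<^sub>M j\<in>coords d. uniform_measure (restrict_space lborel {-1..1}) {-1..1})"

lemma space_param_measure: "space (param_measure d) = param_domain d"
  by (simp add: param_measure_def param_domain_def space_PiM space_restrict_space)


subsection \<open>The approximation class\<close>

definition multi_indices :: "enat \<Rightarrow> (nat \<Rightarrow> nat) set" where
  "multi_indices d = {\<nu>. finite {j. \<nu> j \<noteq> 0} \<and> {j. \<nu> j \<noteq> 0} \<subseteq> coords d}"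

definition monomial :: "(nat \<Rightarrow> nat) \<Rightarrow> param \<Rightarrow> real" where
  "monomial \<nu> y = (\<Prod>j | \<nu> j \<noteq> 0. y j ^ \<nu> j)"

definition downward_closed :: "enat \<Rightarrow> (nat \<Rightarrow> nat) set \<Rightarrow> bool" where
  "downward_closed d \<Lambda> \<longleftrightarrow> \<Lambda> \<subseteq> multi_indices d \<and>
     (\<forall>\<nu>\<in>\<Lambda>. \<forall>\<mu>\<in>multi_indices d. (\<forall>j. \<mu> j \<le> \<nu> j) \<longrightarrow> \<mu> \<in> \<Lambda>)"

definition polys :: "'v::real_vector set \<Rightarrow> (nat \<Rightarrow> nat) set \<Rightarrow> (param \<Rightarrow> 'v) set" where
  "polys V \<Lambda> = {(\<lambda>y. \<Sum>\<nu>\<in>\<Lambda>. monomial \<nu> y *\<^sub>R a \<nu>) | a. \<forall>\<nu>\<in>\<Lambda>. a \<nu> \<in> V}"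

definition sparse_polys :: "'v::real_vector set \<Rightarrow> enat \<Rightarrow> nat \<Rightarrow> (param \<Rightarrow> 'v) set" where
  "sparse_polys V d m =
     (\<Union>\<Lambda>\<in>{\<Lambda>. downward_closed d \<Lambda> \<and> finite \<Lambda> \<and> card \<Lambda> = m}. polys V \<Lambda>)"

definition approx_error :: "'v::real_inner set \<Rightarrow> enat \<Rightarrow> nat \<Rightarrow> (param \<Rightarrow> 'v) \<Rightarrow> ereal" where
  "approx_error V d m v =
     (INF P\<in>sparse_polys V d m. SUP y\<in>param_domain d. ereal (norm (v y - P y)))"

text \<open>
  \<open>L\<^sup>\<infinity>(Y,V)\<close> is normed by the supremum over all \<open>y\<close>. Separability of the range, which
  Bochner measurability adds to Borel measurability, is not demanded; it holds for every
  element of the class \<open>A\<^sup>r\<close> below, being a uniform limit of polynomials.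
\<close>

definition Linf :: "'v::real_inner set \<Rightarrow> enat \<Rightarrow> (param \<Rightarrow> 'v) set" where
  "Linf V d = {v. v \<in> param_domain d \<rightarrow> V \<and> v \<in> borel_measurable (param_measure d) \<and>
                  bounded (v ` param_domain d)}"

definition Linf_norm :: "enat \<Rightarrow> (param \<Rightarrow> 'v::real_inner) \<Rightarrow> real" where
  "Linf_norm d v = (SUP y\<in>param_domain d. norm (v y))"

definition approx_consts :: "'v::real_inner set \<Rightarrow> enat \<Rightarrow> real \<Rightarrow> (param \<Rightarrow> 'v) \<Rightarrow> real set" where
  "approx_consts V d r v = {C. \<forall>m\<ge>1. approx_error V d m v \<le> ereal (C * real m powr (- r))}"

definition approx_class :: "'v::real_inner set \<Rightarrow> enat \<Rightarrow> real \<Rightarrow> (param \<Rightarrow> 'v) set" where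
  "approx_class V d r = {v \<in> Linf V d. approx_consts V d r v \<noteq> {}}"

text \<open>On the class, the infimum is attained: \<^const>\<open>approx_consts\<close> is closed, and bounded below by 0.\<close>

definition approx_seminorm :: "'v::real_inner set \<Rightarrow> enat \<Rightarrow> real \<Rightarrow> (param \<Rightarrow> 'v) \<Rightarrow> real" where
  "approx_seminorm V d r v = Inf (approx_consts V d r v)"

definition approx_norm :: "'v::real_inner set \<Rightarrow> enat \<Rightarrow> real \<Rightarrow> (param \<Rightarrow> 'v) \<Rightarrow> real" where
  "approx_norm V d r v = max (Linf_norm d v) (approx_seminorm V d r v)"


subsection \<open>The randomized greedy algorithm\<close>

definition greedy_m :: "real \<Rightarrow> real \<Rightarrow> real \<Rightarrow> nat" where
  "greedy_m r M0 \<epsilon> = (LEAST m. 0 < m \<and> 32 * M0 * real m powr (- r + 2) \<le> \<epsilon> \<and>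
                              2 powr (4 * r + 2) * real m powr (- r) \<le> 1)"

definition greedy_N :: "nat \<Rightarrow> real \<Rightarrow> nat" where
  "greedy_N m \<eta> = (LEAST N. (1 - 3 / (4 * (real m)\<^sup>2)) ^ N \<le> \<eta> / (real m)\<^sup>2)"

text \<open>The outcome \<open>\<omega> n k\<close> is the \<open>k\<close>-th of the \<open>N\<close> draws of step \<open>n\<close>; all draws are independent.\<close>

definition sample_measure :: "enat \<Rightarrow> nat \<Rightarrow> (nat \<Rightarrow> nat \<Rightarrow> param) measure" where
  "sample_measure d N = (\<Pi>\<^sub>M n\<in>UNIV. \<Pi>\<^sub>M k\<in>{..<N}. param_measure d)"

definition training_set :: "nat \<Rightarrow> (nat \<Rightarrow> nat \<Rightarrow> param) \<Rightarrow> nat \<Rightarrow> param set" where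
  "training_set N \<omega> n = \<omega> n ` {..<N}"

text \<open>In the next three definitions \<open>ys\<close> is the sequence of selected parameters.\<close>

definition greedy_space :: "(param \<Rightarrow> 'v::real_inner) \<Rightarrow> (nat \<Rightarrow> param) \<Rightarrow> nat \<Rightarrow> 'v set" where
  "greedy_space u ys n = span ((\<lambda>i. u (ys i)) ` {..<n})"

definition greedy_err :: "(param \<Rightarrow> 'v::real_inner) \<Rightarrow> (nat \<Rightarrow> param) \<Rightarrow> nat \<Rightarrow> param \<Rightarrow> real" where
  "greedy_err u ys n y = norm (u y - orth_proj (greedy_space u ys n) (u y))"

definition computed_err ::
    "nat \<Rightarrow> (param \<Rightarrow> 'v::real_inner) \<Rightarrow> (nat \<Rightarrow> nat \<Rightarrow> param) \<Rightarrow> (nat \<Rightarrow> param) \<Rightarrow> nat \<Rightarrow> real" where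
  "computed_err N u \<omega> ys n = Max (greedy_err u ys n ` training_set N \<omega> n)"

text \<open>
  Any maximizer may be selected. The choice is made by a rule \<open>sel\<close>: at step \<open>n\<close> it is a measurable
  function of the draws of steps \<open>0,\<dots>,n\<close> only. A rule for breaking ties that looked at later draws
  would destroy the independence of a training set from the space built before it.
\<close>

definition selected ::
    "(nat \<Rightarrow> (nat \<Rightarrow> nat \<Rightarrow> param) \<Rightarrow> param) \<Rightarrow> (nat \<Rightarrow> nat \<Rightarrow> param) \<Rightarrow> nat \<Rightarrow> param" where
  "selected sel \<omega> n = sel n (restrict \<omega> {..n})"

definition greedy_rule ::
    "enat \<Rightarrow> nat \<Rightarrow> (param \<Rightarrow> 'v::real_inner) \<Rightarrow>
     (nat \<Rightarrow> (nat \<Rightarrow> nat \<Rightarrow> param) \<Rightarrow> param) \<Rightarrow> bool" where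
  "greedy_rule d N u sel \<longleftrightarrow>
     (\<forall>n. sel n \<in> (\<Pi>\<^sub>M i\<in>{..n}. \<Pi>\<^sub>M k\<in>{..<N}. param_measure d) \<rightarrow>\<^sub>M param_measure d) \<and>
     (\<forall>\<omega>\<in>space (sample_measure d N). \<forall>n.
        is_arg_max (greedy_err u (selected sel \<omega>) n) (\<lambda>y. y \<in> training_set N \<omega> n)
                   (selected sel \<omega> n))"

definition terminal_step ::
    "real \<Rightarrow> nat \<Rightarrow> nat \<Rightarrow> (param \<Rightarrow> 'v::real_inner) \<Rightarrow>
     (nat \<Rightarrow> nat \<Rightarrow> param) \<Rightarrow> (nat \<Rightarrow> param) \<Rightarrow> nat" where
  "terminal_step \<epsilon> m N u \<omega> ys =
     (LEAST n. computed_err N u \<omega> ys n \<le> \<epsilon> / (8 * real m) \<or> n = m\<^sup>2)"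

text \<open>
  A caution on bounds for the number \<open>n N\<close> of error evaluations by a multiple of
  \<open>\<bar>ln \<eta>\<bar> + \<bar>ln \<epsilon>\<bar>\<close>: this sum tends to 0 when \<open>\<epsilon> = 1\<close> and \<open>\<eta> \<rightarrow> 1\<close>, whereas \<open>n N \<ge> 1\<close> whenever the
  algorithm does not stop at step 0 (for instance for constant \<open>u\<close> of norm 1 and \<open>M0 = \<epsilon> = 1\<close>).
  A constant independent of \<open>\<epsilon>\<close> and \<open>\<eta>\<close> therefore requires \<open>max 1 (\<bar>ln \<eta>\<bar> + \<bar>ln \<epsilon>\<bar>)\<close>.
\<close>

end

theory Submission
  imports Defs "HOL-Computational_Algebra.Polynomial"
begin

text \<open>
  Let \<open>P\<close> be an \<open>m\<close>-term polynomial near \<open>u\<close>. The residuals of \<open>P\<close> with respect to a reduced space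
  again form a polynomial \<open>Q\<close> over the same downward closed set, and \<open>sup \<bar>Q\<bar>\<^sup>2 \<le> m\<^sup>2 \<integral> \<bar>Q\<bar>\<^sup>2\<close>.
  Hence \<open>\<bar>Q\<bar>\<close> is at least \<open>sup \<bar>Q\<bar> / (2 m)\<close> on a set of measure greater than \<open>3 / (4 m\<^sup>2)\<close>, which
  \<open>N\<close> independent draws miss with probability less than \<open>\<eta> / m\<^sup>2\<close>. Off the union of these events
  over the first \<open>m\<^sup>2\<close> steps, the algorithm is a weak greedy algorithm with constant \<open>1 / (4 m)\<close>
  until the computed error drops below the threshold.

  For a weak greedy algorithm, the product of the distances in a block of \<open>2 M\<close> steps is compared
  with the widths by contracting the space along an \<open>M\<close>-dimensional nearly optimal subspace by a
  factor \<open>a\<close>: this decreases the product of the distances at most by \<open>a\<^sup>M\<close>, while it makes all the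
  vectors as short as their distance to the subspace. Doubling the number of steps then transfers
  algebraic decay from the widths to the greedy errors. The widths are those of \<open>\<M>\<close> in part (ii),
  and at most the approximation errors \<open>\<delta>\<^sub>k(u)\<close> in part (i).
\<close>

section \<open>Projections onto finite-dimensional spaces\<close>

text \<open>The maximum of \<open>u\<close> over a sample says nothing about its supremum. For
  polynomials over a downward closed set it does, because the diagonal of the reproducing kernel is
  at most (card \<open>\<Lambda>\<close>)^2; this square is the source of the m^2 in the definition
  of N. The reduced space of step n is itself random. The sampling estimate therefore holds for
  fixed earlier draws and is then integrated over them, which requires the polynomial to be chosen
  before any sampling and the space to be determined by the draws before step n. The probability is
  strictly greater than 1 - \<eta> because the sampling estimate yields 3 / (4 m^2 - 1) where the
  definition of N asks only for 3 / (4 m^2). Constants independent of \<epsilon> are possible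
  because a run with at least one step forces \<epsilon> \<le> 272 M0, so that additive constants
  can be absorbed into negative powers of \<epsilon>.\<close>

definition fin_span :: "'v::real_inner set \<Rightarrow> bool" where
  "fin_span E \<longleftrightarrow> (\<exists>B. finite B \<and> span B = E)"

text \<open>For finitely spanned \<open>E\<close> this is the distance from \<open>w\<close> to
  \<open>E\<close> (\<open>residual_min\<close>).\<close>

definition residual :: "'v::real_inner set \<Rightarrow> 'v \<Rightarrow> real" where
  "residual E w = norm (w - orth_proj E w)"

lemma fin_span_span [simp, intro]: "finite B \<Longrightarrow> fin_span (span B)"
  by (auto simp: fin_span_def)

lemma fin_span_subspace: "fin_span E \<Longrightarrow> subspace E"
  by (auto simp: fin_span_def)

lemma orth_proj_unique:
  assumes "subspace E" "p \<in> E" "\<And>v. v \<in> E \<Longrightarrow> inner (w - p) v = 0"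
  shows "orth_proj E w = p"
  unfolding orth_proj_def
proof (rule the_equality)
  show "p \<in> E \<and> (\<forall>v\<in>E. orthogonal (w - p) v)"
    using assms by (simp add: orthogonal_def)
next
  fix q assume q: "q \<in> E \<and> (\<forall>v\<in>E. orthogonal (w - q) v)"
  have "q - p \<in> E" using q assms by (simp add: subspace_diff)
  then have "inner (w - p) (q - p) = 0" "inner (w - q) (q - p) = 0"
    using q assms by (auto simp: orthogonal_def)
  then have "inner (q - p) (q - p) = 0"
    by (simp add: inner_diff_left)
  then show "q = p" by simp
qed

lemma orth_proj_exists:
  assumes "finite B"
  shows "\<exists>p\<in>span B. \<forall>v\<in>span B. inner (w - p) v = (0::real)"
proof -
  obtain C where C: "finite C" "span C = span B" "pairwise orthogonal C"
    using basis_orthogonal[OF assms] by blast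
  \<comment> \<open>\<open>C\<close> may contain 0; its coefficient is then 0 / 0 = 0, so the
    Fourier sum stays correct.\<close>
  define p where "p = (\<Sum>b\<in>C. (inner b w / inner b b) *\<^sub>R b)"
  have "p \<in> span B"
    unfolding C(2)[symmetric] p_def by (intro span_sum span_scale span_base)
  moreover have "inner (w - p) v = 0" if "v \<in> span B" for v
  proof -
    have base: "inner (w - p) x = 0" if "x \<in> C" for x
    proof -
      have "inner p x = (\<Sum>b\<in>C. if b = x then inner x w else 0)"
        unfolding p_def inner_sum_left
        using C(3) that by (intro sum.cong) (auto simp: pairwise_def orthogonal_def)
      then show ?thesis using C(1) that by (simp add: inner_diff_left inner_commute[of x])
    qed
    have "subspace {x. inner (w - p) x = 0}"
      by (auto simp: subspace_def inner_add_right)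
    then have "span C \<subseteq> {x. inner (w - p) x = 0}"
      using base by (intro span_minimal) auto
    then show ?thesis using that C(2) by auto
  qed
  ultimately show ?thesis by blast
qed

lemma orth_proj_props:
  assumes "fin_span E"
  shows "orth_proj E w \<in> E" and "v \<in> E \<Longrightarrow> inner (w - orth_proj E w) v = 0"
proof -
  obtain B where B: "finite B" "span B = E" using assms by (auto simp: fin_span_def)
  obtain p where p: "p \<in> E" "\<And>v. v \<in> E \<Longrightarrow> inner (w - p) v = 0"
    using orth_proj_exists[OF B(1), of w] B(2) by auto
  then have "orth_proj E w = p"
    using fin_span_subspace[OF assms] by (intro orth_proj_unique) auto
  then show "orth_proj E w \<in> E" "v \<in> E \<Longrightarrow> inner (w - orth_proj E w) v = 0"
    using p by auto
qed

lemma orth_proj_add: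
  assumes "fin_span E"
  shows "orth_proj E (x + y) = orth_proj E x + orth_proj E y"
proof (rule orth_proj_unique)
  show "subspace E" by (rule fin_span_subspace[OF assms])
  then show "orth_proj E x + orth_proj E y \<in> E"
    by (intro subspace_add orth_proj_props(1) assms)
  fix v assume "v \<in> E"
  have "inner (x + y - (orth_proj E x + orth_proj E y)) v
      = inner (x - orth_proj E x) v + inner (y - orth_proj E y) v"
    by (simp add: inner_diff_left inner_add_left)
  then show "inner (x + y - (orth_proj E x + orth_proj E y)) v = 0"
    by (simp only: orth_proj_props(2)[OF assms \<open>v \<in> E\<close>])
qed

lemma orth_proj_scale:
  assumes "fin_span E"
  shows "orth_proj E (c *\<^sub>R x) = c *\<^sub>R orth_proj E x"
proof (rule orth_proj_unique)
  show "subspace E" by (rule fin_span_subspace[OF assms])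
  then show "c *\<^sub>R orth_proj E x \<in> E"
    by (intro subspace_scale orth_proj_props(1) assms)
  fix v assume "v \<in> E"
  have "inner (c *\<^sub>R x - c *\<^sub>R orth_proj E x) v = c * inner (x - orth_proj E x) v"
    by (simp add: inner_diff_left algebra_simps)
  then show "inner (c *\<^sub>R x - c *\<^sub>R orth_proj E x) v = 0"
    by (simp only: orth_proj_props(2)[OF assms \<open>v \<in> E\<close>])
qed

lemma orth_proj_sum:
  assumes "fin_span E" "finite A"
  shows "orth_proj E (\<Sum>i\<in>A. c i *\<^sub>R f i) = (\<Sum>i\<in>A. c i *\<^sub>R orth_proj E (f i))"
  using assms(2)
proof (induction A rule: finite_induct)
  case empty
  show ?case using orth_proj_scale[OF assms(1), of 0 0] by simp
next
  case (insert x A)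
  then show ?case
    by (subst (1 2) sum.insert, simp_all only: sum.insert orth_proj_add[OF assms(1)] orth_proj_scale[OF assms(1)])
qed

lemma pythagoras_inner:
  fixes x y :: "'v::real_inner"
  assumes "inner x y = 0"
  shows "(norm (x + y))\<^sup>2 = (norm x)\<^sup>2 + (norm y)\<^sup>2"
  using assms by (simp add: power2_norm_eq_inner inner_add_left inner_add_right inner_commute)

lemma residual_pythagoras:
  assumes "fin_span E"
  shows "(norm w)\<^sup>2 = (norm (orth_proj E w))\<^sup>2 + (residual E w)\<^sup>2"
  using pythagoras_inner[of "w - orth_proj E w" "orth_proj E w", OF orth_proj_props(2)[OF assms orth_proj_props(1)[OF assms]]]
  by (simp add: residual_def)

lemma residual_le_norm: "fin_span E \<Longrightarrow> residual E w \<le> norm w"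
  by (rule power2_le_imp_le) (use residual_pythagoras[of E w] in auto)

lemma orth_proj_le_norm: "fin_span E \<Longrightarrow> norm (orth_proj E w) \<le> norm w"
  by (rule power2_le_imp_le) (use residual_pythagoras[of E w] in auto)

lemma residual_nonneg [simp]: "0 \<le> residual E w"
  by (simp add: residual_def)

lemma residual_min:
  assumes "fin_span E" "v \<in> E"
  shows "residual E w \<le> norm (w - v)"
proof -
  have "inner (w - orth_proj E w) (orth_proj E w - v) = 0"
    using orth_proj_props[OF assms(1)] fin_span_subspace[OF assms(1)] assms(2)
    by (simp add: subspace_diff)
  from pythagoras_inner[OF this]
  have "(norm (w - v))\<^sup>2 = (residual E w)\<^sup>2 + (norm (orth_proj E w - v))\<^sup>2"
    by (simp add: residual_def)
  then show ?thesis by (simp add: power2_le_imp_le)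
qed

lemma residual_antimono:
  assumes "fin_span E" "fin_span F" "E \<subseteq> F"
  shows "residual F w \<le> residual E w"
  using residual_min[OF assms(2), of "orth_proj E w" w] orth_proj_props(1)[OF assms(1)] assms(3)
  by (auto simp: residual_def)

lemma residual_triangle:
  assumes "fin_span E"
  shows "residual E x \<le> residual E y + norm (x - y)"
proof -
  have "residual E x \<le> norm (x - orth_proj E y)"
    by (rule residual_min[OF assms orth_proj_props(1)[OF assms]])
  also have "\<dots> \<le> norm (x - y) + norm (y - orth_proj E y)"
    using norm_triangle_ineq[of "x - y" "y - orth_proj E y"] by simp
  finally show ?thesis by (simp add: residual_def)
qed

lemma orthonormal_basis_exists:
  fixes B :: "'v::real_inner set"
  assumes "finite B"
  shows "\<exists>C. finite C \<and> card C \<le> card B \<and> span C = span B \<and> pairwise orthogonal C \<and> (\<forall>w\<in>C. norm w = 1)"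
proof -
  obtain C where C: "finite C" "card C \<le> card B" "span C = span B" "pairwise orthogonal C"
    using basis_orthogonal[OF assms] by blast
  define D where "D = (\<lambda>x. x /\<^sub>R norm x) ` (C - {0})"
  have "card D \<le> card (C - {0})" unfolding D_def by (rule card_image_le) (use C in auto)
  also have "\<dots> \<le> card C" by (rule card_mono) (use C in auto)
  finally have card: "card D \<le> card B" using C by simp
  have span: "span D = span C"
  proof (rule antisym)
    show "span D \<subseteq> span C"
      by (rule span_minimal) (auto simp: D_def span_base span_scale)
    have "x \<in> span D" if "x \<in> C" for x
    proof (cases "x = 0")
      case False
      then have "x /\<^sub>R norm x \<in> span D" using that by (intro span_base) (auto simp: D_def)
      then have "norm x *\<^sub>R (x /\<^sub>R norm x) \<in> span D" by (rule span_scale)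
      then show ?thesis using False by simp
    qed (simp add: span_zero)
    then show "span C \<subseteq> span D" by (intro span_minimal) auto
  qed
  have "pairwise orthogonal D"
    using C(4) unfolding D_def pairwise_image
    by (auto simp: pairwise_def orthogonal_def)
  moreover have "\<forall>w\<in>D. norm w = 1" by (auto simp: D_def)
  moreover have "finite D" using C by (simp add: D_def)
  ultimately show ?thesis using card span C(3) by metis
qed

section \<open>Contraction along one direction\<close>

text \<open>For a unit vector \<open>w\<close>, this multiplies the component along \<open>w\<close>
  by \<open>a\<close> and fixes the orthogonal complement of \<open>w\<close>.\<close>

definition shrink :: "real \<Rightarrow> 'v::real_inner \<Rightarrow> 'v \<Rightarrow> 'v" where
  "shrink a w x = x - ((1 - a) * inner x w) *\<^sub>R w"

lemma linear_shrink: "linear (shrink a w)"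
  by (intro linearI) (auto simp: shrink_def inner_add_left algebra_simps)

lemma norm_shrink:
  assumes "norm w = 1"
  shows "(norm (shrink a w x))\<^sup>2 = (norm x)\<^sup>2 - (1 - a\<^sup>2) * (inner x w)\<^sup>2"
proof -
  have w: "inner w w = 1" using assms by (simp add: power2_norm_eq_inner[symmetric])
  show ?thesis
    unfolding power2_norm_eq_inner shrink_def
    by (simp add: inner_diff_left inner_diff_right w inner_commute[of w x])
       (simp add: power2_eq_square algebra_simps)
qed

lemma inner_shrink: "inner (shrink a w x) y = inner x y - (1 - a) * inner x w * inner w y"
  by (simp add: shrink_def inner_diff_left)

text \<open>For a finite-dimensional F, the factor 1 - (1 - a^2) |P_F w|^2 is the determinant of the
  quadratic form |S x|^2 on F, that is, the factor by which S changes squared volumes in F. A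
  squared residual is a quotient of two such volumes, which suggests the estimate; the proof gets it
  by an explicit minimization instead.\<close>

lemma residual_shrink_step:
  fixes g w :: "'v::real_inner"
  assumes "finite B" "norm w = 1" "0 < a" "a \<le> 1"
  defines "S \<equiv> shrink a w"
  shows "(1 - (1 - a\<^sup>2) * (norm (orth_proj (span (insert g B)) w))\<^sup>2) * (residual (span B) g)\<^sup>2
      \<le> (1 - (1 - a\<^sup>2) * (norm (orth_proj (span B) w))\<^sup>2) * (residual (span (S ` B)) (S g))\<^sup>2"
proof -
  have fin: "fin_span (span B)" "fin_span (span (insert g B))" "fin_span (span (S ` B))"
    using assms(1) by auto
  define c where "c = 1 - a\<^sup>2"
  have "a\<^sup>2 \<le> 1" using assms by (simp add: power_le_one)
  then have c: "0 \<le> c" "c \<le> 1" by (auto simp: c_def)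
  define r where "r = g - orth_proj (span B) g"
  define pw where "pw = orth_proj (span B) w"
  define p where "p = norm pw"
  define b where "b = inner r w"
  define \<delta> where "\<delta> = norm r"
  have res: "residual (span B) g = \<delta>" by (simp add: residual_def \<delta>_def r_def)
  have r_orth: "inner r v = 0" if "v \<in> span B" for v
    unfolding r_def by (rule orth_proj_props(2)[OF fin(1) that])
  have pw_in: "pw \<in> span B" unfolding pw_def by (rule orth_proj_props(1)[OF fin(1)])
  have p1: "p \<le> 1" unfolding p_def pw_def using orth_proj_le_norm[OF fin(1), of w] assms(2) by simp
  have cp: "c * p\<^sup>2 \<le> 1"
  proof -
    have "p\<^sup>2 \<le> 1" using p1 by (simp add: p_def power_le_one)
    then have "c * p\<^sup>2 \<le> 1 * 1" using c by (intro mult_mono) auto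
    then show ?thesis by simp
  qed
  have key: "\<delta>\<^sup>2 * (1 - c * (norm (orth_proj (span (insert g B)) w))\<^sup>2) = \<delta>\<^sup>2 * (1 - c * p\<^sup>2) - c * b\<^sup>2"
  proof (cases "\<delta> = 0")
    case True
    then have "r = 0" by (simp add: \<delta>_def)
    then show ?thesis using True by (simp add: b_def)
  next
    case False
    have rr: "inner r r = \<delta>\<^sup>2" by (simp add: \<delta>_def power2_norm_eq_inner)
    \<comment> \<open>\<open>r\<close> is the new direction, orthogonal to \<open>span B\<close>.
      The projection of \<open>w\<close> gains its component along \<open>r\<close>, of length |b| /
      \<delta>.\<close>
    define q where "q = pw + (b / \<delta>\<^sup>2) *\<^sub>R r"
    have B_sub: "span B \<subseteq> span (insert g B)" by (rule span_mono) auto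
    have "orth_proj (span B) g \<in> span (insert g B)"
      using orth_proj_props(1)[OF fin(1), of g] B_sub by blast
    then have r_in: "r \<in> span (insert g B)"
      unfolding r_def by (intro span_diff) (auto intro: span_base)
    have "orth_proj (span (insert g B)) w = q"
    proof (rule orth_proj_unique)
      show "q \<in> span (insert g B)"
        unfolding q_def using r_in pw_in B_sub by (intro span_add span_scale) auto
      fix v assume "v \<in> span (insert g B)"
      then obtain k where k: "v - k *\<^sub>R g \<in> span B"
        using span_breakdown_eq[of v g B] by auto
      define v0 where "v0 = v - k *\<^sub>R g + k *\<^sub>R orth_proj (span B) g"
      have v0: "v0 \<in> span B" unfolding v0_def
        using k orth_proj_props(1)[OF fin(1), of g] by (intro span_add span_scale) auto
      have v: "v = v0 + k *\<^sub>R r" by (simp add: v0_def r_def algebra_simps)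
      have 1: "inner (w - q) v0 = 0"
      proof -
        have "inner (w - q) v0 = inner (w - pw) v0 - (b / \<delta>\<^sup>2) * inner r v0"
          by (simp add: q_def inner_diff_left inner_add_left)
        then show ?thesis using r_orth[OF v0] orth_proj_props(2)[OF fin(1) v0, of w] by (simp add: pw_def)
      qed
      have 2: "inner (w - q) r = 0"
      proof -
        have "inner pw r = 0" using r_orth[OF pw_in] by (simp add: inner_commute)
        then have "inner (w - q) r = inner w r - (b / \<delta>\<^sup>2) * \<delta>\<^sup>2"
          by (simp add: q_def inner_diff_left inner_add_left rr)
        then show ?thesis using False by (simp add: b_def inner_commute)
      qed
      show "inner (w - q) v = 0" by (simp add: v inner_add_right 1 2)
    qed auto
    moreover have "(norm q)\<^sup>2 = p\<^sup>2 + b\<^sup>2 / \<delta>\<^sup>2"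
    proof -
      have "inner pw ((b / \<delta>\<^sup>2) *\<^sub>R r) = 0" using r_orth[OF pw_in] by (simp add: inner_commute)
      from pythagoras_inner[OF this] have "(norm q)\<^sup>2 = p\<^sup>2 + (norm ((b / \<delta>\<^sup>2) *\<^sub>R r))\<^sup>2"
        by (simp add: q_def p_def)
      also have "(norm ((b / \<delta>\<^sup>2) *\<^sub>R r))\<^sup>2 = b\<^sup>2 / \<delta>\<^sup>2"
        using False by (simp add: power_mult_distrib power_divide \<delta>_def[symmetric])
          (simp add: field_simps power2_eq_square power4_eq_xxxx)
      finally show ?thesis .
    qed
    ultimately have "\<delta>\<^sup>2 * (1 - c * (norm (orth_proj (span (insert g B)) w))\<^sup>2)
        = \<delta>\<^sup>2 * (1 - c * p\<^sup>2) - c * (\<delta>\<^sup>2 * (b\<^sup>2 / \<delta>\<^sup>2))"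
      by (simp only:) (simp add: algebra_simps)
    also have "\<delta>\<^sup>2 * (b\<^sup>2 / \<delta>\<^sup>2) = b\<^sup>2" using False by simp
    finally show ?thesis .
  qed
  have "orth_proj (span (S ` B)) (S g) \<in> span (S ` B)" by (rule orth_proj_props(1)[OF fin(3)])
  then obtain v where v: "v \<in> span B" "orth_proj (span (S ` B)) (S g) = S v"
    using linear_span_image[OF linear_shrink, of a w B] unfolding S_def by auto
  \<comment> \<open>The best approximation of \<open>S g\<close> is \<open>S v\<close>, and the
    error is \<open>S (r + z)\<close> with \<open>z\<close> in \<open>span B\<close>, hence
    orthogonal to \<open>r\<close>. Only the inner products \<open>b\<close> and \<open>t\<close>
    with \<open>w\<close> couple the two.\<close>
  define z where "z = orth_proj (span B) g - v"
  define t where "t = inner z w"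
  have z_in: "z \<in> span B" unfolding z_def using v(1) orth_proj_props(1)[OF fin(1)] by (intro span_diff)
  have "S g - S v = S (r + z)"
    unfolding S_def r_def z_def by (simp add: linear_diff[OF linear_shrink, symmetric])
  then have "(residual (span (S ` B)) (S g))\<^sup>2 = (norm (S (r + z)))\<^sup>2"
    by (simp add: residual_def v(2))
  also have "\<dots> = (norm (r + z))\<^sup>2 - c * (b + t)\<^sup>2"
    unfolding S_def norm_shrink[OF assms(2)] by (simp add: c_def b_def t_def inner_add_left)
  also have "(norm (r + z))\<^sup>2 = \<delta>\<^sup>2 + (norm z)\<^sup>2"
    using pythagoras_inner[OF r_orth[OF z_in]] by (simp add: \<delta>_def)
  finally have S_res: "(residual (span (S ` B)) (S g))\<^sup>2 = \<delta>\<^sup>2 + (norm z)\<^sup>2 - c * (b + t)\<^sup>2" .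
  have t: "\<bar>t\<bar> \<le> norm z * p"
  proof -
    have "inner (w - pw) z = 0" unfolding pw_def by (rule orth_proj_props(2)[OF fin(1) z_in])
    then have "t = inner z pw" by (simp add: t_def inner_diff_left inner_commute[of z])
    then show ?thesis using Cauchy_Schwarz_ineq2[of z pw] by (simp add: p_def)
  qed
  define \<zeta> where "\<zeta> = norm z"
  define k where "k = 1 - c * p\<^sup>2"
  have k: "0 \<le> k" using cp by (simp add: k_def)
  have "t\<^sup>2 \<le> (\<zeta> * p)\<^sup>2" using t unfolding \<zeta>_def by (metis abs_ge_zero power2_abs power_mono)
  then have t2: "c * k * t\<^sup>2 \<le> c * k * (\<zeta> * p)\<^sup>2" using c k by (intro mult_left_mono) auto
  have "b * t \<le> \<bar>b\<bar> * (\<zeta> * p)" using t unfolding \<zeta>_def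
    by (metis abs_ge_self abs_ge_zero abs_mult mult_left_mono order_trans)
  then have bt: "c * k * (b * t) \<le> c * k * (\<bar>b\<bar> * (\<zeta> * p))" using c k by (intro mult_left_mono) auto
  \<comment> \<open>Completing the square: in the worst case |t| = \<zeta> p with the sign of
    \<open>b\<close>, the difference of the two sides is exactly this square.\<close>
  have "0 \<le> (\<zeta> * k - c * \<bar>b\<bar> * p)\<^sup>2" by simp
  also have "\<dots> = \<zeta>\<^sup>2 * k * (1 - c * p\<^sup>2) - 2 * (c * k * (\<bar>b\<bar> * (\<zeta> * p))) + c\<^sup>2 * b\<^sup>2 * p\<^sup>2"
    by (simp add: k_def power2_eq_square algebra_simps)
  also have "\<dots> = \<zeta>\<^sup>2 * k - c * k * (\<zeta> * p)\<^sup>2 - 2 * (c * k * (\<bar>b\<bar> * (\<zeta> * p))) + c * b\<^sup>2 * (1 - k)"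
    by (simp add: k_def[unfolded diff_conv_add_uminus] power2_eq_square algebra_simps)
  also have "\<dots> \<le> \<zeta>\<^sup>2 * k - c * k * t\<^sup>2 - 2 * (c * k * (b * t)) + c * b\<^sup>2 * (1 - k)"
    using t2 bt by linarith
  also have "\<dots> = k * (\<delta>\<^sup>2 + \<zeta>\<^sup>2 - c * (b + t)\<^sup>2) - (\<delta>\<^sup>2 * k - c * b\<^sup>2)"
    by (simp add: power2_eq_square algebra_simps)
  finally have "\<delta>\<^sup>2 * k - c * b\<^sup>2 \<le> k * (\<delta>\<^sup>2 + \<zeta>\<^sup>2 - c * (b + t)\<^sup>2)" by simp
  then show ?thesis
    using key unfolding S_res res c_def[symmetric] pw_def[symmetric] p_def[symmetric] k_def \<zeta>_def
    by (simp add: mult.commute)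
qed

text \<open>The determinant factors \<theta> telescope, from \<theta> 0 = 1 to \<theta> n \<ge> a^2.
  A direction thus costs a single factor a^2 for the whole product, however many vectors there
  are.\<close>

lemma prod_residual_shrink:
  fixes g :: "nat \<Rightarrow> 'v::real_inner"
  assumes "norm w = 1" "0 < a" "a \<le> 1"
  shows "a\<^sup>2 * (\<Prod>i<n. (residual (span (g ` {..<i})) (g i))\<^sup>2)
    \<le> (\<Prod>i<n. (residual (span ((\<lambda>j. shrink a w (g j)) ` {..<i})) (shrink a w (g i)))\<^sup>2)"
    (is "_ * ?P n \<le> ?Q n")
proof -
  define \<theta> where "\<theta> n = 1 - (1 - a\<^sup>2) * (norm (orth_proj (span (g ` {..<n})) w))\<^sup>2" for n
  have a: "a\<^sup>2 \<le> 1" using assms by (simp add: power_le_one)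
  have \<theta>: "a\<^sup>2 \<le> \<theta> n" for n
  proof -
    have "norm (orth_proj (span (g ` {..<n})) w) \<le> 1"
      using orth_proj_le_norm[of "span (g ` {..<n})" w] assms(1) by simp
    then have "(norm (orth_proj (span (g ` {..<n})) w))\<^sup>2 \<le> 1" by (simp add: power_le_one)
    then have "(1 - a\<^sup>2) * (norm (orth_proj (span (g ` {..<n})) w))\<^sup>2 \<le> (1 - a\<^sup>2) * 1"
      using a by (intro mult_left_mono) auto
    then show ?thesis by (simp add: \<theta>_def)
  qed
  have "\<theta> n * ?P n \<le> ?Q n"
  proof (induction n)
    case 0
    show ?case using a by (simp add: \<theta>_def)
  next
    case (Suc n)
    let ?R = "(residual (span ((\<lambda>j. shrink a w (g j)) ` {..<n})) (shrink a w (g n)))\<^sup>2"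
    have "\<theta> (Suc n) * (residual (span (g ` {..<n})) (g n))\<^sup>2 \<le> \<theta> n * ?R"
      using residual_shrink_step[of "g ` {..<n}" w a "g n"] assms
      by (simp add: \<theta>_def lessThan_Suc image_image)
    then have "?P n * (\<theta> (Suc n) * (residual (span (g ` {..<n})) (g n))\<^sup>2) \<le> ?P n * (\<theta> n * ?R)"
      by (intro mult_left_mono prod_nonneg) auto
    also have "\<dots> = (\<theta> n * ?P n) * ?R" by simp
    also have "\<dots> \<le> ?Q n * ?R" by (intro mult_right_mono Suc) auto
    finally show ?case by (simp add: mult_ac)
  qed
  moreover have "a\<^sup>2 * ?P n \<le> \<theta> n * ?P n" by (intro mult_right_mono \<theta> prod_nonneg) auto
  ultimately show ?thesis by linarith
qed

text \<open>Shrinking along each vector of an orthonormal set in turn replaces a determinant argument.\<close>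

lemma prod_residual_orthonormal:
  fixes g :: "nat \<Rightarrow> 'v::real_inner"
  assumes "finite W" "pairwise orthogonal W" "\<forall>w\<in>W. norm w = 1" "0 < a" "a \<le> 1"
  shows "(a\<^sup>2) ^ card W * (\<Prod>i<n. (residual (span (g ` {..<i})) (g i))\<^sup>2)
    \<le> (\<Prod>i<n. (norm (g i))\<^sup>2 - (1 - a\<^sup>2) * (\<Sum>w\<in>W. (inner (g i) w)\<^sup>2))"
  using assms(1-3)
proof (induction W arbitrary: g rule: finite_induct)
  case empty
  show ?case by (auto intro!: prod_mono power_mono residual_le_norm)
next
  case (insert w W)
  let ?S = "shrink a w"
  have w: "norm w = 1" and W: "pairwise orthogonal W" "\<forall>w\<in>W. norm w = 1"
    using insert.prems by (auto simp: pairwise_insert)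
  \<comment> \<open>Shrinking along \<open>w\<close> does not change inner products with the rest of
    \<open>W\<close>, so each step of the induction accounts for exactly one term of the
    sum.\<close>
  have inner0: "inner w v = 0" if "v \<in> W" for v
    using insert.prems(1) insert.hyps(2) that by (auto simp: pairwise_insert orthogonal_def)
  have "(a\<^sup>2) ^ card (insert w W) * (\<Prod>i<n. (residual (span (g ` {..<i})) (g i))\<^sup>2)
    = (a\<^sup>2) ^ card W * (a\<^sup>2 * (\<Prod>i<n. (residual (span (g ` {..<i})) (g i))\<^sup>2))"
    using insert.hyps by simp
  also have "\<dots> \<le> (a\<^sup>2) ^ card W * (\<Prod>i<n. (residual (span ((\<lambda>j. ?S (g j)) ` {..<i})) (?S (g i)))\<^sup>2)"
    by (intro mult_left_mono prod_residual_shrink w assms) auto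
  also have "\<dots> \<le> (\<Prod>i<n. (norm (?S (g i)))\<^sup>2 - (1 - a\<^sup>2) * (\<Sum>v\<in>W. (inner (?S (g i)) v)\<^sup>2))"
    using insert.IH[OF W, of "\<lambda>j. ?S (g j)"] .
  also have "\<dots> = (\<Prod>i<n. (norm (g i))\<^sup>2 - (1 - a\<^sup>2) * (\<Sum>v\<in>insert w W. (inner (g i) v)\<^sup>2))"
    using insert.hyps inner0 by (simp add: norm_shrink[OF w] inner_shrink algebra_simps cong: sum.cong)
  finally show ?case .
qed

section \<open>Convergence of the weak greedy algorithm\<close>

lemma residual_orthonormal:
  assumes "finite W" "pairwise orthogonal W" "\<forall>w\<in>W. norm w = 1"
  shows "(residual (span W) x)\<^sup>2 = (norm x)\<^sup>2 - (\<Sum>w\<in>W. (inner x w)\<^sup>2)"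
proof -
  define p where "p = orth_proj (span W) x"
  define q where "q = (\<Sum>w\<in>W. inner x w *\<^sub>R w)"
  have ww: "inner v w = (if v = w then 1 else 0)" if "v \<in> W" "w \<in> W" for v w
    using assms(2,3) that by (auto simp: pairwise_def orthogonal_def power2_norm_eq_inner[symmetric])
  have qw: "inner q w = inner x w" if "w \<in> W" for w
  proof -
    have "inner q w = (\<Sum>v\<in>W. if v = w then inner x w else 0)"
      unfolding q_def inner_sum_left using that by (intro sum.cong) (auto simp: ww)
    then show ?thesis using assms(1) that by simp
  qed
  have pw: "inner x w = inner p w" if "w \<in> W" for w
    using orth_proj_props(2)[of "span W" w x] assms(1) that
    by (simp add: p_def inner_diff_left span_base)
  have "q \<in> span W" unfolding q_def by (intro span_sum span_scale span_base)
  have "p = q"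
  proof -
    have "subspace {v. inner (p - q) v = 0}" by (auto simp: subspace_def inner_add_right)
    then have "span W \<subseteq> {v. inner (p - q) v = 0}"
      by (intro span_minimal) (auto simp: inner_diff_left qw pw)
    moreover have "p - q \<in> span W"
      using \<open>q \<in> span W\<close> assms(1) unfolding p_def by (intro span_diff orth_proj_props) auto
    ultimately show ?thesis by auto
  qed
  moreover have "(norm q)\<^sup>2 = (\<Sum>w\<in>W. (inner x w)\<^sup>2)"
    unfolding power2_norm_eq_inner
    by (subst (2) q_def) (simp add: inner_sum_right qw power2_eq_square)
  ultimately show ?thesis
    using residual_pythagoras[of "span W" x] assms(1) by (simp add: p_def)
qed

text \<open>Modulo the first N vectors, all vectors of the block have norm at most \<sigma> and lie
  within \<delta> of a space of dimension at most M. Shrinking that space by a = \<delta> / \<sigma>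
  makes every squared norm at most 2 \<delta>^2 and costs the factor a^(2 M). With 2 M steps, the 2
  M-th root of the product inequality is a \<tau>^2 \<le> 2 \<delta>^2, which is the claim.\<close>

lemma greedy_block_bound:
  fixes f :: "nat \<Rightarrow> 'v::real_inner"
  assumes W: "finite W" "card W \<le> M" and "0 < M" "0 < \<delta>" "0 \<le> \<tau>"
    and low: "\<And>i. i < 2 * M \<Longrightarrow> \<tau> \<le> residual (span (f ` {..<N + i})) (f (N + i))"
    and high: "\<And>i. i < 2 * M \<Longrightarrow> residual (span (f ` {..<N})) (f (N + i)) \<le> \<sigma>"
    and near: "\<And>i. i < 2 * M \<Longrightarrow> \<exists>w\<in>span W. norm (f (N + i) - w) \<le> \<delta>"
  shows "\<tau>\<^sup>2 \<le> 2 * \<delta> * \<sigma>"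
proof -
  define E where "E = span (f ` {..<N})"
  have fE: "fin_span E" by (auto simp: E_def)
  define Q where "Q x = x - orth_proj E x" for x
  have linQ: "linear Q"
    by (intro linearI) (auto simp: Q_def orth_proj_add[OF fE] orth_proj_scale[OF fE] algebra_simps)
  have normQ: "norm (Q x) = residual E x" for x by (simp add: Q_def residual_def)
  have \<tau>\<sigma>: "\<tau> \<le> \<sigma>" using low[of 0] high[of 0] \<open>0 < M\<close> by simp
  show ?thesis
  \<comment> \<open>Here \<delta> / \<sigma> could exceed 1 and would not be a contraction, but
    \<tau> \<le> \<sigma> already suffices.\<close>
  proof (cases "\<sigma> \<le> \<delta>")
    case True
    have "\<tau>\<^sup>2 \<le> \<sigma> * \<sigma>" unfolding power2_eq_square using \<tau>\<sigma> \<open>0 \<le> \<tau>\<close> by (intro mult_mono) auto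
    also have "\<dots> \<le> (2 * \<delta>) * \<sigma>" using True \<tau>\<sigma> \<open>0 \<le> \<tau>\<close> \<open>0 < \<delta>\<close> by (intro mult_right_mono) auto
    finally show ?thesis .
  next
    case False
    then have \<sigma>: "\<delta> < \<sigma>" "0 < \<sigma>" using \<open>0 < \<delta>\<close> by auto
    \<comment> \<open>This balances the two contributions: the part inside the space shrinks to at
      most a \<sigma> = \<delta>, the bound for the part outside.\<close>
    define a where "a = \<delta> / \<sigma>"
    have a: "0 < a" "a \<le> 1" using \<sigma> \<open>0 < \<delta>\<close> by (auto simp: a_def)
    have a2: "a\<^sup>2 \<le> 1" using a by (simp add: power_le_one)
    obtain W' where W': "finite W'" "card W' \<le> card (Q ` W)" "span W' = span (Q ` W)"
      "pairwise orthogonal W'" "\<forall>w\<in>W'. norm w = 1"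
      using orthonormal_basis_exists[of "Q ` W"] W(1) by auto
    have cW': "card W' \<le> M" using W'(2) card_image_le[OF W(1), of Q] W(2) by simp
    define g where "g i = Q (f (N + i))" for i
    have g_up: "0 \<le> (norm (g i))\<^sup>2 - (1 - a\<^sup>2) * (\<Sum>w\<in>W'. (inner (g i) w)\<^sup>2)"
      "(norm (g i))\<^sup>2 - (1 - a\<^sup>2) * (\<Sum>w\<in>W'. (inner (g i) w)\<^sup>2) \<le> 2 * \<delta>\<^sup>2" if i: "i < 2 * M" for i
    proof -
      define \<rho> where "\<rho> = residual (span W') (g i)"
      have eq: "(\<Sum>w\<in>W'. (inner (g i) w)\<^sup>2) = (norm (g i))\<^sup>2 - \<rho>\<^sup>2"
        using residual_orthonormal[OF W'(1,4,5), of "g i"] by (simp add: \<rho>_def)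
      have eq2: "(norm (g i))\<^sup>2 - (1 - a\<^sup>2) * (\<Sum>w\<in>W'. (inner (g i) w)\<^sup>2)
          = a\<^sup>2 * (norm (g i))\<^sup>2 + (1 - a\<^sup>2) * \<rho>\<^sup>2"
        unfolding eq by (simp add: algebra_simps)
      show "0 \<le> (norm (g i))\<^sup>2 - (1 - a\<^sup>2) * (\<Sum>w\<in>W'. (inner (g i) w)\<^sup>2)"
        unfolding eq2 using a2 by auto
      obtain w where w: "w \<in> span W" "norm (f (N + i) - w) \<le> \<delta>" using near[OF i] by auto
      have "Q w \<in> span W'" unfolding W'(3) linear_span_image[OF linQ] using w(1) by auto
      then have "\<rho> \<le> norm (g i - Q w)" unfolding \<rho>_def using W'(1) by (intro residual_min) auto
      also have "g i - Q w = Q (f (N + i) - w)" by (simp add: g_def linear_diff[OF linQ])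
      also have "norm \<dots> \<le> norm (f (N + i) - w)" unfolding normQ by (rule residual_le_norm[OF fE])
      finally have "\<rho> \<le> \<delta>" using w by simp
      moreover have "0 \<le> \<rho>" by (simp add: \<rho>_def)
      ultimately have "\<rho>\<^sup>2 \<le> \<delta>\<^sup>2" by (intro power_mono)
      have "norm (g i) \<le> \<sigma>" unfolding g_def normQ using high[OF i] by (simp add: E_def)
      then have "(norm (g i))\<^sup>2 \<le> \<sigma>\<^sup>2" by (intro power_mono) auto
      then have "a\<^sup>2 * (norm (g i))\<^sup>2 \<le> a\<^sup>2 * \<sigma>\<^sup>2" by (intro mult_left_mono) auto
      also have "\<dots> = \<delta>\<^sup>2" using \<sigma> by (simp add: a_def power_divide)
      finally have "a\<^sup>2 * (norm (g i))\<^sup>2 \<le> \<delta>\<^sup>2" .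
      moreover have "(1 - a\<^sup>2) * \<rho>\<^sup>2 \<le> 1 * \<delta>\<^sup>2" using a2 \<open>\<rho>\<^sup>2 \<le> \<delta>\<^sup>2\<close> by (intro mult_mono) auto
      ultimately show "(norm (g i))\<^sup>2 - (1 - a\<^sup>2) * (\<Sum>w\<in>W'. (inner (g i) w)\<^sup>2) \<le> 2 * \<delta>\<^sup>2"
        unfolding eq2 by simp
    qed
    \<comment> \<open>\<open>Q\<close> subtracts only elements of \<open>E\<close>, so an
      approximation of \<open>g i\<close> by earlier \<open>g j\<close> is an approximation of
      \<open>f (N + i)\<close> by all earlier vectors.\<close>
    have g_low: "\<tau> \<le> residual (span (g ` {..<i})) (g i)" if i: "i < 2 * M" for i
    proof -
      define v where "v = orth_proj (span (g ` {..<i})) (g i)"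
      have E_sub: "E \<subseteq> span (f ` {..<N + i})" unfolding E_def by (rule span_mono) auto
      have g_in: "g j \<in> span (f ` {..<N + i})" if "j < i" for j
      proof -
        have "f (N + j) \<in> span (f ` {..<N + i})" using that by (intro span_base) auto
        then show ?thesis
          using orth_proj_props(1)[OF fE, of "f (N + j)"] E_sub
          unfolding g_def Q_def by (intro span_diff) auto
      qed
      have "v \<in> span (g ` {..<i})" unfolding v_def by (intro orth_proj_props) auto
      also have "\<dots> \<subseteq> span (f ` {..<N + i})" using g_in by (intro span_minimal) auto
      finally have "orth_proj E (f (N + i)) + v \<in> span (f ` {..<N + i})"
        using orth_proj_props(1)[OF fE, of "f (N + i)"] E_sub by (intro span_add) auto
      then have "residual (span (f ` {..<N + i})) (f (N + i)) \<le> norm (f (N + i) - (orth_proj E (f (N + i)) + v))"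
        by (intro residual_min) auto
      also have "\<dots> = residual (span (g ` {..<i})) (g i)"
        by (simp add: residual_def v_def[symmetric]) (simp add: g_def Q_def algebra_simps)
      finally show ?thesis using low[OF i] by simp
    qed
    have "(a * \<tau>\<^sup>2) ^ (2 * M) = (a\<^sup>2) ^ M * (\<Prod>i<2*M. \<tau>\<^sup>2)"
      by (simp add: power_mult_distrib power_mult[symmetric])
    also have "\<dots> \<le> (a\<^sup>2) ^ card W' * (\<Prod>i<2*M. (residual (span (g ` {..<i})) (g i))\<^sup>2)"
      using a a2 cW' g_low \<open>0 \<le> \<tau>\<close>
      by (intro mult_mono power_decreasing prod_mono conjI power_mono prod_nonneg) auto
    also have "\<dots> \<le> (\<Prod>i<2*M. (norm (g i))\<^sup>2 - (1 - a\<^sup>2) * (\<Sum>w\<in>W'. (inner (g i) w)\<^sup>2))"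
      by (rule prod_residual_orthonormal[OF W'(1,4,5) a])
    also have "\<dots> \<le> (\<Prod>i<2*M. 2 * \<delta>\<^sup>2)" using g_up by (intro prod_mono) auto
    also have "\<dots> = (2 * \<delta>\<^sup>2) ^ (2 * M)" by simp
    finally have "a * \<tau>\<^sup>2 \<le> 2 * \<delta>\<^sup>2" 
      using \<open>0 < M\<close> power_mono_iff[of "a * \<tau>\<^sup>2" "2 * \<delta>\<^sup>2" "2 * M"] a by simp
    then have "\<sigma> * (a * \<tau>\<^sup>2) \<le> \<sigma> * (2 * \<delta>\<^sup>2)" using \<sigma> by (intro mult_left_mono) auto
    also have "\<sigma> * (a * \<tau>\<^sup>2) = \<delta> * \<tau>\<^sup>2" using \<sigma> by (simp add: a_def)
    also have "\<sigma> * (2 * \<delta>\<^sup>2) = \<delta> * (2 * \<delta> * \<sigma>)" by (simp add: power2_eq_square)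
    finally show ?thesis using \<open>0 < \<delta>\<close> by (simp only: mult_le_cancel_left_pos)
  qed
qed

text \<open>The block from 2 M to 4 M gives \<tau>^2 \<le> 2 (D M^(-s)) (C (2 M)^(-s)) = 2 * 8^s D C
  (4 M)^(-2 s), where \<tau> is \<gamma> times the error after 4 M steps. The rate reproduces itself
  exactly when \<gamma>^2 C = 2 * 8^s D, which fixes the constant.\<close>

lemma weak_greedy_rate:
  fixes f :: "nat \<Rightarrow> 'v::real_inner"
  assumes f: "\<And>i. i < L \<Longrightarrow> f i \<in> U" and \<gamma>: "0 < \<gamma>" "\<gamma> \<le> 1" and "0 < D" "0 \<le> s"
    and greedy: "\<And>i w. i < L \<Longrightarrow> w \<in> U \<Longrightarrow>
      \<gamma> * residual (span (f ` {..<i})) w \<le> residual (span (f ` {..<i})) (f i)"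
    and width: "\<And>k. \<exists>W. finite W \<and> card W \<le> k \<and>
      (\<forall>w\<in>U. \<exists>v\<in>span W. norm (w - v) \<le> D * max 1 (real k) powr (- s))"
  shows "2 ^ j \<le> L \<Longrightarrow> w \<in> U \<Longrightarrow>
    residual (span (f ` {..<2^j})) w \<le> (2 * 8 powr s * D / \<gamma>\<^sup>2) * real (2 ^ j) powr (- s)"
proof (induction j arbitrary: w)
  define C where "C = 2 * 8 powr s * D / \<gamma>\<^sup>2"
  have g2: "\<gamma>\<^sup>2 \<le> 1" "0 < \<gamma>\<^sup>2" using \<gamma> by (auto simp: power_le_one)
  have "(2 * D) * 8 powr s \<le> C"
  proof -
    have "(2 * D * 8 powr s) * \<gamma>\<^sup>2 \<le> (2 * D * 8 powr s) * 1"
      using g2 \<open>0 < D\<close> by (intro mult_left_mono) auto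
    then show ?thesis using g2 by (simp add: C_def field_simps)
  qed
  moreover have "D * 8 powr s \<le> (2 * D) * 8 powr s" using \<open>0 < D\<close> by (intro mult_right_mono) auto
  ultimately have DC: "D * 8 powr s \<le> C" by linarith
  \<comment> \<open>The width hypothesis at k = 0 leaves only the zero space, so it bounds the norms
    on \<open>U\<close>.\<close>
  have small: "residual (span (f ` {..<n})) w \<le> D" if w: "w \<in> U" for n w
  proof -
    obtain W where "finite W" "card W \<le> 0" "\<forall>w\<in>U. \<exists>v\<in>span W. norm (w - v) \<le> D * max 1 (real 0) powr (- s)"
      using width[of 0] by auto
    then have "norm w \<le> D" using w by auto
    then show ?thesis using residual_le_norm[of "span (f ` {..<n})" w] by simp
  qed
  {
    case 0
    have "D * 1 \<le> D * 8 powr s" using \<open>0 < D\<close> \<open>0 \<le> s\<close> by (intro mult_left_mono ge_one_powr_ge_zero) auto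
    then show ?case using small[OF 0(2), of 1] DC by (simp add: C_def[symmetric])
  next
    case (Suc j)
    \<comment> \<open>From one step to two, M would be 1 / 2; that case follows from
      \<open>small\<close>.\<close>
    show ?case
    proof (cases j)
      case 0
      have "D * 1 \<le> D * (8 powr s * 2 powr (- s))"
        using \<open>0 < D\<close> \<open>0 \<le> s\<close>
        by (intro mult_left_mono) (auto simp: powr_minus field_simps intro!: powr_mono2)
      also have "\<dots> \<le> C * 2 powr (- s)" using DC mult_right_mono[of "D * 8 powr s" C "2 powr (- s)"] by (simp add: mult.assoc)
      finally show ?thesis using small[OF Suc.prems(2), of "2 ^ Suc j"] 0 by (simp add: C_def[symmetric])
    next
      case (Suc i)
      define M where "M = (2::nat) ^ i"
      have N: "2 ^ j = 2 * M" "2 ^ Suc j = 4 * M" by (auto simp: M_def Suc)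
      have M: "0 < M" by (simp add: M_def)
      \<comment> \<open>Errors decrease with the number of steps, so the error after 4 M steps,
        weakened by \<gamma>, bounds every selected error of the block from below.\<close>
      define \<tau> where "\<tau> = \<gamma> * residual (span (f ` {..<2 ^ Suc j})) w"
      define x where "x = real (4 * M) powr (- s)"
      have x: "0 < x" using M by (simp add: x_def)
      have x1: "real M powr (- s) = 4 powr s * x"
        using M by (simp add: x_def powr_mult powr_minus)
      have x2: "real (2 * M) powr (- s) = 2 powr s * x"
      proof -
        have "real (4 * M) = 2 * real (2 * M)" by simp
        then show ?thesis unfolding x_def using M by (simp only: powr_mult powr_minus) simp
      qed
      obtain W where W: "finite W" "card W \<le> M"
        "\<forall>w\<in>U. \<exists>v\<in>span W. norm (w - v) \<le> D * max 1 (real M) powr (- s)"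
        using width[of M] by auto
      have maxM: "max 1 (real M) = real M" using M by simp
      have "\<tau>\<^sup>2 \<le> 2 * (D * real M powr (- s)) * (C * real (2 * M) powr (- s))"
      proof (rule greedy_block_bound[OF W(1,2) M])
        show "0 < D * real M powr (- s)" using \<open>0 < D\<close> M by simp
        show "0 \<le> \<tau>" using \<gamma> by (simp add: \<tau>_def)
        fix k assume k: "k < 2 * M"
        have kL: "2 * M + k < L" using k Suc.prems(1) N by simp
        have "\<tau> \<le> \<gamma> * residual (span (f ` {..<2 * M + k})) w"
          unfolding \<tau>_def N(2) using \<gamma> k
          by (intro mult_left_mono residual_antimono span_mono image_mono) auto
        also have "\<dots> \<le> residual (span (f ` {..<2 * M + k})) (f (2 * M + k))"
          by (rule greedy[OF kL Suc.prems(2)])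
        finally show "\<tau> \<le> residual (span (f ` {..<2 * M + k})) (f (2 * M + k))" .
        show "residual (span (f ` {..<2 * M})) (f (2 * M + k)) \<le> C * real (2 * M) powr (- s)"
          using Suc.IH[of "f (2 * M + k)"] f[OF kL] Suc.prems(1) unfolding N C_def by simp
        show "\<exists>w\<in>span W. norm (f (2 * M + k) - w) \<le> D * real M powr (- s)"
          using W(3) f[OF kL] by (auto simp: maxM)
      qed
      also have "\<dots> = (2 * 4 powr s * 2 powr s * D) * C * x\<^sup>2"
        unfolding x1 x2 by (simp add: power2_eq_square)
      also have "2 * 4 powr s * 2 powr s * D = \<gamma>\<^sup>2 * C"
      proof -
        have "(4::real) powr s * 2 powr s = 8 powr s" by (simp add: powr_mult[symmetric])
        then show ?thesis using g2 by (simp add: C_def)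
      qed
      finally have "\<tau>\<^sup>2 \<le> (\<gamma> * (C * x))\<^sup>2" by (simp add: power2_eq_square mult_ac)
      moreover have "0 \<le> \<gamma> * (C * x)" using \<gamma> x \<open>0 < D\<close> by (simp add: C_def)
      ultimately have "\<tau> \<le> \<gamma> * (C * x)" by (rule power2_le_imp_le)
      then have "residual (span (f ` {..<2 ^ Suc j})) w \<le> C * x"
        unfolding \<tau>_def using \<gamma>(1) by (rule mult_left_le_imp_le)
      then show ?thesis by (simp only: x_def C_def N)
    qed
  }
qed

section \<open>Orthonormal polynomials on an interval\<close>

text \<open>The interval is kept general because interior points are treated by cutting the interval
  there.\<close>

definition poly_avg :: "real \<Rightarrow> real \<Rightarrow> real poly \<Rightarrow> real" where
  "poly_avg a b p = integral {a..b} (poly p) / (b - a)"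

definition orthonormal_polys :: "real \<Rightarrow> real \<Rightarrow> (nat \<Rightarrow> real poly) \<Rightarrow> bool" where
  "orthonormal_polys a b L \<longleftrightarrow> L 0 = 1 \<and> (\<forall>n. degree (L n) = n) \<and>
     (\<forall>i j. poly_avg a b (L i * L j) = (if i = j then 1 else 0))"

lemma poly_integrable [simp]: "poly (p::real poly) integrable_on {a..b}"
  by (intro integrable_continuous_interval continuous_on_poly continuous_on_id)

lemma poly_avg_add: "poly_avg a b (p + q) = poly_avg a b p + poly_avg a b q"
proof -
  have "poly (p + q) = (\<lambda>x. poly p x + poly q x)" by auto
  then show ?thesis by (simp add: poly_avg_def integral_add add_divide_distrib)
qed

lemma poly_avg_smult: "poly_avg a b (smult c p) = c * poly_avg a b p"
proof -
  have "poly (smult c p) = (\<lambda>x. c * poly p x)" by auto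
  then show ?thesis by (simp add: poly_avg_def)
qed

lemma poly_avg_0 [simp]: "poly_avg a b 0 = 0"
  using poly_avg_smult[of a b 0 0] by simp

lemma poly_avg_diff: "poly_avg a b (p - q) = poly_avg a b p - poly_avg a b q"
  using poly_avg_add[of a b p "smult (-1) q"] poly_avg_smult[of a b "-1" q] by simp

lemma poly_avg_sum: "poly_avg a b (\<Sum>i\<in>A. f i) = (\<Sum>i\<in>A. poly_avg a b (f i))"
  by (induction A rule: infinite_finite_induct) (simp_all add: poly_avg_add)

lemma poly_avg_1: "a < b \<Longrightarrow> poly_avg a b 1 = 1"
proof -
  have "poly (1 :: real poly) = (\<lambda>x. 1)" by auto
  then show "a < b \<Longrightarrow> poly_avg a b 1 = 1" by (simp add: poly_avg_def)
qed

lemma poly_avg_pderiv: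
  assumes "a < b"
  shows "poly_avg a b (pderiv p) = (poly p b - poly p a) / (b - a)"
proof -
  have "(poly (pderiv p) has_integral (poly p b - poly p a)) {a..b}"
    using assms
    by (intro fundamental_theorem_of_calculus)
       (auto intro!: has_field_derivative_at_within[OF poly_DERIV]
          simp: has_real_derivative_iff_has_vector_derivative[symmetric])
  then show ?thesis by (simp add: poly_avg_def integral_unique)
qed

lemma poly_avg_square_pos:
  assumes "a < b" "p \<noteq> 0"
  shows "0 < poly_avg a b (p * p)"
proof -
  have "0 \<le> integral {a..b} (poly (p * p))"
    by (intro integral_nonneg) auto
  moreover have "integral {a..b} (poly (p * p)) \<noteq> 0"
  proof
    assume "integral {a..b} (poly (p * p)) = 0"
    then have "\<forall>x\<in>{a..b}. poly (p * p) x = 0"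
      using assms(1) by (subst (asm) integral_eq_0_iff) (auto intro!: continuous_intros)
    then have "{a..b} \<subseteq> {x. poly p x = 0}" by auto
    then have "finite {a..b}" using poly_roots_finite[OF assms(2)] finite_subset by blast
    then show False using assms(1) by (simp add: infinite_Icc)
  qed
  ultimately show ?thesis using assms(1) by (simp add: poly_avg_def)
qed

text \<open>Gram-Schmidt on the monomials. These are the Legendre polynomials of the interval,
  normalized in mean square, with signs left free except that \<open>L 0\<close> = 1.\<close>

lemma orthonormal_polys_exist:
  assumes "a < b"
  shows "\<exists>L. orthonormal_polys a b L"
proof -
  define P where "P f n r \<longleftrightarrow> degree r = n \<and> (n = 0 \<longrightarrow> r = 1) \<and> poly_avg a b (r * r) = 1
      \<and> (\<forall>k<n. poly_avg a b (r * f k) = 0)" for f :: "nat \<Rightarrow> real poly" and n r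
  have "\<exists>L. \<forall>n. P L n (L n)"
  proof (rule dependent_wellorder_choice)
    fix n and f :: "nat \<Rightarrow> real poly"
    assume IH: "\<And>k. k < n \<Longrightarrow> P f k (f k)"
    have orth: "poly_avg a b (f i * f j) = (if i = j then 1 else 0)" if "i < n" "j < n" for i j
      using IH[OF that(1)] IH[OF that(2)] unfolding P_def
      by (metis linorder_neqE_nat mult.commute)
    define q where "q = monom 1 n - (\<Sum>k<n. smult (poly_avg a b (monom 1 n * f k)) (f k))"
    have deg_f: "degree (f k) = k" if "k < n" for k using IH[OF that] by (simp add: P_def)
    have "coeff q n = 1"
      using deg_f by (auto simp: q_def coeff_sum coeff_eq_0 intro!: sum.neutral)
    moreover have "degree q \<le> n" unfolding q_def
      by (intro degree_diff_le degree_sum_le degree_monom_le)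
         (auto intro: order.trans[OF degree_smult_le] simp: deg_f)
    ultimately have deg: "degree q = n"
      using le_degree[of q n] by simp
    have "q \<noteq> 0" using \<open>coeff q n = 1\<close> by auto
    then have pos: "0 < poly_avg a b (q * q)" by (rule poly_avg_square_pos[OF assms])
    have q_orth: "poly_avg a b (q * f j) = 0" if "j < n" for j
    proof -
      have "poly_avg a b (q * f j) = poly_avg a b (monom 1 n * f j)
          - (\<Sum>k<n. poly_avg a b (monom 1 n * f k) * poly_avg a b (f k * f j))"
        by (simp add: q_def left_diff_distrib sum_distrib_right poly_avg_diff poly_avg_sum poly_avg_smult)
      also have "(\<Sum>k<n. poly_avg a b (monom 1 n * f k) * poly_avg a b (f k * f j))
          = (\<Sum>k<n. if k = j then poly_avg a b (monom 1 n * f j) else 0)"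
        using that by (intro sum.cong) (auto simp: orth)
      finally show ?thesis using that by simp
    qed
    define s where "s = 1 / sqrt (poly_avg a b (q * q))"
    show "\<exists>r. P f n r"
    proof (cases "n = 0")
      case True
      then show ?thesis using poly_avg_1[OF assms] by (auto simp: P_def)
    next
      case False
      have "s \<noteq> 0" "s * s * poly_avg a b (q * q) = 1" using pos by (auto simp: s_def)
      then have "P f n (smult s q)"
        using deg q_orth False by (simp add: P_def poly_avg_smult mult.assoc)
      then show ?thesis ..
    qed
  qed (auto simp: P_def)
  then obtain L where L: "\<And>n. P L n (L n)" by auto
  have "poly_avg a b (L i * L j) = (if i = j then 1 else 0)" for i j
    using L[of i] L[of j] unfolding P_def
    by (metis linorder_neqE_nat mult.commute)
  then have "orthonormal_polys a b L"
    using L by (auto simp: orthonormal_polys_def P_def)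
  then show ?thesis by blast
qed

text \<open>The alternative \<open>p = 0\<close> lets the induction start at n = 0, since the zero
  polynomial has degree 0.\<close>

lemma poly_in_orthonormal_span:
  assumes "\<And>k. degree (L k) = k" and L0: "L 0 \<noteq> (0::real poly)"
  shows "degree p < n \<or> p = 0 \<Longrightarrow> \<exists>c. p = (\<Sum>k<n. smult (c k) (L k))"
proof (induction n arbitrary: p)
  case (Suc n)
  have "L n \<noteq> 0" using assms(1)[of n] L0 by (cases n) auto
  then have nz: "coeff (L n) n \<noteq> 0" using leading_coeff_0_iff[of "L n"] assms(1)[of n] by metis
  define c where "c = coeff p n / coeff (L n) n"
  define q where "q = p - smult c (L n)"
  have "degree q \<le> n" unfolding q_def
    using Suc.prems assms(1)[of n]
    by (intro degree_diff_le order.trans[OF degree_smult_le]) auto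
  moreover have "coeff q n = 0" using nz by (simp add: q_def c_def)
  ultimately have "degree q < n \<or> q = 0"
    by (metis le_neq_implies_less leading_coeff_0_iff)
  then obtain d where d: "q = (\<Sum>k<n. smult (d k) (L k))" using Suc.IH by blast
  have "p = (\<Sum>k<Suc n. smult ((d(n := c)) k) (L k))"
    using d by (simp add: q_def algebra_simps)
  then show ?case by blast
qed auto

lemma orthonormal_polys_expand:
  assumes L: "orthonormal_polys a b L" and "degree p < n"
  shows "p = (\<Sum>k<n. smult (poly_avg a b (p * L k)) (L k))"
    and "poly_avg a b (p * p) = (\<Sum>k<n. (poly_avg a b (p * L k))\<^sup>2)"
    and "n \<le> j \<Longrightarrow> poly_avg a b (p * L j) = 0"
proof -
  have orth: "poly_avg a b (L i * L j) = (if i = j then 1 else 0)" for i j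
    using L by (simp add: orthonormal_polys_def)
  obtain c where c: "p = (\<Sum>k<n. smult (c k) (L k))"
    using poly_in_orthonormal_span[of L p n] L assms(2) by (auto simp: orthonormal_polys_def)
  have ip: "poly_avg a b (p * L j) = (if j < n then c j else 0)" for j
  proof -
    have "poly_avg a b (p * L j) = (\<Sum>k<n. if k = j then c j else 0)"
      unfolding c sum_distrib_right poly_avg_sum
      by (intro sum.cong) (auto simp: poly_avg_smult orth)
    then show ?thesis by simp
  qed
  show expand: "p = (\<Sum>k<n. smult (poly_avg a b (p * L k)) (L k))"
    by (subst c) (simp add: ip)
  have "poly_avg a b (p * p) = poly_avg a b (\<Sum>k<n. smult (poly_avg a b (p * L k)) (p * L k))"
    by (subst (2) expand) (simp add: sum_distrib_left)
  then show "poly_avg a b (p * p) = (\<Sum>k<n. (poly_avg a b (p * L k))\<^sup>2)"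
    by (simp add: poly_avg_sum poly_avg_smult power2_eq_square)
  show "n \<le> j \<Longrightarrow> poly_avg a b (p * L j) = 0" using ip by simp
qed

text \<open>
  The endpoint value of an orthonormal polynomial is found by integrating the derivative of
  \<open>(x - c) L(x)\<^sup>2\<close>, where \<open>c\<close> is the other endpoint: since \<open>(x - c) L' - n L\<close> has degree less
  than \<open>n\<close>, it is orthogonal to \<open>L\<close>. No formula for the Legendre polynomials is needed.
\<close>

lemma orthonormal_polys_endpoint:
  assumes L: "orthonormal_polys a b L" and "a < b" and t: "t = a \<or> t = b"
  shows "(poly (L n) t)\<^sup>2 = 2 * real n + 1"
proof -
  define c where "c = a + b - t"
  define X where "X = [:- c, 1:]"
  define R where "R = X * pderiv (L n) - smult (real n) (L n)"
  have deg: "degree (L n) = n" for n using L by (simp add: orthonormal_polys_def)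
  have norm1: "poly_avg a b (L n * L n) = 1" using L by (simp add: orthonormal_polys_def)
  have "poly_avg a b (R * L n) = 0"
  proof (cases "n = 0")
    case True
    then have "L n = 1" using L by (simp add: orthonormal_polys_def)
    then show ?thesis using True by (simp add: R_def)
  next
    case False
    have "degree (X * pderiv (L n)) \<le> n"
      using degree_mult_le[of X "pderiv (L n)"] deg[of n] False by (simp add: X_def degree_pderiv)
    then have "degree R \<le> n" unfolding R_def
      using deg[of n] by (intro degree_diff_le order.trans[OF degree_smult_le]) auto
    moreover have "coeff R n = 0"
    proof -
      obtain k where k: "n = Suc k" using False by (cases n) auto
      have "coeff (pderiv (L n)) n = 0" by (simp add: coeff_pderiv coeff_eq_0 deg)
      then show ?thesis by (simp add: R_def X_def k coeff_pderiv mult_pCons_left)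
    qed
    ultimately have "degree R < n"
      using False by (metis degree_0 gr0I le_neq_implies_less leading_coeff_0_iff)
    then show ?thesis using orthonormal_polys_expand(3)[OF L] by blast
  qed
  moreover have "pderiv (X * (L n * L n)) = L n * L n + smult 2 (X * pderiv (L n) * L n)"
  proof -
    have X1: "pderiv X = 1" by (simp add: X_def pderiv_pCons)
    have two: "smult 2 q = q + q" for q :: "real poly"
      by (metis one_add_one smult_1_left smult_add_left)
    show ?thesis by (simp only: pderiv_mult X1 two) (simp only: algebra_simps mult_1_right)
  qed
  moreover have "X * pderiv (L n) * L n = R * L n + smult (real n) (L n * L n)"
    by (simp add: R_def algebra_simps)
  ultimately have "poly_avg a b (pderiv (X * (L n * L n))) = 1 + 2 * real n"
    by (simp add: poly_avg_add poly_avg_smult norm1)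
  then have "poly (X * (L n * L n)) b - poly (X * (L n * L n)) a = (1 + 2 * real n) * (b - a)"
    using \<open>a < b\<close> by (simp add: poly_avg_pderiv field_simps)
  moreover have "poly (X * (L n * L n)) b - poly (X * (L n * L n)) a = (poly (L n) t)\<^sup>2 * (b - a)"
    using t by (auto simp: X_def c_def power2_eq_square algebra_simps)
  ultimately show ?thesis using \<open>a < b\<close> by simp
qed

text \<open>Cauchy-Schwarz for the orthonormal expansion: at an endpoint the kernel has the diagonal
  value 1 + 3 + ... + (2 n - 1) = n^2.\<close>

lemma poly_endpoint_bound:
  assumes "a < b" "t = a \<or> t = b" "degree p < n"
  shows "(poly p t)\<^sup>2 \<le> (real n)\<^sup>2 * poly_avg a b (p * p)"
proof -
  obtain L where L: "orthonormal_polys a b L" using orthonormal_polys_exist[OF assms(1)] ..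
  define c where "c k = poly_avg a b (p * L k)" for k
  have "poly p t = (\<Sum>k<n. c k * poly (L k) t)"
    by (subst orthonormal_polys_expand(1)[OF L assms(3)]) (simp add: poly_sum c_def)
  then have "(poly p t)\<^sup>2 \<le> (\<Sum>k<n. (c k)\<^sup>2) * (\<Sum>k<n. (poly (L k) t)\<^sup>2)"
    by (simp add: Cauchy_Schwarz_ineq_sum)
  also have "(\<Sum>k<n. (c k)\<^sup>2) = poly_avg a b (p * p)"
    using orthonormal_polys_expand(2)[OF L assms(3)] by (simp add: c_def)
  also have "(\<Sum>k<n. (poly (L k) t)\<^sup>2) = (\<Sum>k<n. 2 * real k + 1)"
    using orthonormal_polys_endpoint[OF L assms(1,2)] by simp
  also have "(\<Sum>k<n. 2 * real k + 1) = (real n)\<^sup>2"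
    by (induction n) (auto simp: power2_eq_square algebra_simps)
  finally show ?thesis by (simp add: mult.commute)
qed

text \<open>An interior \<open>t\<close> is an endpoint of both [a, t] and [t, b]; the two endpoint
  bounds are added with the lengths as weights.\<close>

lemma poly_point_bound:
  assumes "a < b" "t \<in> {a..b}" "degree p < n"
  shows "(poly p t)\<^sup>2 \<le> (real n)\<^sup>2 * poly_avg a b (p * p)"
proof (cases "t = a \<or> t = b")
  case True
  then show ?thesis using poly_endpoint_bound assms by blast
next
  case False
  then have t: "a < t" "t < b" using assms by auto
  let ?I = "\<lambda>x y. integral {x..y} (poly (p * p))"
  have "(poly p t)\<^sup>2 * (t - a) \<le> (real n)\<^sup>2 * ?I a t"
    using poly_endpoint_bound[of a t t p n] t assms by (simp add: poly_avg_def field_simps)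
  moreover have "(poly p t)\<^sup>2 * (b - t) \<le> (real n)\<^sup>2 * ?I t b"
    using poly_endpoint_bound[of t b t p n] t assms by (simp add: poly_avg_def field_simps)
  moreover have "?I a t + ?I t b = ?I a b"
    using t by (intro Henstock_Kurzweil_Integration.integral_combine) auto
  ultimately have "(poly p t)\<^sup>2 * (b - a) \<le> (real n)\<^sup>2 * ?I a b"
    by (simp only: flip: \<open>?I a t + ?I t b = ?I a b\<close>) (simp add: algebra_simps)
  then show ?thesis using assms(1) by (simp add: poly_avg_def field_simps)
qed

text \<open>The kernel K at \<open>t\<close> is itself a polynomial of degree less than n, and both
  K(t) and the average of K^2 equal the sum S. The pointwise bound applied to K reads S^2 \<le> n^2
  S.\<close>

lemma orthonormal_polys_kernel_bound:
  assumes L: "orthonormal_polys a b L" and "a < b" "t \<in> {a..b}"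
  shows "(\<Sum>k<n. (poly (L k) t)\<^sup>2) \<le> (real n)\<^sup>2"
proof (cases "n = 0")
  case False
  define K where "K = (\<Sum>k<n. smult (poly (L k) t) (L k))"
  have deg: "degree (L k) = k" for k using L by (simp add: orthonormal_polys_def)
  have "degree K \<le> n - 1" unfolding K_def
    by (intro degree_sum_le order.trans[OF degree_smult_le]) (auto simp: deg)
  then have degK: "degree K < n" using False by simp
  define S where "S = (\<Sum>k<n. (poly (L k) t)\<^sup>2)"
  have Kt: "poly K t = S" by (simp add: K_def S_def poly_sum power2_eq_square)
  have ip: "poly_avg a b (K * L j) = poly (L j) t" if "j < n" for j
  proof -
    have "poly_avg a b (K * L j) = (\<Sum>k<n. if k = j then poly (L j) t else 0)"
      unfolding K_def sum_distrib_right poly_avg_sum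
      using L by (intro sum.cong) (auto simp: poly_avg_smult orthonormal_polys_def)
    then show ?thesis using that by simp
  qed
  have KK: "poly_avg a b (K * K) = S"
    using orthonormal_polys_expand(2)[OF L degK] ip by (simp add: S_def)
  have "S * S \<le> (real n)\<^sup>2 * S"
    using poly_point_bound[OF assms(2,3) degK] unfolding Kt KK by (simp add: power2_eq_square)
  moreover have "0 \<le> S" by (simp add: S_def sum_nonneg)
  ultimately have "S \<le> (real n)\<^sup>2"
    by (metis mult_right_le_imp_le order_le_less zero_le_power2)
  then show ?thesis by (simp add: S_def)
qed simp

section \<open>Sparse polynomials on the parameter domain\<close>

definition legendre :: "nat \<Rightarrow> real poly" where
  "legendre = (SOME L. orthonormal_polys (-1) 1 L)"

lemma orthonormal_legendre: "orthonormal_polys (-1) 1 legendre"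
  unfolding legendre_def by (rule someI_ex[OF orthonormal_polys_exist]) simp

definition tensor_legendre :: "nat set \<Rightarrow> (nat \<Rightarrow> nat) \<Rightarrow> param \<Rightarrow> real" where
  "tensor_legendre S \<nu> y = (\<Prod>j\<in>S. poly (legendre (\<nu> j)) (y j))"

text \<open>The partial sums of x are dominated by those of 2 k + 1, and c^2 decreases, so summation
  by parts replaces x k by 2 k + 1. Then n c(n) \<le> c(0) + ... + c(n - 1) gives the square of the
  sum.\<close>

lemma sum_weighted_squares_le:
  fixes x c :: "nat \<Rightarrow> real"
  assumes c: "\<And>k. 0 \<le> c k" "\<And>k. c (Suc k) \<le> c k"
    and x: "\<And>n. (\<Sum>k<n. x k) \<le> (real n)\<^sup>2"
  shows "(\<Sum>k<n. x k * (c k)\<^sup>2) \<le> (\<Sum>k<n. c k)\<^sup>2"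
proof -
  \<comment> \<open>The extra term on the left is the boundary term of the summation by parts; it is
    what makes the induction go through.\<close>
  have "(\<Sum>k<n. x k * (c k)\<^sup>2) + ((real n)\<^sup>2 - (\<Sum>k<n. x k)) * (c n)\<^sup>2 \<le> (\<Sum>k<n. (2 * real k + 1) * (c k)\<^sup>2)"
  proof (induction n)
    case (Suc n)
    have "((real (Suc n))\<^sup>2 - (\<Sum>k<Suc n. x k)) * (c (Suc n))\<^sup>2
        \<le> ((real (Suc n))\<^sup>2 - (\<Sum>k<Suc n. x k)) * (c n)\<^sup>2"
      using x[of "Suc n"] c by (intro mult_left_mono power_mono) auto
    also have "\<dots> = ((real n)\<^sup>2 - (\<Sum>k<n. x k)) * (c n)\<^sup>2 + (2 * real n + 1) * (c n)\<^sup>2 - x n * (c n)\<^sup>2"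
      by (simp add: power2_eq_square algebra_simps)
    finally show ?case using Suc by simp
  qed simp
  moreover have "0 \<le> ((real n)\<^sup>2 - (\<Sum>k<n. x k)) * (c n)\<^sup>2"
    using x[of n] by simp
  moreover have "(\<Sum>k<n. (2 * real k + 1) * (c k)\<^sup>2) \<le> (\<Sum>k<n. c k)\<^sup>2 \<and> real n * c n \<le> (\<Sum>k<n. c k)"
  proof (induction n)
    case (Suc n)
    have "real n * c n * c n \<le> (\<Sum>k<n. c k) * c n" using Suc c(1) by (intro mult_right_mono) auto
    moreover have "(\<Sum>k<Suc n. c k)\<^sup>2 = (\<Sum>k<n. c k)\<^sup>2 + 2 * ((\<Sum>k<n. c k) * c n) + (c n)\<^sup>2"
      by (simp add: power2_eq_square algebra_simps)
    moreover have "(\<Sum>k<Suc n. (2 * real k + 1) * (c k)\<^sup>2)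
        = (\<Sum>k<n. (2 * real k + 1) * (c k)\<^sup>2) + 2 * (real n * c n * c n) + (c n)\<^sup>2"
      by (simp add: power2_eq_square algebra_simps)
    moreover have "real n * c (Suc n) \<le> real n * c n" using c(2) by (intro mult_left_mono) auto
    ultimately show ?case using Suc c(2)[of n] by (auto simp: algebra_simps)
  qed simp
  ultimately show ?thesis by linarith
qed

definition lower_set_on :: "nat set \<Rightarrow> (nat \<Rightarrow> nat) set \<Rightarrow> bool" where
  "lower_set_on S \<Lambda> \<longleftrightarrow> finite \<Lambda> \<and> (\<forall>\<nu>\<in>\<Lambda>. \<forall>j. j \<notin> S \<longrightarrow> \<nu> j = 0) \<and>
     (\<forall>\<nu>\<in>\<Lambda>. \<forall>\<mu>. (\<forall>j. \<mu> j \<le> \<nu> j) \<longrightarrow> \<mu> \<in> \<Lambda>)"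

text \<open>Slice \<open>\<Lambda>\<close> by the value k of one coordinate. The slices are lower
  sets that decrease in k and have total cardinality card \<open>\<Lambda>\<close>. The induction
  hypothesis bounds each slice by the square of its cardinality, and
  \<open>sum_weighted_squares_le\<close> joins these with the univariate kernel bound.\<close>

lemma tensor_kernel_bound:
  assumes "finite S" "\<And>j. j \<in> S \<Longrightarrow> y j \<in> {-1..1}" "lower_set_on S \<Lambda>"
  shows "(\<Sum>\<nu>\<in>\<Lambda>. (tensor_legendre S \<nu> y)\<^sup>2) \<le> (real (card \<Lambda>))\<^sup>2"
  using assms
proof (induction S arbitrary: \<Lambda> rule: finite_induct)
  case empty
  then have "\<Lambda> \<subseteq> {\<lambda>_. 0}" by (auto simp: lower_set_on_def)
  then have "\<Lambda> = {} \<or> \<Lambda> = {\<lambda>_. 0}" by auto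
  then show ?case by (auto simp: tensor_legendre_def)
next
  case (insert i S)
  have \<Lambda>: "finite \<Lambda>" "\<And>\<nu> j. \<nu> \<in> \<Lambda> \<Longrightarrow> j \<noteq> i \<Longrightarrow> j \<notin> S \<Longrightarrow> \<nu> j = 0"
    "\<And>\<nu> \<mu>. \<nu> \<in> \<Lambda> \<Longrightarrow> (\<And>j. \<mu> j \<le> \<nu> j) \<Longrightarrow> \<mu> \<in> \<Lambda>"
    using insert.prems(2) unfolding lower_set_on_def by blast+
  \<comment> \<open>Resetting coordinate \<open>i\<close> to 0 makes the slices comparable and
    places them on \<open>S\<close>.\<close>
  define A where "A k = {\<mu>. \<mu> i = 0 \<and> \<mu>(i := k) \<in> \<Lambda>}" for k
  have inj: "inj_on (\<lambda>\<mu>. \<mu>(i := k)) (A k)" for k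
    by (rule inj_onI) (auto simp: A_def fun_eq_iff split: if_splits, metis)
  have finA: "finite (A k)" for k
    by (rule finite_imageD[OF _ inj[of k]], rule finite_subset[OF _ \<Lambda>(1)]) (auto simp: A_def)
  have lowA: "lower_set_on S (A k)" for k
  proof -
    have "\<nu> j = 0" if "\<nu> \<in> A k" "j \<notin> S" for \<nu> j
      using \<Lambda>(2)[of "\<nu>(i := k)" j] that by (cases "j = i") (auto simp: A_def)
    moreover have "\<mu> \<in> A k" if "\<nu> \<in> A k" "\<And>j. \<mu> j \<le> \<nu> j" for \<mu> \<nu>
    proof -
      have "\<mu> i = 0" using that(2)[of i] that(1) by (simp add: A_def)
      moreover have "\<mu>(i := k) \<in> \<Lambda>"
        by (rule \<Lambda>(3)[of "\<nu>(i := k)"]) (use that in \<open>auto simp: A_def\<close>)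
      ultimately show ?thesis by (simp add: A_def)
    qed
    ultimately show ?thesis using finA by (auto simp: lower_set_on_def)
  qed
  have decr: "A (Suc k) \<subseteq> A k" for k
  proof
    fix \<mu> assume \<mu>: "\<mu> \<in> A (Suc k)"
    have "\<mu>(i := k) \<in> \<Lambda>"
      by (rule \<Lambda>(3)[of "\<mu>(i := Suc k)"]) (use \<mu> in \<open>auto simp: A_def\<close>)
    then show "\<mu> \<in> A k" using \<mu> by (simp add: A_def)
  qed
  obtain n where n: "\<And>\<nu>. \<nu> \<in> \<Lambda> \<Longrightarrow> \<nu> i < n"
    using finite_nat_set_iff_bounded[of "(\<lambda>\<nu>. \<nu> i) ` \<Lambda>"] \<Lambda>(1) by auto
  have split: "(\<Sum>\<nu>\<in>\<Lambda>. h \<nu>) = (\<Sum>k<n. \<Sum>\<mu>\<in>A k. h (\<mu>(i := k)))" for h :: "_ \<Rightarrow> real"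
  proof -
    have "(\<Sum>\<nu>\<in>\<Lambda>. h \<nu>) = (\<Sum>(k, \<mu>)\<in>Sigma {..<n} A. h (\<mu>(i := k)))"
      by (rule sum.reindex_bij_witness[where j = "\<lambda>\<nu>. (\<nu> i, \<nu>(i := 0))" and i = "\<lambda>(k, \<mu>). \<mu>(i := k)"])
         (auto simp: A_def n fun_upd_idem)
    also have "\<dots> = (\<Sum>k<n. \<Sum>\<mu>\<in>A k. h (\<mu>(i := k)))"
      by (rule sum.Sigma[symmetric]) (auto simp: finA)
    finally show ?thesis .
  qed
  have card: "real (card \<Lambda>) = (\<Sum>k<n. real (card (A k)))"
    using split[of "\<lambda>_. 1"] by simp
  define x where "x k = (poly (legendre k) (y i))\<^sup>2" for k
  have "(\<Sum>\<nu>\<in>\<Lambda>. (tensor_legendre (insert i S) \<nu> y)\<^sup>2)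
      = (\<Sum>k<n. x k * (\<Sum>\<mu>\<in>A k. (tensor_legendre S \<mu> y)\<^sup>2))"
  proof -
    have "tensor_legendre (insert i S) (\<mu>(i := k)) y = poly (legendre k) (y i) * tensor_legendre S \<mu> y" for \<mu> k
      unfolding tensor_legendre_def using insert.hyps
      by (auto intro!: prod.cong)
    then show ?thesis by (simp add: split x_def sum_distrib_left power_mult_distrib)
  qed
  also have "\<dots> \<le> (\<Sum>k<n. x k * (real (card (A k)))\<^sup>2)"
    using insert.IH[OF _ lowA] insert.prems(1) by (intro sum_mono mult_left_mono) (auto simp: x_def)
  also have "\<dots> \<le> (\<Sum>k<n. real (card (A k)))\<^sup>2"
  proof (rule sum_weighted_squares_le)
    show "(\<Sum>k<n. x k) \<le> (real n)\<^sup>2" for n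
      unfolding x_def using insert.prems(1)
      by (intro orthonormal_polys_kernel_bound[OF orthonormal_legendre]) auto
  qed (auto intro!: card_mono finA decr)
  finally show ?case by (simp add: card)
qed

section \<open>Change of basis from monomials to tensor Legendre polynomials\<close>

lemma power_legendre: "\<exists>c. \<forall>t. t ^ k = (\<Sum>i\<le>k. c i * poly (legendre i) t)"
proof -
  have "monom 1 k = (\<Sum>i<Suc k. smult (poly_avg (-1) 1 (monom 1 k * legendre i)) (legendre i))"
    by (rule orthonormal_polys_expand(1)[OF orthonormal_legendre]) (simp add: degree_monom_eq)
  then have "poly (monom 1 k) t = (\<Sum>i<Suc k. poly_avg (-1) 1 (monom 1 k * legendre i) * poly (legendre i) t)" for t
    by (metis (no_types, lifting) poly_smult poly_sum sum.cong)
  then show ?thesis by (auto simp: poly_monom lessThan_Suc_atMost)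
qed

definition index_box :: "nat set \<Rightarrow> (nat \<Rightarrow> nat) \<Rightarrow> (nat \<Rightarrow> nat) set" where
  "index_box S \<nu> = {\<mu>. (\<forall>j\<in>S. \<mu> j \<le> \<nu> j) \<and> (\<forall>j. j \<notin> S \<longrightarrow> \<mu> j = 0)}"

lemma prod_power_tensor:
  assumes "finite S"
  shows "finite (index_box S \<nu>) \<and>
    (\<exists>b. \<forall>y. (\<Prod>j\<in>S. y j ^ \<nu> j) = (\<Sum>\<mu>\<in>index_box S \<nu>. b \<mu> * tensor_legendre S \<mu> y))"
  using assms
proof (induction S rule: finite_induct)
  case empty
  have "index_box {} \<nu> = {\<lambda>_. 0}" by (auto simp: index_box_def)
  then show ?case by (auto simp: tensor_legendre_def intro!: exI[of _ "\<lambda>_. 1"])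
next
  case (insert i S)
  obtain b where b: "finite (index_box S \<nu>)"
    "\<And>y. (\<Prod>j\<in>S. y j ^ \<nu> j) = (\<Sum>\<mu>\<in>index_box S \<nu>. b \<mu> * tensor_legendre S \<mu> y)"
    using insert.IH by blast
  obtain c where c: "\<And>t. t ^ \<nu> i = (\<Sum>k\<le>\<nu> i. c k * poly (legendre k) t)"
    using power_legendre by blast
  have box: "index_box (insert i S) \<nu> = (\<lambda>(k, \<mu>). \<mu>(i := k)) ` ({..\<nu> i} \<times> index_box S \<nu>)"
  proof (rule equalityI; rule subsetI)
    fix \<mu> assume \<mu>: "\<mu> \<in> index_box (insert i S) \<nu>"
    then have "(\<mu> i, \<mu>(i := 0)) \<in> {..\<nu> i} \<times> index_box S \<nu>"
      using insert.hyps by (auto simp: index_box_def)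
    moreover have "\<mu> = (\<lambda>(k, \<mu>). \<mu>(i := k)) (\<mu> i, \<mu>(i := 0))" by simp
    ultimately show "\<mu> \<in> (\<lambda>(k, \<mu>). \<mu>(i := k)) ` ({..\<nu> i} \<times> index_box S \<nu>)" by (rule rev_image_eqI)
  qed (use insert.hyps in \<open>auto simp: index_box_def\<close>)
  have tens: "tensor_legendre (insert i S) \<mu> y = poly (legendre (\<mu> i)) (y i) * tensor_legendre S (\<mu>(i := 0)) y" for \<mu> y
    unfolding tensor_legendre_def using insert.hyps
    by (auto intro!: prod.cong)
  have zero: "\<mu> i = 0" if "\<mu> \<in> index_box S \<nu>" for \<mu>
    using that insert.hyps by (auto simp: index_box_def)
  have "(\<Prod>j\<in>insert i S. y j ^ \<nu> j)
      = (\<Sum>\<mu>\<in>index_box (insert i S) \<nu>. (c (\<mu> i) * b (\<mu>(i := 0))) * tensor_legendre (insert i S) \<mu> y)" for y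
  proof -
    have "(\<Prod>j\<in>insert i S. y j ^ \<nu> j)
        = (\<Sum>k\<le>\<nu> i. c k * poly (legendre k) (y i)) * (\<Sum>\<mu>\<in>index_box S \<nu>. b \<mu> * tensor_legendre S \<mu> y)"
      using insert.hyps by (simp add: b(2) c)
    also have "\<dots> = (\<Sum>(k, \<mu>)\<in>{..\<nu> i} \<times> index_box S \<nu>.
        (c k * b \<mu>) * (poly (legendre k) (y i) * tensor_legendre S \<mu> y))"
      unfolding sum_product sum.cartesian_product by (intro sum.cong) auto
    also have "\<dots> = (\<Sum>\<mu>\<in>index_box (insert i S) \<nu>. (c (\<mu> i) * b (\<mu>(i := 0))) * tensor_legendre (insert i S) \<mu> y)"
      by (rule sum.reindex_bij_witness[where i = "\<lambda>\<mu>. (\<mu> i, \<mu>(i := 0))" and j = "\<lambda>(k, \<mu>). \<mu>(i := k)"])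
         (use insert.hyps zero in \<open>auto simp: tens fun_upd_idem index_box_def\<close>)
    finally show ?thesis .
  qed
  moreover have "finite (index_box (insert i S) \<nu>)" unfolding box using b(1) by auto
  ultimately show ?case by (intro conjI exI[of _ "\<lambda>\<mu>. c (\<mu> i) * b (\<mu>(i := 0))"]) auto
qed

lemma monomial_eq_prod:
  assumes "finite S" "\<And>j. j \<notin> S \<Longrightarrow> \<nu> j = 0"
  shows "monomial \<nu> y = (\<Prod>j\<in>S. y j ^ \<nu> j)"
proof -
  have "{j. \<nu> j \<noteq> 0} \<subseteq> S" by (rule subsetI, rule ccontr) (use assms(2) in auto)
  then show ?thesis unfolding monomial_def using assms(1) by (intro prod.mono_neutral_left) auto
qed

text \<open>The change of basis is triangular for the componentwise order: a monomial only involves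
  indices below its own. Being a lower set keeps all of these in \<open>\<Lambda>\<close>.\<close>

lemma sparse_poly_legendre:
  fixes a :: "(nat \<Rightarrow> nat) \<Rightarrow> 'v::real_vector"
  assumes "finite S" "lower_set_on S \<Lambda>"
  shows "\<exists>c. \<forall>y. (\<Sum>\<nu>\<in>\<Lambda>. monomial \<nu> y *\<^sub>R a \<nu>) = (\<Sum>\<mu>\<in>\<Lambda>. tensor_legendre S \<mu> y *\<^sub>R c \<mu>)"
proof -
  obtain b where b: "\<And>\<nu> y. (\<Prod>j\<in>S. y j ^ \<nu> j) = (\<Sum>\<mu>\<in>index_box S \<nu>. b \<nu> \<mu> * tensor_legendre S \<mu> y)"
    using prod_power_tensor[OF assms(1)] by metis
  define b' where "b' \<nu> \<mu> = (if \<mu> \<in> index_box S \<nu> then b \<nu> \<mu> else 0)" for \<nu> \<mu>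
  have mono: "monomial \<nu> y = (\<Sum>\<mu>\<in>\<Lambda>. b' \<nu> \<mu> * tensor_legendre S \<mu> y)" if \<nu>: "\<nu> \<in> \<Lambda>" for \<nu> y
  proof -
    have zero: "\<nu> j = 0" if "j \<notin> S" for j using assms(2) \<nu> that by (auto simp: lower_set_on_def)
    have sub: "index_box S \<nu> \<subseteq> \<Lambda>"
    proof
      fix \<mu> assume "\<mu> \<in> index_box S \<nu>"
      then have "\<mu> j \<le> \<nu> j" for j by (cases "j \<in> S") (auto simp: index_box_def)
      then show "\<mu> \<in> \<Lambda>" using assms(2) \<nu> by (auto simp: lower_set_on_def)
    qed
    have "monomial \<nu> y = (\<Sum>\<mu>\<in>index_box S \<nu>. b \<nu> \<mu> * tensor_legendre S \<mu> y)"
      using monomial_eq_prod[OF assms(1) zero] b by simp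
    also have "\<dots> = (\<Sum>\<mu>\<in>\<Lambda>. b' \<nu> \<mu> * tensor_legendre S \<mu> y)"
      using sub assms(2) by (intro sum.mono_neutral_cong_left) (auto simp: b'_def lower_set_on_def)
    finally show ?thesis .
  qed
  have "(\<Sum>\<nu>\<in>\<Lambda>. monomial \<nu> y *\<^sub>R a \<nu>) = (\<Sum>\<mu>\<in>\<Lambda>. tensor_legendre S \<mu> y *\<^sub>R (\<Sum>\<nu>\<in>\<Lambda>. b' \<nu> \<mu> *\<^sub>R a \<nu>))" for y
  proof -
    have "(\<Sum>\<nu>\<in>\<Lambda>. monomial \<nu> y *\<^sub>R a \<nu>) = (\<Sum>\<nu>\<in>\<Lambda>. \<Sum>\<mu>\<in>\<Lambda>. (b' \<nu> \<mu> * tensor_legendre S \<mu> y) *\<^sub>R a \<nu>)"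
      by (simp add: mono scaleR_sum_left)
    also have "\<dots> = (\<Sum>\<mu>\<in>\<Lambda>. \<Sum>\<nu>\<in>\<Lambda>. (b' \<nu> \<mu> * tensor_legendre S \<mu> y) *\<^sub>R a \<nu>)"
      by (rule sum.swap)
    finally show ?thesis by (simp add: scaleR_sum_right mult.commute)
  qed
  then show ?thesis by (intro exI allI)
qed

text \<open>Finitely many multi-indices involve finitely many coordinates, which reduces d =
  \<infinity> to the finite case.\<close>

lemma downward_closed_lower_set_on:
  assumes "downward_closed d \<Lambda>" "finite \<Lambda>"
  defines "S \<equiv> \<Union>\<nu>\<in>\<Lambda>. {j. \<nu> j \<noteq> 0}"
  shows "finite S" "S \<subseteq> coords d" "lower_set_on S \<Lambda>"
proof -
  have \<Lambda>: "\<Lambda> \<subseteq> multi_indices d" using assms(1) by (simp add: downward_closed_def)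
  show "finite S" "S \<subseteq> coords d" using \<Lambda> assms(2) by (auto simp: S_def multi_indices_def)
  have "\<mu> \<in> \<Lambda>" if "\<nu> \<in> \<Lambda>" "\<And>j. \<mu> j \<le> \<nu> j" for \<mu> \<nu>
  proof -
    have "{j. \<mu> j \<noteq> 0} \<subseteq> {j. \<nu> j \<noteq> 0}" using that(2) by (metis (mono_tags, lifting) Collect_mono le_zero_eq)
    moreover have "finite {j. \<nu> j \<noteq> 0}" "{j. \<nu> j \<noteq> 0} \<subseteq> coords d"
      using \<Lambda> that(1) by (auto simp: multi_indices_def)
    ultimately have "\<mu> \<in> multi_indices d"
      unfolding multi_indices_def using finite_subset by blast
    then show ?thesis using assms(1) that by (auto simp: downward_closed_def)
  qed
  then show "lower_set_on S \<Lambda>" using assms(2) by (auto simp: lower_set_on_def S_def)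
qed

subsection \<open>Integration over the parameter domain\<close>

definition interval_measure_unif :: "real measure" where
  "interval_measure_unif = uniform_measure (restrict_space lborel {-1..1}) {-1..1}"

lemma prob_space_unif: "prob_space interval_measure_unif"
  unfolding interval_measure_unif_def
  by (rule prob_space_uniform_measure) (auto simp: emeasure_restrict_space)

lemma space_unif: "space interval_measure_unif = {-1..1}"
  by (simp add: interval_measure_unif_def space_restrict_space)

lemma poly_measurable_unif [measurable]: "poly p \<in> borel_measurable interval_measure_unif"
proof -
  have "poly p \<in> borel_measurable (restrict_space lborel {-1..1})"
    by (intro measurable_restrict_space1) (auto intro!: borel_measurable_continuous_onI continuous_intros)
  then show ?thesis by (simp add: interval_measure_unif_def cong: measurable_cong_sets)
qed

lemma integral_unif: "integral\<^sup>L interval_measure_unif (poly p) = poly_avg (-1) 1 p"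
proof -
  let ?R = "restrict_space lborel {-1..1::real}"
  have dens: "interval_measure_unif = density ?R (\<lambda>x. ennreal (1 / 2))"
    unfolding interval_measure_unif_def uniform_measure_def
  proof (rule density_cong)
    have "{-1..1} \<in> sets ?R" by (auto simp: sets_restrict_space_iff)
    then show "(\<lambda>x. indicator {-1..1} x / emeasure ?R {-1..1}) \<in> borel_measurable ?R"
      unfolding divide_ennreal_def by measurable
    show "AE x in ?R. indicator {-1..1} x / emeasure ?R {-1..1} = ennreal (1 / 2)"
      by (rule AE_I2)
        (simp add: space_restrict_space emeasure_restrict_space divide_ennreal_def flip: divide_ennreal ennreal_numeral)
  qed auto
  have "poly p \<in> borel_measurable ?R"
    by (intro measurable_restrict_space1) (auto intro!: borel_measurable_continuous_onI continuous_intros)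
  then have "integral\<^sup>L interval_measure_unif (poly p) = (\<integral>x. (1 / 2) *\<^sub>R poly p x \<partial>?R)"
    unfolding dens by (rule integral_density) auto
  also have "\<dots> = (LINT x:{-1..1}|lborel. poly p x) / 2"
    by (simp add: integral_restrict_space set_lebesgue_integral_def)
  also have "\<dots> = poly_avg (-1) 1 p"
    unfolding poly_avg_def
    by (subst set_borel_integral_eq_integral(2)) (auto intro!: borel_integrable_atLeastAtMost' continuous_intros)
  finally show ?thesis .
qed

lemma integrable_unif: "integrable interval_measure_unif (poly p)"
proof -
  interpret prob_space interval_measure_unif by (rule prob_space_unif)
  have "compact (poly p ` {-1..1})" by (intro compact_continuous_image continuous_intros) auto
  then obtain B where "\<And>x. x \<in> {-1..1} \<Longrightarrow> norm (poly p x) \<le> B"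
    using compact_imp_bounded bounded_iff by (metis imageI)
  then show ?thesis
    by (intro integrable_const_bound[of _ B] AE_I2) (auto simp: space_unif)
qed

interpretation unif_product: product_prob_space "\<lambda>_::nat. interval_measure_unif" "I" for I
  by (intro product_prob_spaceI prob_space_unif)

lemma param_measure_eq: "param_measure d = (\<Pi>\<^sub>M j\<in>coords d. interval_measure_unif)"
  by (simp add: param_measure_def interval_measure_unif_def)

lemma prob_space_param: "prob_space (param_measure d)"
  unfolding param_measure_eq by (intro prob_space_PiM prob_space_unif)

lemma coord_measurable:
  assumes "j \<in> coords d"
  shows "(\<lambda>y. y j) \<in> param_measure d \<rightarrow>\<^sub>M interval_measure_unif"
  unfolding param_measure_eq using assms by measurable

text \<open>The integrand depends on the coordinates in \<open>S\<close> only, and the marginal of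
  the product measure there is a finite product, to which Fubini applies.\<close>

lemma tensor_integral:
  assumes "finite S" "S \<subseteq> coords d"
  shows "integrable (param_measure d) (\<lambda>y. tensor_legendre S \<mu> y * tensor_legendre S \<nu> y)"
    and "(\<integral>y. tensor_legendre S \<mu> y * tensor_legendre S \<nu> y \<partial>param_measure d)
      = (if \<forall>j\<in>S. \<mu> j = \<nu> j then 1 else 0)"
proof -
  let ?f = "\<lambda>j. poly (legendre (\<mu> j) * legendre (\<nu> j))"
  let ?PS = "\<Pi>\<^sub>M j\<in>S. interval_measure_unif"
  define F where "F y = (\<Prod>j\<in>S. ?f j (y j))" for y :: param
  have F: "tensor_legendre S \<mu> y * tensor_legendre S \<nu> y = F (restrict y S)" for y
    unfolding F_def tensor_legendre_def by (simp add: prod.distrib[symmetric])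
  have distr: "distr (param_measure d) ?PS (\<lambda>y. restrict y S) = ?PS"
    unfolding param_measure_eq by (rule unif_product.distr_PiM_restrict_finite[OF assms])
  have restr: "(\<lambda>y. restrict y S) \<in> param_measure d \<rightarrow>\<^sub>M ?PS"
    unfolding param_measure_eq by (rule measurable_restrict_subset[OF assms(2)])
  have intF: "integrable ?PS F"
    unfolding F_def by (rule unif_product.product_integrable_prod[OF assms(1) integrable_unif])
  then have "integrable (distr (param_measure d) ?PS (\<lambda>y. restrict y S)) F" by (simp only: distr)
  then show "integrable (param_measure d) (\<lambda>y. tensor_legendre S \<mu> y * tensor_legendre S \<nu> y)"
    unfolding F by (rule integrable_distr[OF restr])
  have "(\<integral>y. tensor_legendre S \<mu> y * tensor_legendre S \<nu> y \<partial>param_measure d) = integral\<^sup>L ?PS F"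
    unfolding F using integral_distr[OF restr, of F] intF by (simp add: distr)
  also have "\<dots> = (\<Prod>j\<in>S. poly_avg (-1) 1 (legendre (\<mu> j) * legendre (\<nu> j)))"
    unfolding F_def by (simp only: unif_product.product_integral_prod[OF assms(1) integrable_unif] integral_unif)
  also have "\<dots> = (\<Prod>j\<in>S. if \<mu> j = \<nu> j then 1 else 0)"
    using orthonormal_legendre by (simp add: orthonormal_polys_def)
  also have "\<dots> = (if \<forall>j\<in>S. \<mu> j = \<nu> j then 1 else 0)"
    using assms(1) by (auto intro!: prod.neutral)
  finally show "(\<integral>y. tensor_legendre S \<mu> y * tensor_legendre S \<nu> y \<partial>param_measure d)
      = (if \<forall>j\<in>S. \<mu> j = \<nu> j then 1 else 0)" .
qed

text \<open>In the orthonormal basis the integral is the sum of the squared coefficient norms, and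
  Cauchy-Schwarz leaves the diagonal of the kernel as the only other factor.\<close>

lemma sparse_poly_point_bound:
  fixes a :: "(nat \<Rightarrow> nat) \<Rightarrow> 'v::real_inner"
  assumes "downward_closed d \<Lambda>" "finite \<Lambda>"
  defines "Q \<equiv> \<lambda>y. \<Sum>\<nu>\<in>\<Lambda>. monomial \<nu> y *\<^sub>R a \<nu>"
  shows "integrable (param_measure d) (\<lambda>y. (norm (Q y))\<^sup>2)"
    and "y \<in> param_domain d \<Longrightarrow>
      (norm (Q y))\<^sup>2 \<le> (real (card \<Lambda>))\<^sup>2 * (\<integral>y. (norm (Q y))\<^sup>2 \<partial>param_measure d)"
proof -
  define S where "S = (\<Union>\<nu>\<in>\<Lambda>. {j. \<nu> j \<noteq> 0})"
  have S: "finite S" "S \<subseteq> coords d" "lower_set_on S \<Lambda>"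
    using downward_closed_lower_set_on[OF assms(1,2)] by (auto simp: S_def)
  obtain c where c: "\<And>y. Q y = (\<Sum>\<mu>\<in>\<Lambda>. tensor_legendre S \<mu> y *\<^sub>R c \<mu>)"
    using sparse_poly_legendre[OF S(1,3), of a] unfolding Q_def by blast
  have eq_iff: "(\<forall>j\<in>S. \<mu> j = \<nu> j) \<longleftrightarrow> \<mu> = \<nu>" if "\<mu> \<in> \<Lambda>" "\<nu> \<in> \<Lambda>" for \<mu> \<nu>
    using S(3) that unfolding lower_set_on_def fun_eq_iff by metis
  have sq: "(norm (Q y))\<^sup>2
      = (\<Sum>\<mu>\<in>\<Lambda>. \<Sum>\<nu>\<in>\<Lambda>. inner (c \<mu>) (c \<nu>) * (tensor_legendre S \<mu> y * tensor_legendre S \<nu> y))" for y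
    unfolding power2_norm_eq_inner c
    by (simp add: inner_sum_left inner_sum_right sum_distrib_left mult_ac inner_commute)
  show "integrable (param_measure d) (\<lambda>y. (norm (Q y))\<^sup>2)"
    unfolding sq by (intro Bochner_Integration.integrable_sum integrable_mult_right tensor_integral S)
  have "(\<integral>y. (norm (Q y))\<^sup>2 \<partial>param_measure d)
      = (\<Sum>\<mu>\<in>\<Lambda>. \<Sum>\<nu>\<in>\<Lambda>. inner (c \<mu>) (c \<nu>) * (if \<forall>j\<in>S. \<mu> j = \<nu> j then 1 else 0))"
    unfolding sq using tensor_integral[OF S(1,2)]
    by (simp add: Bochner_Integration.integral_sum Bochner_Integration.integrable_sum)
  also have "\<dots> = (\<Sum>\<mu>\<in>\<Lambda>. \<Sum>\<nu>\<in>\<Lambda>. if \<mu> = \<nu> then inner (c \<mu>) (c \<mu>) else 0)"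
    by (intro sum.cong) (auto simp: eq_iff)
  also have "\<dots> = (\<Sum>\<mu>\<in>\<Lambda>. (norm (c \<mu>))\<^sup>2)"
    using assms(2) by (simp add: power2_norm_eq_inner)
  finally have int: "(\<integral>y. (norm (Q y))\<^sup>2 \<partial>param_measure d) = (\<Sum>\<mu>\<in>\<Lambda>. (norm (c \<mu>))\<^sup>2)" .
  assume y: "y \<in> param_domain d"
  have "norm (Q y) \<le> (\<Sum>\<mu>\<in>\<Lambda>. \<bar>tensor_legendre S \<mu> y\<bar> * norm (c \<mu>))"
    unfolding c by (rule order.trans[OF norm_sum]) simp
  then have "(norm (Q y))\<^sup>2 \<le> (\<Sum>\<mu>\<in>\<Lambda>. \<bar>tensor_legendre S \<mu> y\<bar> * norm (c \<mu>))\<^sup>2"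
    by (intro power_mono) auto
  also have "\<dots> \<le> (\<Sum>\<mu>\<in>\<Lambda>. \<bar>tensor_legendre S \<mu> y\<bar>\<^sup>2) * (\<Sum>\<mu>\<in>\<Lambda>. (norm (c \<mu>))\<^sup>2)"
    by (rule Cauchy_Schwarz_ineq_sum)
  also have "\<dots> \<le> (real (card \<Lambda>))\<^sup>2 * (\<Sum>\<mu>\<in>\<Lambda>. (norm (c \<mu>))\<^sup>2)"
  proof (intro mult_right_mono sum_nonneg)
    have "y j \<in> {-1..1}" if "j \<in> S" for j
      using y S(2) that unfolding param_domain_def by blast
    from tensor_kernel_bound[OF S(1) this S(3)]
    show "(\<Sum>\<mu>\<in>\<Lambda>. \<bar>tensor_legendre S \<mu> y\<bar>\<^sup>2) \<le> (real (card \<Lambda>))\<^sup>2" by simp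
  qed auto
  finally show "(norm (Q y))\<^sup>2 \<le> (real (card \<Lambda>))\<^sup>2 * (\<integral>y. (norm (Q y))\<^sup>2 \<partial>param_measure d)"
    by (simp only: int)
qed

section \<open>Measurability of projection errors\<close>

text \<open>
  The type of \<open>V\<close> need not be second countable, so that sums of Borel functions need not be Borel;
  pointwise limits of functions of finite rank are closed under sums.
\<close>

inductive_set finite_rank :: "'a measure \<Rightarrow> ('a \<Rightarrow> 'v::real_inner) set" for S where
  scale: "c \<in> borel_measurable S \<Longrightarrow> (\<lambda>x. c x *\<^sub>R v) \<in> finite_rank S"
| add: "f \<in> finite_rank S \<Longrightarrow> g \<in> finite_rank S \<Longrightarrow> (\<lambda>x. f x + g x) \<in> finite_rank S"

definition strongly_measurable :: "'a measure \<Rightarrow> ('a \<Rightarrow> 'v::real_inner) set" where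
  "strongly_measurable S = {f. \<exists>F. (\<forall>k::nat. F k \<in> finite_rank S) \<and> (\<forall>x\<in>space S. (\<lambda>k. F k x) \<longlonglongrightarrow> f x)}"

lemma finite_rank_zero: "(\<lambda>x. 0) \<in> finite_rank S"
  using finite_rank.scale[of "\<lambda>_. 0" S 0] by simp

lemma finite_rank_sum:
  assumes "\<And>i. i \<in> A \<Longrightarrow> f i \<in> finite_rank S"
  shows "(\<lambda>x. \<Sum>i\<in>A. f i x) \<in> finite_rank S"
  using assms by (induction A rule: infinite_finite_induct) (auto intro: finite_rank_zero finite_rank.add)

lemma finite_rank_scaleR: "f \<in> finite_rank S \<Longrightarrow> (\<lambda>x. r *\<^sub>R f x) \<in> finite_rank S"
proof (induction rule: finite_rank.induct)
  case (scale c v)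
  then show ?case using finite_rank.scale[of "\<lambda>x. r * c x" S v] by simp
next
  case (add f g)
  then show ?case using finite_rank.add by (simp add: scaleR_add_right)
qed

lemma finite_rank_compose: "f \<in> finite_rank S \<Longrightarrow> t \<in> T \<rightarrow>\<^sub>M S \<Longrightarrow> (\<lambda>x. f (t x)) \<in> finite_rank T"
proof (induction rule: finite_rank.induct)
  case (scale c v)
  then show ?case by (intro finite_rank.scale) (rule measurable_compose)
next
  case (add f g)
  then show ?case by (intro finite_rank.add) auto
qed

lemma finite_rank_inner_const: "f \<in> finite_rank S \<Longrightarrow> (\<lambda>x. inner v (f x)) \<in> borel_measurable S"
  by (induction rule: finite_rank.induct) (simp_all add: inner_add_right)

lemma finite_rank_inner:
  "f \<in> finite_rank S \<Longrightarrow> g \<in> finite_rank S \<Longrightarrow> (\<lambda>x. inner (f x) (g x)) \<in> borel_measurable S"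
proof (induction rule: finite_rank.induct)
  case (scale c v)
  then show ?case using finite_rank_inner_const[of g S v] by simp
next
  case (add f f')
  then show ?case by (simp add: inner_add_left)
qed

lemma finite_rank_strongly_measurable: "f \<in> finite_rank S \<Longrightarrow> f \<in> strongly_measurable S"
  unfolding strongly_measurable_def by (auto intro!: exI[of _ "\<lambda>_. f"])

lemma strongly_measurable_compose:
  assumes "f \<in> strongly_measurable S" "t \<in> T \<rightarrow>\<^sub>M S"
  shows "(\<lambda>x. f (t x)) \<in> strongly_measurable T"
proof -
  obtain F where "\<And>k. F k \<in> finite_rank S" "\<And>x. x \<in> space S \<Longrightarrow> (\<lambda>k. F k x) \<longlonglongrightarrow> f x"
    using assms(1) by (auto simp: strongly_measurable_def)
  then show ?thesis unfolding strongly_measurable_def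
    using finite_rank_compose[OF _ assms(2)] measurable_space[OF assms(2)]
    by (auto intro!: exI[of _ "\<lambda>k x. F k (t x)"])
qed

lemma strongly_measurable_add:
  assumes "f \<in> strongly_measurable S" "g \<in> strongly_measurable S"
  shows "(\<lambda>x. f x + g x) \<in> strongly_measurable S"
proof -
  obtain F where "\<And>k. F k \<in> finite_rank S" "\<And>x. x \<in> space S \<Longrightarrow> (\<lambda>k. F k x) \<longlonglongrightarrow> f x"
    using assms(1) by (auto simp: strongly_measurable_def)
  moreover obtain G where "\<And>k. G k \<in> finite_rank S" "\<And>x. x \<in> space S \<Longrightarrow> (\<lambda>k. G k x) \<longlonglongrightarrow> g x"
    using assms(2) by (auto simp: strongly_measurable_def)
  ultimately show ?thesis unfolding strongly_measurable_def
    by (auto intro!: exI[of _ "\<lambda>k x. F k x + G k x"] finite_rank.add tendsto_add)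
qed

lemma strongly_measurable_scaleR:
  assumes "f \<in> strongly_measurable S"
  shows "(\<lambda>x. r *\<^sub>R f x) \<in> strongly_measurable S"
proof -
  obtain F where "\<And>k. F k \<in> finite_rank S" "\<And>x. x \<in> space S \<Longrightarrow> (\<lambda>k. F k x) \<longlonglongrightarrow> f x"
    using assms by (auto simp: strongly_measurable_def)
  then show ?thesis unfolding strongly_measurable_def
    by (auto intro!: exI[of _ "\<lambda>k x. r *\<^sub>R F k x"] finite_rank_scaleR tendsto_intros)
qed

lemma strongly_measurable_sum:
  "(\<And>i. i \<in> A \<Longrightarrow> f i \<in> strongly_measurable S) \<Longrightarrow> (\<lambda>x. \<Sum>i\<in>A. f i x) \<in> strongly_measurable S"
  by (induction A rule: infinite_finite_induct)
     (auto intro: finite_rank_strongly_measurable finite_rank_zero strongly_measurable_add)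

lemma strongly_measurable_norm:
  assumes "f \<in> strongly_measurable S"
  shows "(\<lambda>x. norm (f x)) \<in> borel_measurable S"
proof -
  obtain F where F: "\<And>k. F k \<in> finite_rank S" "\<And>x. x \<in> space S \<Longrightarrow> (\<lambda>k. F k x) \<longlonglongrightarrow> f x"
    using assms by (auto simp: strongly_measurable_def)
  show ?thesis
  proof (rule borel_measurable_LIMSEQ_real)
    show "(\<lambda>x. norm (F k x)) \<in> borel_measurable S" for k
      using finite_rank_inner[OF F(1) F(1), of k k] unfolding norm_eq_sqrt_inner by measurable
    show "(\<lambda>k. norm (F k x)) \<longlonglongrightarrow> norm (f x)" if "x \<in> space S" for x
      by (intro tendsto_norm F that)
  qed
qed

section \<open>Measurability of the distance to a varying span\<close>

lemma span_lessThan_coeffs: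
  fixes f :: "nat \<Rightarrow> 'v::real_vector"
  assumes "v \<in> span (f ` {..<n})"
  shows "\<exists>c. v = (\<Sum>i<n. c i *\<^sub>R f i)"
proof -
  let ?T = "range (\<lambda>c. \<Sum>i<n. c i *\<^sub>R f i)"
  have "subspace ?T"
  proof (rule subspaceI)
    show "0 \<in> ?T" by (rule range_eqI[of _ _ "\<lambda>_. 0"]) simp
    show "x + y \<in> ?T" if xy: "x \<in> ?T" "y \<in> ?T" for x y
    proof -
      obtain c e where ce: "x = (\<Sum>i<n. c i *\<^sub>R f i)" "y = (\<Sum>i<n. e i *\<^sub>R f i)" using xy by auto
      show ?thesis by (rule range_eqI[of _ _ "\<lambda>i. c i + e i"]) (simp add: ce sum.distrib scaleR_add_left)
    qed
    show "r *\<^sub>R x \<in> ?T" if x: "x \<in> ?T" for r x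
    proof -
      obtain c where c: "x = (\<Sum>i<n. c i *\<^sub>R f i)" using x by auto
      show ?thesis by (rule range_eqI[of _ _ "\<lambda>i. r * c i"]) (simp add: c scaleR_sum_right)
    qed
  qed
  moreover have "f ` {..<n} \<subseteq> ?T"
  proof
    fix x assume "x \<in> f ` {..<n}"
    then obtain j where j: "j < n" "x = f j" by auto
    then have "x = (\<Sum>i<n. (if i = j then 1 else 0) *\<^sub>R f i)"
      by (simp add: if_distrib[where f = "\<lambda>c. c *\<^sub>R _"] cong: if_cong)
    then show "x \<in> ?T"
      by (rule range_eqI[of x "\<lambda>c. \<Sum>i<n. c i *\<^sub>R f i" "\<lambda>i. if i = j then 1 else 0"])
  qed
  ultimately have "span (f ` {..<n}) \<subseteq> ?T" by (rule span_minimal[rotated])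
  then show ?thesis using assms by blast
qed

text \<open>The projection onto a span can jump where the vectors become dependent, so measurability
  is not obtained from a formula for it. Rational coefficients turn the condition into a countable
  union of conditions on norms.\<close>

lemma residual_less_iff:
  fixes f :: "nat \<Rightarrow> 'v::real_inner"
  shows "residual (span (f ` {..<n})) w < e \<longleftrightarrow>
    (\<exists>q\<in>(\<Pi>\<^sub>E i\<in>{..<n}. \<rat>). norm (w - (\<Sum>i<n. q i *\<^sub>R f i)) < e)"
proof
  assume "\<exists>q\<in>(\<Pi>\<^sub>E i\<in>{..<n}. \<rat>). norm (w - (\<Sum>i<n. q i *\<^sub>R f i)) < e"
  then obtain q where "norm (w - (\<Sum>i<n. q i *\<^sub>R f i)) < e" by blast
  moreover have "(\<Sum>i<n. q i *\<^sub>R f i) \<in> span (f ` {..<n})"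
    by (intro span_sum span_scale span_base) auto
  ultimately show "residual (span (f ` {..<n})) w < e"
    by (meson residual_min fin_span_span finite_imageI finite_lessThan order_le_less_trans)
next
  assume less: "residual (span (f ` {..<n})) w < e"
  define \<delta> where "\<delta> = e - residual (span (f ` {..<n})) w"
  \<comment> \<open>The summand 1 makes K positive and the final rounding error strictly smaller
    than \<delta>.\<close>
  define K where "K = 1 + (\<Sum>i<n. norm (f i))"
  have K: "0 < K" by (simp add: K_def add_pos_nonneg sum_nonneg)
  have \<delta>: "0 < \<delta>" using less by (simp add: \<delta>_def)
  have "orth_proj (span (f ` {..<n})) w \<in> span (f ` {..<n})" by (intro orth_proj_props) auto
  then obtain c where c: "orth_proj (span (f ` {..<n})) w = (\<Sum>i<n. c i *\<^sub>R f i)"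
    using span_lessThan_coeffs by blast
  have "\<exists>q\<in>\<rat>. \<bar>c i - q\<bar> \<le> \<delta> / K" for i
    using Rats_dense_in_real[of "c i - \<delta> / K" "c i + \<delta> / K"] \<delta> K by (auto intro!: bexI)
  then obtain q where q: "\<And>i. q i \<in> \<rat>" "\<And>i. \<bar>c i - q i\<bar> \<le> \<delta> / K" by metis
  define q' where "q' = restrict q {..<n}"
  have "w - (\<Sum>i<n. q' i *\<^sub>R f i) = (w - orth_proj (span (f ` {..<n})) w) + (\<Sum>i<n. (c i - q i) *\<^sub>R f i)"
    by (simp add: c q'_def sum_subtractf scaleR_diff_left)
  then have "norm (w - (\<Sum>i<n. q' i *\<^sub>R f i))
      \<le> residual (span (f ` {..<n})) w + norm (\<Sum>i<n. (c i - q i) *\<^sub>R f i)"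
    unfolding residual_def by (metis norm_triangle_ineq)
  also have "norm (\<Sum>i<n. (c i - q i) *\<^sub>R f i) \<le> (\<Sum>i<n. \<bar>c i - q i\<bar> * norm (f i))"
    by (rule order.trans[OF norm_sum]) simp
  also have "\<dots> \<le> (\<Sum>i<n. \<delta> / K * norm (f i))"
    by (intro sum_mono mult_right_mono q) auto
  also have "\<dots> = \<delta> / K * (K - 1)" by (simp add: K_def sum_distrib_left)
  also have "\<dots> < \<delta>" using K \<delta> by (simp add: field_simps)
  finally have "norm (w - (\<Sum>i<n. q' i *\<^sub>R f i)) < e" by (simp add: \<delta>_def)
  moreover have "q' \<in> (\<Pi>\<^sub>E i\<in>{..<n}. \<rat>)" using q by (auto simp: q'_def)
  ultimately show "\<exists>q\<in>(\<Pi>\<^sub>E i\<in>{..<n}. \<rat>). norm (w - (\<Sum>i<n. q i *\<^sub>R f i)) < e" by blast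
qed

lemma residual_measurable:
  fixes n :: nat
  assumes f: "\<And>i. i < n \<Longrightarrow> f i \<in> strongly_measurable S" and g: "g \<in> strongly_measurable S"
  shows "(\<lambda>x. residual (span ((\<lambda>i. f i x) ` {..<n})) (g x)) \<in> borel_measurable S"
  unfolding borel_measurable_iff_less
proof
  fix e :: real
  let ?I = "\<Pi>\<^sub>E i\<in>{..<n}. \<rat> :: real set"
  have "countable ?I" by (intro countable_PiE) (auto intro: countable_rat)
  have meas: "(\<lambda>x. norm (g x - (\<Sum>i<n. q i *\<^sub>R f i x))) \<in> borel_measurable S" for q
  proof -
    have "(\<lambda>x. g x + (- 1) *\<^sub>R (\<Sum>i<n. q i *\<^sub>R f i x)) \<in> strongly_measurable S"
      using f by (intro strongly_measurable_add g strongly_measurable_scaleR strongly_measurable_sum) auto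
    from strongly_measurable_norm[OF this] show ?thesis by simp
  qed
  have "{x \<in> space S. residual (span ((\<lambda>i. f i x) ` {..<n})) (g x) < e}
      = (\<Union>q\<in>?I. {x \<in> space S. norm (g x - (\<Sum>i<n. q i *\<^sub>R f i x)) < e})"
    unfolding residual_less_iff by auto
  also have "\<dots> \<in> sets S"
    using meas \<open>countable ?I\<close> by (intro sets.countable_UN'') (auto simp: borel_measurable_iff_less)
  finally show "{x \<in> space S. residual (span ((\<lambda>i. f i x) ` {..<n})) (g x) < e} \<in> sets S" .
qed

lemma monomial_measurable:
  assumes "\<nu> \<in> multi_indices d"
  shows "monomial \<nu> \<in> borel_measurable (param_measure d)"
  unfolding monomial_def
proof (rule borel_measurable_prod)
  fix j assume "j \<in> {j. \<nu> j \<noteq> 0}"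
  then have "j \<in> coords d" using assms by (auto simp: multi_indices_def)
  have "(\<lambda>x. poly (monom 1 (\<nu> j)) x) \<in> borel_measurable interval_measure_unif"
    by (rule poly_measurable_unif)
  from measurable_compose[OF coord_measurable[OF \<open>j \<in> coords d\<close>] this]
  show "(\<lambda>y. y j ^ \<nu> j) \<in> borel_measurable (param_measure d)"
    by (simp add: poly_monom)
qed

lemma poly_finite_rank:
  assumes "downward_closed d \<Lambda>"
  shows "(\<lambda>y. \<Sum>\<nu>\<in>\<Lambda>. monomial \<nu> y *\<^sub>R a \<nu>) \<in> finite_rank (param_measure d)"
  using assms by (intro finite_rank_sum finite_rank.scale monomial_measurable) (auto simp: downward_closed_def)

section \<open>The probability of a poor training set\<close>

lemma fin_span_greedy: "fin_span (greedy_space u ys n)"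
  by (auto simp: greedy_space_def)

text \<open>The polynomial given by \<open>\<Lambda>\<close> and \<open>a\<close> does not depend on
  the outcome or on the step, so a training set can fail only through its relation to the current
  reduced space.\<close>

locale greedy_sampling =
  fixes d :: enat and N :: nat and u :: "param \<Rightarrow> 'v::real_inner"
    and sel :: "nat \<Rightarrow> (nat \<Rightarrow> nat \<Rightarrow> param) \<Rightarrow> param"
    and \<Lambda> :: "(nat \<Rightarrow> nat) set" and a :: "(nat \<Rightarrow> nat) \<Rightarrow> 'v"
  assumes u: "u \<in> strongly_measurable (param_measure d)"
    and sel: "\<And>n. sel n \<in> (\<Pi>\<^sub>M i\<in>{..n}. \<Pi>\<^sub>M k\<in>{..<N}. param_measure d) \<rightarrow>\<^sub>M param_measure d"
    and \<Lambda>: "downward_closed d \<Lambda>" "finite \<Lambda>" "\<Lambda> \<noteq> {}"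
begin

abbreviation "rho \<equiv> param_measure d"
abbreviation "draw \<equiv> \<Pi>\<^sub>M k\<in>{..<N}. param_measure d"

definition P :: "param \<Rightarrow> 'v" where
  "P y = (\<Sum>\<nu>\<in>\<Lambda>. monomial \<nu> y *\<^sub>R a \<nu>)"

definition res_sq :: "(nat \<Rightarrow> nat \<Rightarrow> param) \<Rightarrow> nat \<Rightarrow> param \<Rightarrow> real" where
  "res_sq \<omega> n y = (residual (greedy_space u (selected sel \<omega>) n) (P y))\<^sup>2"

definition mean_sq :: "(nat \<Rightarrow> nat \<Rightarrow> param) \<Rightarrow> nat \<Rightarrow> real" where
  "mean_sq \<omega> n = (\<integral>y. res_sq \<omega> n y \<partial>rho)"

text \<open>Outside this event some draw satisfies \<open>mean_sq\<close> \<le> 4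
  \<open>res_sq\<close>; combined with sup \<le> m^2 \<open>mean_sq\<close> this gives the factor 2
  m for unsquared residuals.\<close>

definition bad :: "nat \<Rightarrow> (nat \<Rightarrow> nat \<Rightarrow> param) set" where
  "bad n = {\<omega> \<in> space (sample_measure d N). \<forall>k<N. res_sq \<omega> n (\<omega> n k) < mean_sq \<omega> n / 4}"

lemma res_sq_poly:
  "res_sq \<omega> n y = (norm (\<Sum>\<nu>\<in>\<Lambda>. monomial \<nu> y *\<^sub>R
     (a \<nu> - orth_proj (greedy_space u (selected sel \<omega>) n) (a \<nu>))))\<^sup>2"
  unfolding res_sq_def residual_def P_def orth_proj_sum[OF fin_span_greedy \<Lambda>(2)]
  by (simp add: scaleR_diff_right sum_subtractf)

lemma integrable_res_sq: "integrable rho (res_sq \<omega> n)"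
  using sparse_poly_point_bound(1)[OF \<Lambda>(1,2)] unfolding res_sq_poly[abs_def] .

lemma res_sq_le: "y \<in> param_domain d \<Longrightarrow> res_sq \<omega> n y \<le> (real (card \<Lambda>))\<^sup>2 * mean_sq \<omega> n"
  unfolding mean_sq_def res_sq_poly by (rule sparse_poly_point_bound(2)[OF \<Lambda>(1,2)])

lemma res_sq_measurable: "res_sq \<omega> n \<in> borel_measurable rho"
  using integrable_res_sq by (rule borel_measurable_integrable)

text \<open>The mean I is at most (I / 4) p + m^2 I (1 - p), where p is the probability in question.
  Solving for p gives (m^2 - 1) / (m^2 - 1/4).\<close>

lemma prob_small_res_sq:
  "measure rho {y \<in> space rho. res_sq \<omega> n y < mean_sq \<omega> n / 4} \<le> 1 - 3 / (4 * (real (card \<Lambda>))\<^sup>2 - 1)"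
proof -
  interpret prob_space rho by (rule prob_space_param)
  define m where "m = real (card \<Lambda>)"
  have m: "1 \<le> m" using \<Lambda> by (simp add: m_def Suc_le_eq card_gt_0_iff)
  then have m2: "1 \<le> m\<^sup>2" by simp
  define I where "I = mean_sq \<omega> n"
  define G where "G = {y \<in> space rho. res_sq \<omega> n y < I / 4}"
  have G: "G \<in> sets rho" unfolding G_def using res_sq_measurable by measurable
  have "0 \<le> I" unfolding I_def mean_sq_def by (simp add: res_sq_def)
  show ?thesis
  proof (cases "I = 0")
    case True
    then have "G = {}" by (auto simp: G_def res_sq_def not_less)
    then have "prob G = 0" by simp
    moreover have "0 \<le> 1 - 3 / (4 * m\<^sup>2 - 1)" using m2 by (simp add: field_simps)
    ultimately show ?thesis by (simp only: G_def I_def m_def)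
  next
    case False
    then have I: "0 < I" using \<open>0 \<le> I\<close> by simp
    have "I = (\<integral>y. res_sq \<omega> n y \<partial>rho)" by (simp add: I_def mean_sq_def)
    also have "\<dots> \<le> (\<integral>y. m\<^sup>2 * I - (m\<^sup>2 * I - I / 4) * indicator G y \<partial>rho)"
    proof (rule integral_mono)
      show "integrable rho (\<lambda>y. m\<^sup>2 * I - (m\<^sup>2 * I - I / 4) * indicator G y)"
        using G by (intro Bochner_Integration.integrable_diff integrable_const integrable_mult_right
            integrable_real_indicator) (auto simp: emeasure_eq_measure)
      fix y assume y: "y \<in> space rho"
      then have "res_sq \<omega> n y \<le> m\<^sup>2 * I"
        unfolding m_def I_def by (intro res_sq_le) (simp add: space_param_measure)
      then show "res_sq \<omega> n y \<le> m\<^sup>2 * I - (m\<^sup>2 * I - I / 4) * indicator G y"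
        using y by (auto simp: G_def indicator_def)
    qed (rule integrable_res_sq)
    also have "\<dots> = m\<^sup>2 * I - (m\<^sup>2 * I - I / 4) * prob G"
    proof -
      have "integrable rho (indicat_real G)"
        using G by (intro integrable_real_indicator) (auto simp: emeasure_eq_measure)
      then have "integrable rho (\<lambda>y. (m\<^sup>2 * I - I / 4) * indicator G y)"
        by (rule integrable_mult_right)
      then have "(\<integral>y. m\<^sup>2 * I - (m\<^sup>2 * I - I / 4) * indicator G y \<partial>rho)
          = (\<integral>y. m\<^sup>2 * I \<partial>rho) - (\<integral>y. (m\<^sup>2 * I - I / 4) * indicator G y \<partial>rho)"
        by (intro Bochner_Integration.integral_diff integrable_const)
      then show ?thesis using G by (simp add: prob_space sets.Int_space_eq2)
    qed
    finally have "I * ((m\<^sup>2 - 1 / 4) * prob G) \<le> I * (m\<^sup>2 - 1)" by (simp add: algebra_simps)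
    then have "(m\<^sup>2 - 1 / 4) * prob G \<le> m\<^sup>2 - 1" using I by (simp only: mult_le_cancel_left_pos)
    then have "prob G \<le> (m\<^sup>2 - 1) / (m\<^sup>2 - 1 / 4)"
      using m2 by (simp add: pos_le_divide_eq mult.commute)
    also have "\<dots> = 1 - 3 / (4 * m\<^sup>2 - 1)" using m2 by (simp add: field_simps)
    finally show ?thesis by (simp add: G_def I_def m_def)
  qed
qed

text \<open>Here \<omega> is fixed and only the fresh draws \<open>z\<close> are random, so
  independence gives an N-th power.\<close>

lemma prob_poor_draw:
  "emeasure draw {z \<in> space draw. \<forall>k<N. res_sq \<omega> n (z k) < mean_sq \<omega> n / 4}
     \<le> ennreal ((1 - 3 / (4 * (real (card \<Lambda>))\<^sup>2 - 1)) ^ N)"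
proof -
  interpret R: prob_space rho by (rule prob_space_param)
  interpret D: product_prob_space "\<lambda>_::nat. rho" "{..<N}"
    by (intro product_prob_spaceI prob_space_param)
  define G where "G = {y \<in> space rho. res_sq \<omega> n y < mean_sq \<omega> n / 4}"
  have G: "G \<in> sets rho" unfolding G_def using res_sq_measurable by measurable
  have "{z \<in> space draw. \<forall>k<N. res_sq \<omega> n (z k) < mean_sq \<omega> n / 4} = (\<Pi>\<^sub>E k\<in>{..<N}. G)"
  proof (rule equalityI; rule subsetI)
    fix z assume "z \<in> {z \<in> space draw. \<forall>k<N. res_sq \<omega> n (z k) < mean_sq \<omega> n / 4}"
    then show "z \<in> (\<Pi>\<^sub>E k\<in>{..<N}. G)" unfolding space_PiM PiE_iff G_def by blast
  next
    fix z assume "z \<in> (\<Pi>\<^sub>E k\<in>{..<N}. G)"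
    then show "z \<in> {z \<in> space draw. \<forall>k<N. res_sq \<omega> n (z k) < mean_sq \<omega> n / 4}"
      unfolding space_PiM PiE_iff G_def by blast
  qed
  then have "emeasure draw {z \<in> space draw. \<forall>k<N. res_sq \<omega> n (z k) < mean_sq \<omega> n / 4}
      = (\<Prod>k<N. emeasure rho G)"
    using D.emeasure_PiM[of "{..<N}" "\<lambda>_. G"] G by simp
  also have "\<dots> = ennreal (measure rho G ^ N)"
    by (simp add: R.emeasure_eq_measure ennreal_power)
  also have "\<dots> \<le> ennreal ((1 - 3 / (4 * (real (card \<Lambda>))\<^sup>2 - 1)) ^ N)"
    unfolding G_def by (intro ennreal_leI power_mono prob_small_res_sq) auto
  finally show ?thesis .
qed

text \<open>The reduced space of step n uses selections before n, each of which sees only the draws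
  up to its own step. The independence of the n-th training set from that space rests on
  this.\<close>

lemma greedy_space_restrict:
  assumes "{..<n} \<subseteq> A"
  shows "greedy_space u (selected sel (restrict \<omega> A)) n = greedy_space u (selected sel \<omega>) n"
proof -
  have "restrict (restrict \<omega> A) {..i} = restrict \<omega> {..i}" if "i < n" for i
    using assms that by (auto simp: restrict_def fun_eq_iff subset_iff)
  then show ?thesis unfolding greedy_space_def selected_def by (auto intro!: arg_cong[where f = span] image_cong)
qed

lemma res_sq_restrict:
  assumes "{..<n} \<subseteq> A"
  shows "res_sq (restrict \<omega> A) n = res_sq \<omega> n" "mean_sq (restrict \<omega> A) n = mean_sq \<omega> n"
  unfolding mean_sq_def res_sq_def greedy_space_restrict[OF assms] by auto

text \<open>The maps \<open>h\<close> and \<open>t\<close> are arbitrary because two instances are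
  needed: the point \<open>t\<close> as a draw of the same outcome, and as an independent second
  variable that is integrated out to make \<open>mean_sq\<close> measurable.\<close>

lemma res_sq_joint_measurable:
  assumes s: "\<And>i. i < n \<Longrightarrow> (\<lambda>x. selected sel (h x) i) \<in> S \<rightarrow>\<^sub>M rho" and t: "t \<in> S \<rightarrow>\<^sub>M rho"
  shows "(\<lambda>x. res_sq (h x) n (t x)) \<in> borel_measurable S"
proof -
  have "P \<in> strongly_measurable rho"
    unfolding P_def[abs_def] by (intro finite_rank_strongly_measurable poly_finite_rank \<Lambda>)
  then have "(\<lambda>x. P (t x)) \<in> strongly_measurable S"
    using t by (rule strongly_measurable_compose)
  moreover have "(\<lambda>x. u (selected sel (h x) i)) \<in> strongly_measurable S" if "i < n" for i
    using strongly_measurable_compose[OF u s[OF that]] .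
  ultimately have "(\<lambda>x. residual (span ((\<lambda>i. u (selected sel (h x) i)) ` {..<n})) (P (t x))) \<in> borel_measurable S"
    by (intro residual_measurable)
  then show ?thesis unfolding res_sq_def greedy_space_def by measurable
qed

lemma selected_measurable:
  assumes "i \<le> n"
  shows "(\<lambda>x. selected sel x i) \<in> (\<Pi>\<^sub>M i\<in>{..n}. draw) \<rightarrow>\<^sub>M rho"
  unfolding selected_def using assms
  by (intro measurable_compose[OF measurable_restrict_subset sel]) auto

text \<open>The event involves the draws of steps 0..n only, so it can be measured in a finite
  product. Fubini with the n-th draw as inner variable leaves the estimate for a frozen
  past.\<close>

lemma bad_prob:
  shows "bad n \<in> sets (sample_measure d N)"
    and "measure (sample_measure d N) (bad n) \<le> (1 - 3 / (4 * (real (card \<Lambda>))\<^sup>2 - 1)) ^ N"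
proof -
  let ?q = "(1 - 3 / (4 * (real (card \<Lambda>))\<^sup>2 - 1)) ^ N"
  have prob_draw: "prob_space draw" by (intro prob_space_PiM prob_space_param)
  interpret R: prob_space rho by (rule prob_space_param)
  interpret X: product_prob_space "\<lambda>_::nat. draw" UNIV
    by (intro product_prob_spaceI prob_draw)
  interpret Past: prob_space "\<Pi>\<^sub>M i\<in>{..<n}. draw"
    by (intro prob_space_PiM prob_draw)
  let ?M = "\<Pi>\<^sub>M i\<in>{..n}. draw"
  have ins: "{..n} = insert n {..<n}" by auto
  define B where "B = {x \<in> space ?M. \<forall>k<N. res_sq x n (x n k) < mean_sq x n / 4}"
  have xnk: "(\<lambda>x. x n k) \<in> ?M \<rightarrow>\<^sub>M rho" if "k < N" for k
    using measurable_compose[OF measurable_component_singleton[of n "{..n}" "\<lambda>_. draw"]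
        measurable_component_singleton[of k "{..<N}" "\<lambda>_. rho"]] that by simp
  have meas1: "(\<lambda>x. res_sq x n (x n k)) \<in> borel_measurable ?M" if "k < N" for k
    by (rule res_sq_joint_measurable[where h = "\<lambda>x. x"]) (auto intro!: selected_measurable xnk that)
  have "(\<lambda>z. res_sq (fst z) n (snd z)) \<in> borel_measurable (?M \<Otimes>\<^sub>M rho)"
    by (rule res_sq_joint_measurable)
       (auto intro!: measurable_compose[OF measurable_fst selected_measurable])
  then have meas2: "(\<lambda>x. mean_sq x n) \<in> borel_measurable ?M"
    unfolding mean_sq_def by (intro R.borel_measurable_lebesgue_integral) (simp add: split_beta')
  have B: "B \<in> sets ?M"
  proof -
    \<comment> \<open>The intersection with the space matters for N = 0, where the indexed
      intersection is the whole type.\<close>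
    have "B = (\<Inter>k\<in>{..<N}. {x \<in> space ?M. res_sq x n (x n k) < mean_sq x n / 4}) \<inter> space ?M"
      by (auto simp: B_def)
    moreover have "{x \<in> space ?M. res_sq x n (x n k) < mean_sq x n / 4} \<in> sets ?M" if "k < N" for k
      using meas1[OF that] meas2 by measurable
    ultimately show ?thesis by (cases "N = 0") (auto intro!: sets.Int sets.finite_INT)
  qed
  have res: "(\<lambda>\<omega>. restrict \<omega> {..n}) \<in> sample_measure d N \<rightarrow>\<^sub>M ?M"
    unfolding sample_measure_def by (rule measurable_restrict_subset) auto
  have bad_eq: "bad n = (\<lambda>\<omega>. restrict \<omega> {..n}) -` B \<inter> space (sample_measure d N)"
  proof -
    have "res_sq (restrict \<omega> {..n}) n = res_sq \<omega> n" "mean_sq (restrict \<omega> {..n}) n = mean_sq \<omega> n" for \<omega>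
      by (rule res_sq_restrict; auto)+
    then show ?thesis
      using measurable_space[OF res] by (auto simp: bad_def B_def)
  qed
  show "bad n \<in> sets (sample_measure d N)"
    unfolding bad_eq by (rule measurable_sets[OF res B])
  have "emeasure ?M B = (\<integral>\<^sup>+x. indicator B x \<partial>\<Pi>\<^sub>M i\<in>insert n {..<n}. draw)"
    using B by (simp flip: ins)
  also have "\<dots> = (\<integral>\<^sup>+x. (\<integral>\<^sup>+z. indicator B (x(n := z)) \<partial>draw) \<partial>\<Pi>\<^sub>M i\<in>{..<n}. draw)"
    using B by (intro X.product_nn_integral_insert) (auto simp flip: ins)
  also have "\<dots> \<le> (\<integral>\<^sup>+x. ennreal ?q \<partial>\<Pi>\<^sub>M i\<in>{..<n}. draw)"
  proof (rule nn_integral_mono)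
    fix x assume x: "x \<in> space (\<Pi>\<^sub>M i\<in>{..<n}. draw)"
    \<comment> \<open>Replacing the n-th draw changes neither the reduced space nor the mean, so in
      the inner integral only the sampled points vary.\<close>
    have eq: "restrict (x(n := z)) {..<n} = restrict x {..<n}" for z by auto
    have dep: "res_sq (x(n := z)) n = res_sq x n" "mean_sq (x(n := z)) n = mean_sq x n" for z
      using res_sq_restrict[of n "{..<n}" "x(n := z)"] res_sq_restrict[of n "{..<n}" x] by (simp_all only: eq)
    let ?Z = "{z \<in> space draw. \<forall>k<N. res_sq x n (z k) < mean_sq x n / 4}"
    have "(\<integral>\<^sup>+z. indicator B (x(n := z)) \<partial>draw) = (\<integral>\<^sup>+z. indicator ?Z z \<partial>draw)"
    proof (rule nn_integral_cong)
      fix z assume z: "z \<in> space draw"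
      have "x(n := z) \<in> space ?M" using x z by (auto simp: space_PiM PiE_iff extensional_def)
      then show "indicator B (x(n := z)) = (indicator ?Z z :: ennreal)"
        using z by (simp add: B_def dep indicator_def)
    qed
    also have "\<dots> = emeasure draw ?Z"
    proof (rule nn_integral_indicator)
      have "(\<lambda>z. res_sq x n (z k)) \<in> borel_measurable draw" if "k < N" for k
        using measurable_compose[OF measurable_component_singleton[of k "{..<N}" "\<lambda>_. rho"] res_sq_measurable] that
        by simp
      then have "{z \<in> space draw. res_sq x n (z k) < mean_sq x n / 4} \<in> sets draw" if "k < N" for k
        using that by measurable
      moreover have "?Z = (\<Inter>k\<in>{..<N}. {z \<in> space draw. res_sq x n (z k) < mean_sq x n / 4}) \<inter> space draw"
        by auto
      ultimately show "?Z \<in> sets draw" by (cases "N = 0") (auto intro!: sets.Int sets.finite_INT)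
    qed
    also have "\<dots> \<le> ennreal ?q" by (rule prob_poor_draw)
    finally show "(\<integral>\<^sup>+z. indicator B (x(n := z)) \<partial>draw) \<le> ennreal ?q" .
  qed
  also have "\<dots> = ennreal ?q"
    by (simp add: Past.emeasure_space_1)
  finally have EB: "emeasure ?M B \<le> ennreal ?q" .
  have "emeasure (sample_measure d N) (bad n) = emeasure (distr (sample_measure d N) ?M (\<lambda>\<omega>. restrict \<omega> {..n})) B"
    unfolding bad_eq by (rule emeasure_distr[OF res B, symmetric])
  also have "distr (sample_measure d N) ?M (\<lambda>\<omega>. restrict \<omega> {..n}) = ?M"
    unfolding sample_measure_def by (rule X.distr_PiM_restrict_finite) auto
  finally have "emeasure (sample_measure d N) (bad n) \<le> ennreal ?q" using EB by simp
  moreover have "0 \<le> ?q"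
  proof -
    have "1 \<le> (real (card \<Lambda>))\<^sup>2" using \<Lambda> by (simp add: Suc_le_eq card_gt_0_iff)
    then show ?thesis by (simp add: field_simps)
  qed
  ultimately show "measure (sample_measure d N) (bad n) \<le> ?q"
    unfolding measure_def by (rule enn2real_leI[rotated])
qed

section \<open>Consequences of a good training set\<close>

lemma greedy_err_eq_residual: "greedy_err u ys n y = residual (greedy_space u ys n) (u y)"
  by (simp add: greedy_err_def residual_def)

lemma training_set_domain:
  assumes "\<omega> \<in> space (sample_measure d N)"
  shows "training_set N \<omega> n \<subseteq> param_domain d"
  using assms unfolding training_set_def sample_measure_def space_param_measure[symmetric]
  by (auto simp: space_PiM dest!: PiE_mem)

lemma computed_err_upper:
  assumes "k < N"
  shows "greedy_err u ys n (\<omega> n k) \<le> computed_err N u \<omega> ys n"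
  unfolding computed_err_def training_set_def using assms by (intro Max_ge) auto

text \<open>The comparison passes from \<open>u\<close> to \<open>P\<close> at \<open>y\<close>, to
  a good draw by the sup bound, and back to \<open>u\<close> there. The second change of function is
  amplified by 2 m, the first is not.\<close>

lemma greedy_err_good_training:
  assumes \<omega>: "\<omega> \<in> space (sample_measure d N)" "\<omega> \<notin> bad n"
    and near: "\<And>y. y \<in> param_domain d \<Longrightarrow> norm (u y - P y) \<le> \<kappa>"
    and y: "y \<in> param_domain d"
  shows "greedy_err u (selected sel \<omega>) n y
    \<le> 2 * real (card \<Lambda>) * (computed_err N u \<omega> (selected sel \<omega>) n + \<kappa>) + \<kappa>"
proof -
  define E where "E = greedy_space u (selected sel \<omega>) n"
  have E: "fin_span E" unfolding E_def by (rule fin_span_greedy)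
  obtain k where k: "k < N" "mean_sq \<omega> n / 4 \<le> res_sq \<omega> n (\<omega> n k)"
    using \<omega> by (auto simp: bad_def not_less)
  define z where "z = \<omega> n k"
  have z: "z \<in> param_domain d"
    using training_set_domain[OF \<omega>(1), of n] k(1) by (auto simp: training_set_def z_def)
  have "(residual E (P y))\<^sup>2 \<le> (real (card \<Lambda>))\<^sup>2 * mean_sq \<omega> n"
    using res_sq_le[OF y] by (simp add: res_sq_def E_def)
  also have "\<dots> \<le> (real (card \<Lambda>))\<^sup>2 * (4 * res_sq \<omega> n z)"
    using k(2) by (intro mult_left_mono) (auto simp: z_def)
  also have "\<dots> = (2 * real (card \<Lambda>) * residual E (P z))\<^sup>2"
    by (simp add: res_sq_def E_def power_mult_distrib)
  finally have 1: "residual E (P y) \<le> 2 * real (card \<Lambda>) * residual E (P z)"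
    by (rule power2_le_imp_le) simp
  have "residual E (P z) \<le> residual E (u z) + norm (P z - u z)" by (rule residual_triangle[OF E])
  also have "\<dots> \<le> computed_err N u \<omega> (selected sel \<omega>) n + \<kappa>"
    using near[OF z] computed_err_upper[OF k(1), of "selected sel \<omega>" n \<omega>]
    by (simp add: greedy_err_eq_residual E_def z_def norm_minus_commute)
  finally have 2: "2 * real (card \<Lambda>) * residual E (P z)
      \<le> 2 * real (card \<Lambda>) * (computed_err N u \<omega> (selected sel \<omega>) n + \<kappa>)"
    by (intro mult_left_mono) auto
  have "residual E (u y) \<le> residual E (P y) + norm (u y - P y)" by (rule residual_triangle[OF E])
  then show ?thesis using 1 2 near[OF y] by (simp add: greedy_err_eq_residual E_def)
qed

lemma computed_err_selected:
  assumes "greedy_rule d N u sel" "\<omega> \<in> space (sample_measure d N)"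
  shows "selected sel \<omega> n \<in> param_domain d"
    and "computed_err N u \<omega> (selected sel \<omega>) n = greedy_err u (selected sel \<omega>) n (selected sel \<omega> n)"
proof -
  let ?ys = "selected sel \<omega>"
  have am: "is_arg_max (greedy_err u ?ys n) (\<lambda>y. y \<in> training_set N \<omega> n) (?ys n)"
    using assms by (auto simp: greedy_rule_def)
  then have "?ys n \<in> training_set N \<omega> n" by (simp add: is_arg_max_def)
  then show "?ys n \<in> param_domain d" using training_set_domain[OF assms(2)] by blast
  have fin: "finite (training_set N \<omega> n)" by (simp add: training_set_def)
  show "computed_err N u \<omega> ?ys n = greedy_err u ?ys n (?ys n)"
    unfolding computed_err_def
    using am fin \<open>?ys n \<in> training_set N \<omega> n\<close>
    by (intro Max_eqI) (auto simp: is_arg_max_linorder)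
qed

text \<open>Selections are defined for all steps, even beyond termination, so the union bound runs
  over a fixed number of steps and no stopping time enters.\<close>

lemma good_event:
  assumes "(real K) * (1 - 3 / (4 * (real (card \<Lambda>))\<^sup>2 - 1)) ^ N < \<eta>"
  defines "A \<equiv> space (sample_measure d N) - (\<Union>n<K. bad n)"
  shows "A \<in> sets (sample_measure d N)" "measure (sample_measure d N) A > 1 - \<eta>"
proof -
  interpret S: prob_space "sample_measure d N"
    unfolding sample_measure_def by (intro prob_space_PiM prob_space_param)
  have U: "(\<Union>n<K. bad n) \<in> sets (sample_measure d N)" using bad_prob(1) by auto
  then show "A \<in> sets (sample_measure d N)" unfolding A_def by auto
  have "S.prob (\<Union>n<K. bad n) \<le> (\<Sum>n<K. S.prob (bad n))"
    using bad_prob(1) by (intro S.finite_measure_subadditive_finite) auto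
  also have "\<dots> \<le> (\<Sum>n<K. (1 - 3 / (4 * (real (card \<Lambda>))\<^sup>2 - 1)) ^ N)"
    by (intro sum_mono bad_prob(2))
  also have "\<dots> < \<eta>" using assms(1) by simp
  finally show "S.prob A > 1 - \<eta>" unfolding A_def using S.prob_compl[OF U] by simp
qed

end

section \<open>The parameters of the algorithm\<close>

text \<open>The number 32 is chosen for the second condition: 4 r + 2 \<le> 5 r, and 2^(5 r) =
  32^r.\<close>

lemma greedy_m_sufficient:
  assumes "2 < r" "0 < M0" "0 < \<epsilon>" "32 \<le> x" "(32 * M0 / \<epsilon>) powr (1 / (r - 2)) \<le> x"
  shows "32 * M0 * x powr (- r + 2) \<le> \<epsilon>" "2 powr (4 * r + 2) * x powr (- r) \<le> (1::real)"
proof -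
  have "32 * M0 / \<epsilon> = ((32 * M0 / \<epsilon>) powr (1 / (r - 2))) powr (r - 2)"
    using assms by (simp add: powr_powr)
  also have "\<dots> \<le> x powr (r - 2)" using assms by (intro powr_mono2) auto
  finally have "32 * M0 \<le> \<epsilon> * x powr (r - 2)" using assms by (simp add: field_simps)
  moreover have "x powr (- r + 2) * x powr (r - 2) = 1" using assms by (simp flip: powr_add)
  ultimately show "32 * M0 * x powr (- r + 2) \<le> \<epsilon>"
    using mult_right_mono[of "32 * M0" "\<epsilon> * x powr (r - 2)" "x powr (- r + 2)"] by (simp add: mult_ac)
  have "2 powr (4 * r + 2) \<le> (2::real) powr (5 * r)" using assms by (intro powr_mono) auto
  also have "\<dots> = 32 powr r"
  proof -
    have "(32::real) = 2 powr 5" by simp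
    then show ?thesis by (simp only: powr_powr)
  qed
  also have "\<dots> \<le> x powr r" using assms by (intro powr_mono2) auto
  finally have "2 powr (4 * r + 2) * x powr (- r) \<le> x powr r * x powr (- r)"
    by (intro mult_right_mono) auto
  also have "\<dots> = 1" using assms by (simp flip: powr_add)
  finally show "2 powr (4 * r + 2) * x powr (- r) \<le> 1" .
qed

lemma greedy_m_props:
  assumes "2 < r" "0 < M0" "0 < \<epsilon>"
  defines "m \<equiv> greedy_m r M0 \<epsilon>"
  shows "0 < m" "32 * M0 * real m powr (- r + 2) \<le> \<epsilon>" "2 powr (4 * r + 2) * real m powr (- r) \<le> 1"
    and "real m \<le> 33 + (32 * M0 / \<epsilon>) powr (1 / (r - 2))"
proof -
  define X where "X = (32 * M0 / \<epsilon>) powr (1 / (r - 2))"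
  define k where "k = nat \<lceil>32 + X\<rceil>"
  have X: "0 \<le> X" by (simp add: X_def)
  have k1: "32 + X \<le> real k" unfolding k_def by linarith
  have k2: "real k \<le> 33 + X" unfolding k_def using X by linarith
  have k0: "0 < real k" using k1 X by linarith
  let ?Q = "\<lambda>m. 0 < m \<and> 32 * M0 * real m powr (- r + 2) \<le> \<epsilon> \<and> 2 powr (4 * r + 2) * real m powr (- r) \<le> 1"
  have k32: "32 \<le> real k" "(32 * M0 / \<epsilon>) powr (1 / (r - 2)) \<le> real k"
    unfolding X_def[symmetric] using k1 X by linarith+
  have "0 < k" using k0 by simp
  then have Qk: "?Q k" using greedy_m_sufficient[OF assms(1-3) k32] by blast
  have "?Q m" unfolding m_def greedy_m_def by (rule LeastI[of ?Q, OF Qk])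
  then show "0 < m" "32 * M0 * real m powr (- r + 2) \<le> \<epsilon>" "2 powr (4 * r + 2) * real m powr (- r) \<le> 1"
    by auto
  have "m \<le> k" unfolding m_def greedy_m_def by (rule Least_le[of ?Q, OF Qk])
  then show "real m \<le> 33 + (32 * M0 / \<epsilon>) powr (1 / (r - 2))" using k2 by (simp add: X_def)
qed

text \<open>The upper bound comes from (1 - p)^k \<le> exp (- k p). The strict inequality compares
  the denominators 4 m^2 - 1 and 4 m^2, and needs N > 0, which holds since \<eta> / m^2 < 1.\<close>

lemma greedy_N_props:
  assumes "0 < m" "0 < \<eta>" "\<eta> < 1"
  defines "N \<equiv> greedy_N m \<eta>"
  shows "0 < N" "real (m\<^sup>2) * (1 - 3 / (4 * (real m)\<^sup>2 - 1)) ^ N < \<eta>"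
    and "real N \<le> 1 + 4 / 3 * (real m)\<^sup>2 * (2 * ln (real m) + \<bar>ln \<eta>\<bar>)"
proof -
  define p where "p = 3 / (4 * (real m)\<^sup>2)"
  define L where "L = 2 * ln (real m) + \<bar>ln \<eta>\<bar>"
  have m2: "1 \<le> (real m)\<^sup>2" using assms(1) by simp
  have "3 < 4 * (real m)\<^sup>2" using m2 by linarith
  then have p: "0 < p" "p < 1" using assms(1) by (simp_all only: p_def) (simp_all add: pos_divide_less_eq)
  have L: "0 \<le> L" using assms(1) by (simp add: L_def)
  let ?Q = "\<lambda>N. (1 - 3 / (4 * (real m)\<^sup>2)) ^ N \<le> \<eta> / (real m)\<^sup>2"
  define k where "k = nat \<lceil>L / p\<rceil>"
  have k1: "L / p \<le> real k" unfolding k_def by linarith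
  have "0 \<le> L / p" using L p by simp
  then have k2: "real k \<le> 1 + L / p" unfolding k_def by linarith
  have "(1 - p) ^ k \<le> exp (- p) ^ k"
    using p exp_ge_add_one_self[of "- p"] by (intro power_mono) auto
  also have "\<dots> = exp (- (real k * p))" by (simp add: exp_of_nat_mult[symmetric])
  also have "\<dots> \<le> exp (- L)" using k1 p by (simp add: field_simps)
  also have "exp (- L) = \<eta> / (real m)\<^sup>2"
  proof -
    have "- L = ln \<eta> - ln ((real m)\<^sup>2)"
      using assms(1-3) by (simp add: L_def ln_realpow)
    then show ?thesis using assms m2 by (simp add: exp_diff)
  qed
  finally have Qk: "?Q k" by (simp add: p_def)
  have QN: "?Q N" unfolding N_def greedy_N_def by (rule LeastI[of ?Q, OF Qk])
  have "N \<le> k" unfolding N_def greedy_N_def by (rule Least_le[of ?Q, OF Qk])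
  then have "real N \<le> 1 + L / p" using k2 by linarith
  also have "L / p = 4 / 3 * (real m)\<^sup>2 * L" by (simp add: p_def)
  finally show "real N \<le> 1 + 4 / 3 * (real m)\<^sup>2 * (2 * ln (real m) + \<bar>ln \<eta>\<bar>)" by (simp add: L_def)
  show N: "0 < N"
  proof (rule ccontr)
    assume "\<not> 0 < N"
    then have "1 \<le> \<eta> / (real m)\<^sup>2" using QN by simp
    then show False using m2 assms by (simp add: field_simps)
  qed
  have "(1 - 3 / (4 * (real m)\<^sup>2 - 1)) ^ N < (1 - 3 / (4 * (real m)\<^sup>2)) ^ N"
  proof (rule power_strict_mono)
    show "1 - 3 / (4 * (real m)\<^sup>2 - 1) < 1 - 3 / (4 * (real m)\<^sup>2)"
    proof -
      have "0 < 4 * (real m)\<^sup>2 - 1" "0 < 4 * (real m)\<^sup>2" using m2 by linarith+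
      then have "3 / (4 * (real m)\<^sup>2) < 3 / (4 * (real m)\<^sup>2 - 1)"
        by (intro divide_strict_left_mono[OF _ _ mult_pos_pos]) linarith+
      then show ?thesis by simp
    qed
    have "3 / (4 * (real m)\<^sup>2 - 1) \<le> 1"
      using m2 by (subst pos_divide_le_eq) (linarith, simp)
    then show "0 \<le> 1 - 3 / (4 * (real m)\<^sup>2 - 1)" by simp
  qed (rule N)
  then have "(1 - 3 / (4 * (real m)\<^sup>2 - 1)) ^ N < \<eta> / (real m)\<^sup>2" using QN by linarith
  moreover have "0 < (real m)\<^sup>2" using m2 by linarith
  ultimately show "real (m\<^sup>2) * (1 - 3 / (4 * (real m)\<^sup>2 - 1)) ^ N < \<eta>"
    by (simp only: pos_less_divide_eq of_nat_power mult.commute)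
qed

section \<open>Approximability of the solution map\<close>

lemma approx_class_norm_le:
  assumes "u \<in> approx_class V d r" "approx_norm V d r u \<le> M0" "y \<in> param_domain d"
  shows "norm (u y) \<le> M0"
proof -
  have "bounded (u ` param_domain d)"
    using assms(1) by (auto simp: approx_class_def Linf_def)
  then have "bdd_above ((\<lambda>y. norm (u y)) ` param_domain d)"
    by (auto simp: bounded_iff bdd_above_def)
  then have "norm (u y) \<le> Linf_norm d u" unfolding Linf_norm_def by (rule cSUP_upper[OF assms(3)])
  then show "norm (u y) \<le> M0" using assms(2) by (simp add: approx_norm_def)
qed

lemma approx_class_sparse:
  assumes "u \<in> approx_class V d r" "approx_norm V d r u \<le> M0" "0 < M0" "0 < k"
  shows "\<exists>\<Lambda> a. downward_closed d \<Lambda> \<and> finite \<Lambda> \<and> card \<Lambda> = k \<and>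
    (\<forall>y\<in>param_domain d. norm (u y - (\<Sum>\<nu>\<in>\<Lambda>. monomial \<nu> y *\<^sub>R a \<nu>)) \<le> 2 * M0 * real k powr (- r))"
proof -
  have "approx_consts V d r u \<noteq> {}" using assms(1) by (simp add: approx_class_def)
  \<comment> \<open>Doubling \<open>M0\<close> leaves room to choose an admissible constant and then
    a polynomial without attaining either infimum.\<close>
  moreover have "Inf (approx_consts V d r u) < 2 * M0"
    using assms(2,3) by (simp add: approx_norm_def approx_seminorm_def)
  ultimately obtain C where C: "C \<in> approx_consts V d r u" "C < 2 * M0"
    by (meson cInf_lessD)
  have "approx_error V d k u \<le> ereal (C * real k powr (- r))"
    using C(1) assms(4) by (simp add: approx_consts_def)
  also have "\<dots> < ereal (2 * M0 * real k powr (- r))" using C(2) assms(4) by simp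
  finally obtain P where P: "P \<in> sparse_polys V d k"
    "(SUP y\<in>param_domain d. ereal (norm (u y - P y))) < ereal (2 * M0 * real k powr (- r))"
    unfolding approx_error_def INF_less_iff by blast
  then obtain \<Lambda> a where \<Lambda>: "downward_closed d \<Lambda>" "finite \<Lambda>" "card \<Lambda> = k"
    "P = (\<lambda>y. \<Sum>\<nu>\<in>\<Lambda>. monomial \<nu> y *\<^sub>R a \<nu>)"
    by (auto simp: sparse_polys_def polys_def)
  have "norm (u y - P y) \<le> 2 * M0 * real k powr (- r)" if "y \<in> param_domain d" for y
  proof -
    have "ereal (norm (u y - P y)) \<le> (SUP y\<in>param_domain d. ereal (norm (u y - P y)))"
      by (rule SUP_upper[OF that])
    then have "ereal (norm (u y - P y)) \<le> ereal (2 * M0 * real k powr (- r))"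
      using P(2) by (meson le_less_trans less_imp_le)
    then show ?thesis by simp
  qed
  then show ?thesis using \<Lambda> by blast
qed

lemma approx_class_strongly_measurable:
  assumes "u \<in> approx_class V d r" "approx_norm V d r u \<le> M0" "0 < M0" "0 < r"
  shows "u \<in> strongly_measurable (param_measure d)"
proof -
  have "\<exists>F. F \<in> finite_rank (param_measure d) \<and>
      (\<forall>y\<in>param_domain d. norm (u y - F y) \<le> 2 * M0 * real (Suc k) powr (- r))" for k
    using approx_class_sparse[OF assms(1-3), of "Suc k"] poly_finite_rank by blast
  then obtain F where F: "\<And>k. F k \<in> finite_rank (param_measure d)"
    "\<And>k y. y \<in> param_domain d \<Longrightarrow> norm (u y - F k y) \<le> 2 * M0 * real (Suc k) powr (- r)" by metis
  have "(\<lambda>k. real (Suc k) powr (- r)) \<longlonglongrightarrow> 0"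
    using assms(4) by (intro tendsto_neg_powr filterlim_compose[OF filterlim_real_sequentially filterlim_Suc]) auto
  then have lim: "(\<lambda>k. 2 * M0 * real (Suc k) powr (- r)) \<longlonglongrightarrow> 0" by (rule tendsto_mult_right_zero)
  have "(\<lambda>k. F k y) \<longlonglongrightarrow> u y" if "y \<in> param_domain d" for y
    unfolding LIM_zero_iff[symmetric, of _ "u y"]
    by (rule Lim_null_comparison[OF _ lim]) (use F(2)[OF that] in \<open>auto simp: norm_minus_commute\<close>)
  then show ?thesis unfolding strongly_measurable_def using F(1) by (auto simp: space_param_measure)
qed

lemma approx_class_width:
  assumes "u \<in> approx_class V d r" "approx_norm V d r u \<le> M0" "0 < M0"
  shows "\<exists>W. finite W \<and> card W \<le> k \<and>
    (\<forall>w\<in>u ` param_domain d. \<exists>v\<in>span W. norm (w - v) \<le> 2 * M0 * max 1 (real k) powr (- r))"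
proof (cases "k = 0")
  case True
  have "\<exists>v\<in>span {}. norm (w - v) \<le> 2 * M0 * max 1 (real k) powr (- r)" if "w \<in> u ` param_domain d" for w
    using approx_class_norm_le[OF assms(1,2)] that True assms(3) by fastforce
  then show ?thesis by (intro exI[of _ "{}"]) auto
next
  case False
  then have "max 1 (real k) = real k" by simp
  obtain \<Lambda> a where \<Lambda>: "finite \<Lambda>" "card \<Lambda> = k"
    "\<And>y. y \<in> param_domain d \<Longrightarrow> norm (u y - (\<Sum>\<nu>\<in>\<Lambda>. monomial \<nu> y *\<^sub>R a \<nu>)) \<le> 2 * M0 * real k powr (- r)"
    using approx_class_sparse[OF assms, of k] False by auto
  have "(\<Sum>\<nu>\<in>\<Lambda>. monomial \<nu> y *\<^sub>R a \<nu>) \<in> span (a ` \<Lambda>)" for y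
    by (intro span_sum span_scale span_base) auto
  then show ?thesis using \<Lambda> card_image_le[OF \<Lambda>(1), of a] unfolding \<open>max 1 (real k) = real k\<close>
    by (intro exI[of _ "a ` \<Lambda>"]) blast
qed

text \<open>The factor 2 is paid because the infimum need not be attained. Asking only for card W
  \<le> k also covers the convention for spaces of dimension below k.\<close>

lemma kolmogorov_width_span:
  assumes "kolmogorov_width V k M \<le> ereal x" "0 < x"
  shows "\<exists>W. finite W \<and> card W \<le> k \<and> (\<forall>w\<in>M. \<exists>v\<in>span W. norm (w - v) \<le> 2 * x)"
proof -
  have "kolmogorov_width V k M < ereal (2 * x)"
    using assms by (intro le_less_trans[OF assms(1)]) auto
  then obtain E where E: "has_dim E k \<or> E = V \<and> (\<exists>j<k. has_dim V j)" "dist_set M E < ereal (2 * x)"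
    unfolding kolmogorov_width_def INF_less_iff by blast
  then obtain W where W: "finite W" "card W \<le> k" "span W = E"
    unfolding has_dim_def by (metis order_le_less)
  have "norm (w - orth_proj E w) \<le> 2 * x" if "w \<in> M" for w
  proof -
    have "ereal (norm (w - orth_proj E w)) \<le> dist_set M E"
      unfolding dist_set_def by (rule SUP_upper[OF that])
    then have "ereal (norm (w - orth_proj E w)) \<le> ereal (2 * x)" using E(2) by (meson le_less_trans less_imp_le)
    then show ?thesis by simp
  qed
  moreover have "orth_proj E w \<in> span W" for w
    using orth_proj_props(1)[of E w] W by auto
  ultimately show ?thesis using W by blast
qed

section \<open>Complexity bounds\<close>

lemma ex_power_of_two_between:
  assumes "1 \<le> (n::nat)"
  shows "\<exists>j. 2 ^ j \<le> n \<and> n < 2 * 2 ^ j"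
  using ex_power_ivl1[of 2 n] assms by auto

text \<open>
  A run in which no training set is poor; \<open>\<sigma> i\<close> is the computed error. As long as it exceeds
  \<open>\<epsilon> / (8 m)\<close>, the additive term in the assumption \<open>good\<close> is dominated, and the selection is
  a weak greedy step with constant \<open>1 / (4 m)\<close>.
\<close>

locale greedy_run =
  fixes r M0 \<epsilon> :: real and d :: enat and u :: "param \<Rightarrow> 'v::real_inner"
    and ys :: "nat \<Rightarrow> param" and \<sigma> :: "nat \<Rightarrow> real" and m n :: nat
  assumes r: "2 < r" and M0: "0 < M0" and \<epsilon>: "0 < \<epsilon>"
    and m: "0 < m" "32 * M0 * real m powr (- r + 2) \<le> \<epsilon>" "2 powr (4 * r + 2) * real m powr (- r) \<le> 1"
    and m_le: "real m \<le> 33 + (32 * M0 / \<epsilon>) powr (1 / (r - 2))"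
    and bound: "\<And>y. y \<in> param_domain d \<Longrightarrow> norm (u y) \<le> M0"
    and ys: "\<And>i. ys i \<in> param_domain d"
    and \<sigma>: "\<And>i. \<sigma> i = residual (greedy_space u ys i) (u (ys i))"
    and good: "\<And>i y. i < m\<^sup>2 \<Longrightarrow> y \<in> param_domain d \<Longrightarrow>
      residual (greedy_space u ys i) (u y) \<le> 2 * real m * \<sigma> i + 6 * real m * (M0 * real m powr (- r))"
    and n: "n = (LEAST n. \<sigma> n \<le> \<epsilon> / (8 * real m) \<or> n = m\<^sup>2)"
    and approx: "\<And>k. \<exists>W. finite W \<and> card W \<le> k \<and>
      (\<forall>w\<in>u ` param_domain d. \<exists>v\<in>span W. norm (w - v) \<le> 2 * M0 * max 1 (real k) powr (- r))"
begin

lemma m_powr: "real m powr (- r + 2) = real m powr (- r) * (real m)\<^sup>2"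
  unfolding powr_add using m(1) by (simp add: powr_numeral)

text \<open>One power of m in the condition 32 M0 m^(2 - r) \<le> \<epsilon> is kept, to compare the
  approximation error with the threshold \<epsilon> / (8 m): it is 3/2 of it.\<close>

lemma noise: "6 * real m * (M0 * real m powr (- r)) \<le> 3 * \<epsilon> / (16 * real m)"
proof -
  have "32 * M0 * (real m powr (- r) * (real m)\<^sup>2) \<le> \<epsilon>" using m(2) by (simp only: m_powr)
  then show ?thesis using m(1) by (simp add: field_simps power2_eq_square)
qed

lemma n_le: "n \<le> m\<^sup>2" and n_stop: "\<sigma> n \<le> \<epsilon> / (8 * real m) \<or> n = m\<^sup>2"
  and before_n: "i < n \<Longrightarrow> \<epsilon> / (8 * real m) < \<sigma> i"
proof -
  let ?Q = "\<lambda>n. \<sigma> n \<le> \<epsilon> / (8 * real m) \<or> n = m\<^sup>2"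
  show "n \<le> m\<^sup>2" unfolding n by (rule Least_le) simp
  show "?Q n" unfolding n by (rule LeastI[of ?Q "m\<^sup>2"]) simp
  show "i < n \<Longrightarrow> \<epsilon> / (8 * real m) < \<sigma> i"
    using not_less_Least[of i ?Q] unfolding n by auto
qed

lemma weak_greedy_step:
  assumes "i < n" "y \<in> param_domain d"
  shows "1 / (4 * real m) * residual (greedy_space u ys i) (u y) \<le> \<sigma> i"
proof -
  have "3 * \<epsilon> / (16 * real m) \<le> 2 * \<sigma> i"
    using before_n[OF assms(1)] \<epsilon> m(1) by (simp add: field_simps)
  also have "\<dots> \<le> 2 * real m * \<sigma> i"
    using m(1) by (intro mult_right_mono) (auto simp: \<sigma>)
  finally have "residual (greedy_space u ys i) (u y) \<le> 4 * real m * \<sigma> i"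
    using good[of i y] assms n_le noise by simp
  then show ?thesis using m(1) by (simp add: field_simps)
qed

lemma greedy_space_mono: "i \<le> j \<Longrightarrow> residual (greedy_space u ys j) w \<le> residual (greedy_space u ys i) w"
  unfolding greedy_space_def by (intro residual_antimono span_mono image_mono) auto

text \<open>The weak greedy constant 1 / (4 m) contributes 16 m^2, and rounding \<open>i\<close>
  down to a power of two contributes 2^s; 2 * 8^s * 16 * 2^s = 32 * 16^s.\<close>

lemma run_rate:
  assumes "0 < D" "0 \<le> s" "1 \<le> i" "i \<le> n" "y \<in> param_domain d"
    and width: "\<And>k. \<exists>W. finite W \<and> card W \<le> k \<and>
      (\<forall>w\<in>u ` param_domain d. \<exists>v\<in>span W. norm (w - v) \<le> D * max 1 (real k) powr (- s))"
  shows "residual (greedy_space u ys i) (u y) \<le> 32 * 16 powr s * D * (real m)\<^sup>2 * real i powr (- s)"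
proof -
  obtain j where j: "2 ^ j \<le> i" "i < 2 * 2 ^ j" using ex_power_of_two_between[OF assms(3)] by blast
  have "residual (span ((\<lambda>i. u (ys i)) ` {..<2 ^ j})) (u y)
      \<le> (2 * 8 powr s * D / (1 / (4 * real m))\<^sup>2) * real (2 ^ j) powr (- s)"
  proof (rule weak_greedy_rate[where L = n and U = "u ` param_domain d"])
    show "1 / (4 * real m) * residual (span ((\<lambda>i. u (ys i)) ` {..<i})) w
        \<le> residual (span ((\<lambda>i. u (ys i)) ` {..<i})) (u (ys i))"
      if "i < n" "w \<in> u ` param_domain d" for i w
      using weak_greedy_step[OF that(1)] that(2) \<sigma> by (auto simp: greedy_space_def)
  qed (use m(1) ys assms j in auto)
  also have "(1 / (4 * real m))\<^sup>2 = 1 / (16 * (real m)\<^sup>2)" by (simp add: power_divide power_mult_distrib)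
  also have "real (2 ^ j) powr (- s) \<le> (real i / 2) powr (- s)"
  proof (rule powr_mono2')
    have "real i \<le> real (2 * 2 ^ j)" using j(2) by (intro of_nat_mono) simp
    then show "real i / 2 \<le> real (2 ^ j)" by simp
  qed (use assms in auto)
  also have "(real i / 2) powr (- s) = 2 powr s * real i powr (- s)"
    using assms by (simp add: powr_divide powr_minus field_simps)
  finally have "residual (greedy_space u ys (2 ^ j)) (u y)
      \<le> (2 * 8 powr s * D / (1 / (16 * (real m)\<^sup>2))) * (2 powr s * real i powr (- s))"
    using assms by (simp add: greedy_space_def mult_left_mono)
  also have "\<dots> = 32 * (8 powr s * 2 powr s) * D * (real m)\<^sup>2 * real i powr (- s)"
    by (simp add: field_simps)
  also have "(8::real) powr s * 2 powr s = 16 powr s" by (simp add: powr_mult[symmetric])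
  finally show ?thesis using greedy_space_mono[OF j(1), of "u y"] by simp
qed

text \<open>After m^2 steps the rate is m^(-2 r). One factor m^(-r) absorbs 16^r by the condition
  with 2^(4 r + 2), the other absorbs m^2 and M0 by the first condition, leaving \<epsilon> / 2. If
  the run stops earlier, the threshold contributes \<epsilon> / 4 and the approximation error at
  most 3 \<epsilon> / 16.\<close>

lemma error_at_termination:
  assumes y: "y \<in> param_domain d"
  shows "residual (greedy_space u ys n) (u y) \<le> \<epsilon>"
proof (cases "n = m\<^sup>2")
  case True
  define x where "x = real m powr (- r)"
  have x: "0 < x" using m(1) by (simp add: x_def)
  have "1 \<le> n" using True m(1) by simp
  have "real n powr (- r) = x * x"
    using m(1) unfolding x_def True by (simp add: powr_mult power2_eq_square)
  with run_rate[OF _ _ \<open>1 \<le> n\<close> _ y approx] r M0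
  have "residual (greedy_space u ys n) (u y) \<le> 32 * 16 powr r * (2 * M0) * (real m)\<^sup>2 * (x * x)" by simp
  also have "\<dots> = (16 powr r * x) * (2 * (32 * M0 * (x * (real m)\<^sup>2)))" by simp
  also have "\<dots> \<le> (1 / 4) * (2 * \<epsilon>)"
  proof (rule mult_mono)
    have "(2::real) powr (4 * r) = (2 powr 4) powr r" by (simp only: powr_powr)
    then have "(2::real) powr (4 * r + 2) = 4 * 16 powr r" by (simp add: powr_add)
    then show "16 powr r * x \<le> 1 / 4" using m(3) by (simp add: x_def)
    show "2 * (32 * M0 * (x * (real m)\<^sup>2)) \<le> 2 * \<epsilon>" using m(2) unfolding m_powr x_def by simp
  qed (use x M0 in auto)
  also have "\<dots> \<le> \<epsilon>" using \<epsilon> by simp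
  finally show ?thesis .
next
  case False
  then have "\<sigma> n \<le> \<epsilon> / (8 * real m)" "n < m\<^sup>2" using n_stop n_le by auto
  then have "2 * real m * \<sigma> n \<le> \<epsilon> / 4" using m(1) by (simp add: field_simps)
  moreover have "3 * \<epsilon> / (16 * real m) \<le> 3 * \<epsilon> / 16"
    using m(1) \<epsilon> by (intro divide_left_mono) auto
  ultimately show ?thesis using good[OF \<open>n < m\<^sup>2\<close> y] noise \<epsilon> by linarith
qed

text \<open>For larger \<epsilon> the bound on m is 33 + 1 = 34, and the initial error, at most M0,
  would already be below \<epsilon> / (8 * 34); 272 = 8 * 34.\<close>

lemma \<epsilon>_le:
  assumes "0 < n"
  shows "\<epsilon> \<le> 272 * M0"
proof (rule ccontr)
  assume large: "\<not> \<epsilon> \<le> 272 * M0"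
  have "(32 * M0 / \<epsilon>) powr (1 / (r - 2)) \<le> 1"
    using large \<epsilon> M0 r by (intro powr_le1) auto
  then have "real m \<le> 34" using m_le by simp
  have "\<sigma> 0 \<le> M0"
    unfolding \<sigma> by (rule order.trans[OF residual_le_norm[OF fin_span_greedy] bound[OF ys]])
  then have "\<epsilon> / (8 * real m) < M0" using before_n[OF assms] by simp
  then have "\<epsilon> < 8 * M0 * real m" using m(1) by (simp add: field_simps)
  also have "\<dots> \<le> 8 * M0 * 34" using M0 \<open>real m \<le> 34\<close> by (intro mult_left_mono) auto
  finally show False using large by simp
qed

definition c1 :: real where "c1 = 34 * (272 * M0) powr (1 / (r - 2))"

lemma c1_pos: "0 < c1"
  using M0 by (simp add: c1_def)

lemma m_bound:
  assumes "0 < n"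
  shows "real m \<le> c1 * \<epsilon> powr (- (1 / (r - 2)))"
proof -
  let ?t = "1 / (r - 2)"
  let ?E = "272 * M0 / \<epsilon>"
  have t: "0 \<le> ?t" using r by simp
  have E: "1 \<le> ?E" using \<epsilon>_le[OF assms] \<epsilon> by simp
  have "(32 * M0 / \<epsilon>) powr ?t \<le> ?E powr ?t"
    using M0 \<epsilon> t by (intro powr_mono2 divide_right_mono) auto
  moreover have "1 \<le> ?E powr ?t" using E t by (intro ge_one_powr_ge_zero) auto
  ultimately have "real m \<le> 34 * ?E powr ?t" using m_le by linarith
  also have "\<dots> = c1 * \<epsilon> powr (- ?t)"
    using M0 \<epsilon> by (simp add: c1_def powr_divide powr_minus field_simps)
  finally show ?thesis .
qed

text \<open>The last error before stopping exceeds \<epsilon> / (8 m) and is of order m^2 n^(-s).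
  Hence n^s is of order m^3 / \<epsilon>, and m is of order \<epsilon>^(-1 / (r - 2)): the cube is
  the 3 in the exponent.\<close>

lemma step_bound:
  assumes "0 < s" "0 < C0"
    and width: "\<And>k. \<exists>W. finite W \<and> card W \<le> k \<and>
      (\<forall>w\<in>u ` param_domain d. \<exists>v\<in>span W. norm (w - v) \<le> 2 * C0 * max 1 (real k) powr (- s))"
  shows "real n \<le> ((512 * 32 powr s * C0 * c1 ^ 3) powr (1 / s)
      + (272 * M0) powr (1 / s + 3 / (s * (r - 2)))) * \<epsilon> powr (- (1 / s + 3 / (s * (r - 2))))"
proof -
  define q where "q = 1 / s + 3 / (s * (r - 2))"
  define K where "K = 512 * 32 powr s * C0 * c1 ^ 3"
  have q: "0 < q" using assms r by (simp add: q_def add_pos_pos)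
  have K: "0 < K" using assms c1_pos by (simp add: K_def)
  consider "n = 0" | "n = 1" | "2 \<le> n" by linarith
  then have "real n \<le> (K powr (1 / s) + (272 * M0) powr q) * \<epsilon> powr (- q)"
  proof cases
    case 2
    have "\<epsilon> powr q \<le> (272 * M0) powr q" using \<epsilon>_le 2 \<epsilon> q by (intro powr_mono2) auto
    then have "1 \<le> (272 * M0) powr q * \<epsilon> powr (- q)"
      using \<epsilon> by (simp add: powr_minus field_simps)
    also have "\<dots> \<le> (K powr (1 / s) + (272 * M0) powr q) * \<epsilon> powr (- q)"
      by (intro mult_right_mono) auto
    finally show ?thesis using 2 by simp
  next
    case 3
    \<comment> \<open>At i = n - 1 the run has not stopped yet. The rate needs i \<ge> 1, so n = 1
      was handled by the bound on \<epsilon>.\<close>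
    define i where "i = n - 1"
    have i: "1 \<le> i" "i < n" "n \<le> 2 * i" using 3 by (auto simp: i_def)
    have "\<epsilon> / (8 * real m) < \<sigma> i" by (rule before_n[OF i(2)])
    also have "\<sigma> i \<le> 32 * 16 powr s * (2 * C0) * (real m)\<^sup>2 * real i powr (- s)"
      unfolding \<sigma> using assms i by (intro run_rate ys width) auto
    also have "\<dots> \<le> 32 * 16 powr s * (2 * C0) * (real m)\<^sup>2 * (real n / 2) powr (- s)"
      using assms i by (intro mult_left_mono powr_mono2') auto
    also have "(real n / 2) powr (- s) = 2 powr s * real n powr (- s)"
      by (simp add: powr_divide powr_minus field_simps)
    also have "32 * 16 powr s * (2 * C0) * (real m)\<^sup>2 * (2 powr s * real n powr (- s))
        = 64 * (16 powr s * 2 powr s) * C0 * (real m)\<^sup>2 * real n powr (- s)" by simp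
    also have "(16::real) powr s * 2 powr s = 32 powr s" by (simp add: powr_mult[symmetric])
    finally have "\<epsilon> < 64 * 32 powr s * C0 * (real m)\<^sup>2 * real n powr (- s) * (8 * real m)"
      using m(1) by (simp add: pos_divide_less_eq)
    also have "\<dots> = (512 * 32 powr s * C0 * real m ^ 3) * real n powr (- s)"
      by (simp add: power2_eq_square power3_eq_cube)
    finally have "\<epsilon> * real n powr s < 512 * 32 powr s * C0 * real m ^ 3"
      using 3 by (simp add: powr_minus field_simps)
    also have "\<dots> \<le> 512 * 32 powr s * C0 * (c1 * \<epsilon> powr (- (1 / (r - 2)))) ^ 3"
      using assms m_bound 3 by (intro mult_left_mono power_mono) auto
    also have "\<dots> = K * \<epsilon> powr (- (3 / (r - 2)))"
      using \<epsilon> by (simp add: K_def power_mult_distrib powr_power)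
    finally have "real n powr s < K * \<epsilon> powr (- (3 / (r - 2))) / \<epsilon>"
      using \<epsilon> by (simp add: field_simps)
    also have "\<dots> = K * \<epsilon> powr (- (1 + 3 / (r - 2)))"
    proof -
      have "- (1 + 3 / (r - 2)) = - (3 / (r - 2)) - 1" by simp
      then show ?thesis using \<epsilon> by (simp only: powr_diff) simp
    qed
    finally have "(real n powr s) powr (1 / s) \<le> (K * \<epsilon> powr (- (1 + 3 / (r - 2)))) powr (1 / s)"
      using assms by (intro powr_mono2) auto
    also have "(real n powr s) powr (1 / s) = real n" using assms 3 by (simp add: powr_powr)
    also have "(K * \<epsilon> powr (- (1 + 3 / (r - 2)))) powr (1 / s) = K powr (1 / s) * \<epsilon> powr (- (1 + 3 / (r - 2)) * (1 / s))"
      using K \<epsilon> by (simp only: powr_mult powr_powr)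
    also have "- (1 + 3 / (r - 2)) * (1 / s) = - q"
      using assms r by (simp add: q_def field_simps)
    also have "K powr (1 / s) * \<epsilon> powr (- q) \<le> (K powr (1 / s) + (272 * M0) powr q) * \<epsilon> powr (- q)"
      by (intro mult_right_mono) auto
    finally show ?thesis .
  qed simp
  then show ?thesis by (simp add: q_def K_def)
qed

definition c2 :: real where "c2 = 1 + 4 / 3 * (2 * \<bar>ln c1\<bar> + 2 / (r - 2) + 1)"

lemma c2_pos: "0 < c2"
proof -
  have "0 \<le> 2 * \<bar>ln c1\<bar> + 2 / (r - 2) + 1" using r by (intro add_nonneg_nonneg) auto
  then show ?thesis unfolding c2_def by (intro add_pos_nonneg mult_nonneg_nonneg) auto
qed

text \<open>A training set has size of order m^2 (1 + ln m + |ln \<eta>|). The factor m^2 adds 2 /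
  (r - 2) to the exponent of the step bound, and ln m is of order 1 + |ln \<epsilon>|.\<close>

lemma evaluation_bound:
  assumes s: "0 < s" and n_bound: "real n \<le> C * \<epsilon> powr (- (1 / s + 3 / (s * (r - 2))))"
    and N: "real N \<le> 1 + 4 / 3 * (real m)\<^sup>2 * (2 * ln (real m) + \<bar>ln \<eta>\<bar>)"
  shows "real (n * N) \<le> (C * (c1\<^sup>2 * c2)) * \<epsilon> powr (- ((2 * s + r + 1) / (s * (r - 2))))
      * max 1 (\<bar>ln \<eta>\<bar> + \<bar>ln \<epsilon>\<bar>)"
proof (cases "n = 0")
  case True
  \<comment> \<open>The sign of \<open>C\<close> is not assumed; it is read off from the step
    bound.\<close>
  have "0 \<le> C * \<epsilon> powr (- (1 / s + 3 / (s * (r - 2))))" using n_bound True by simp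
  then have "0 \<le> C" using \<epsilon> by (simp add: zero_le_mult_iff)
  then show ?thesis using True c2_pos by simp
next
  case False
  define X where "X = max 1 (\<bar>ln \<eta>\<bar> + \<bar>ln \<epsilon>\<bar>)"
  have X: "1 \<le> X" "\<bar>ln \<eta>\<bar> + \<bar>ln \<epsilon>\<bar> \<le> X" by (auto simp: X_def)
  define t where "t = 1 / (r - 2)"
  have t: "0 \<le> t" using r by (simp add: t_def)
  have mb: "real m \<le> c1 * \<epsilon> powr (- t)" using m_bound False by (simp add: t_def)
  have m2: "1 \<le> (real m)\<^sup>2" using m(1) by simp
  have "ln (real m) \<le> ln (c1 * \<epsilon> powr (- t))" using mb m(1) by (intro ln_mono) auto
  also have "\<dots> = ln c1 - t * ln \<epsilon>" using c1_pos \<epsilon> by (simp add: ln_mult ln_powr)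
  also have "\<dots> \<le> \<bar>ln c1\<bar> + t * \<bar>ln \<epsilon>\<bar>"
  proof -
    have "t * (- ln \<epsilon>) \<le> t * \<bar>ln \<epsilon>\<bar>" using t by (intro mult_left_mono) auto
    then show ?thesis by simp
  qed
  also have "\<dots> \<le> \<bar>ln c1\<bar> * X + t * X"
    using X t by (intro add_mono mult_left_mono) (auto simp: mult_le_cancel_left1)
  finally have "2 * ln (real m) + \<bar>ln \<eta>\<bar> \<le> (2 * \<bar>ln c1\<bar> + 2 * t + 1) * X"
    using X by (simp add: algebra_simps)
  then have "4 / 3 * (real m)\<^sup>2 * (2 * ln (real m) + \<bar>ln \<eta>\<bar>)
      \<le> 4 / 3 * (real m)\<^sup>2 * ((2 * \<bar>ln c1\<bar> + 2 * t + 1) * X)" by (intro mult_left_mono) auto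
  moreover have "1 \<le> (real m)\<^sup>2 * X" using mult_mono[OF m2 X(1)] by simp
  ultimately have "real N \<le> (real m)\<^sup>2 * X + 4 / 3 * (real m)\<^sup>2 * ((2 * \<bar>ln c1\<bar> + 2 * t + 1) * X)"
    using N by linarith
  also have "\<dots> = (real m)\<^sup>2 * (c2 * X)"
    unfolding c2_def t_def by (simp add: algebra_simps)
  also have "\<dots> \<le> (c1 * \<epsilon> powr (- t))\<^sup>2 * (c2 * X)"
    using mb X c2_pos by (intro mult_right_mono power_mono) auto
  also have "\<dots> = \<epsilon> powr (- (2 * t)) * (c1\<^sup>2 * c2 * X)"
    using \<epsilon> by (simp add: power_mult_distrib powr_power)
  finally have "real n * real N
      \<le> (C * \<epsilon> powr (- (1 / s + 3 / (s * (r - 2))))) * (\<epsilon> powr (- (2 * t)) * (c1\<^sup>2 * c2 * X))"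
    using n_bound by (intro mult_mono) auto
  also have "\<dots> = (C * (c1\<^sup>2 * c2)) * (\<epsilon> powr (- (1 / s + 3 / (s * (r - 2)))) * \<epsilon> powr (- (2 * t))) * X"
    by (simp add: mult_ac)
  also have "\<epsilon> powr (- (1 / s + 3 / (s * (r - 2)))) * \<epsilon> powr (- (2 * t))
      = \<epsilon> powr (- ((2 * s + r + 1) / (s * (r - 2))))"
  proof -
    have "1 / s + 3 / (s * (r - 2)) + 2 * t = (2 * s + r + 1) / (s * (r - 2))"
      using s r by (simp add: t_def divide_simps)
    then have "- (1 / s + 3 / (s * (r - 2))) + - (2 * t) = - ((2 * s + r + 1) / (s * (r - 2)))"
      by linarith
    then show ?thesis by (simp only: powr_add[symmetric])
  qed
  finally show ?thesis by (simp add: X_def)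
qed

end

theorem theorem2:
  fixes r M0 :: real
  assumes "r > 2" and "M0 > 0"
  shows "\<exists>C :: real \<Rightarrow> real \<Rightarrow> real.
    \<forall>(V :: 'v::real_inner set) (d :: enat) (u :: param \<Rightarrow> 'v) (\<epsilon> :: real) (\<eta> :: real)
     (sel :: nat \<Rightarrow> (nat \<Rightarrow> nat \<Rightarrow> param) \<Rightarrow> param) (m :: nat) (N :: nat).
      hilbert_subspace V \<longrightarrow> 1 \<le> d \<longrightarrow>
      u \<in> approx_class V d r \<longrightarrow> approx_norm V d r u \<le> M0 \<longrightarrow>
      0 < \<epsilon> \<longrightarrow> 0 < \<eta> \<longrightarrow> \<eta> < 1 \<longrightarrow>
      m = greedy_m r M0 \<epsilon> \<longrightarrow> N = greedy_N m \<eta> \<longrightarrow>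
      greedy_rule d N u sel \<longrightarrow>
      (\<exists>A \<in> sets (sample_measure d N).
         measure (sample_measure d N) A > 1 - \<eta> \<and>
         (\<forall>\<omega>\<in>A.
            let M = u ` param_domain d;
                ys = selected sel \<omega>;
                n = terminal_step \<epsilon> m N u \<omega> ys
            in dist_set M (greedy_space u ys n) \<le> ereal \<epsilon> \<and>
               (\<forall>s>0. \<forall>C0>0.
                  (\<forall>k. kolmogorov_width V k M \<le> ereal (C0 * max 1 (real k) powr (- s))) \<longrightarrow>
                  real n \<le> C s C0 * \<epsilon> powr (- (1 / s + 3 / (s * (r - 2)))) \<and>
                  real (n * N) \<le> C s C0 * \<epsilon> powr (- ((2 * s + r + 1) / (s * (r - 2))))
                                  * max 1 (\<bar>ln \<eta>\<bar> + \<bar>ln \<epsilon>\<bar>))))"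
proof -
  \<comment> \<open>Within the locale these constants depend on r and M0 alone, so they can be fixed
    before \<epsilon>, \<eta>, V, d and u.\<close>
  define c1 where "c1 = greedy_run.c1 r M0"
  define c2 where "c2 = greedy_run.c2 r M0"
  define Cn where "Cn s C0 = (512 * 32 powr s * C0 * c1 ^ 3) powr (1 / s)
      + (272 * M0) powr (1 / s + 3 / (s * (r - 2)))" for s C0
  \<comment> \<open>One constant that dominates those of both the step bound and the evaluation
    bound.\<close>
  define C where "C s C0 = Cn s C0 * (1 + c1\<^sup>2 * \<bar>c2\<bar>)" for s C0
  show ?thesis
  proof (rule exI[of _ C], intro allI impI)
    fix V :: "'v set" and d u \<epsilon> \<eta> sel m N
    assume hu: "u \<in> approx_class V d r" "approx_norm V d r u \<le> M0"
      and \<epsilon>: "0 < (\<epsilon>::real)" and \<eta>: "0 < (\<eta>::real)" "\<eta> < 1"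
      and m_eq: "m = greedy_m r M0 \<epsilon>" and N_eq: "N = greedy_N m \<eta>"
      and rule: "greedy_rule d N u sel"
    note m = greedy_m_props[OF assms \<epsilon>, folded m_eq]
    note N = greedy_N_props[OF m(1) \<eta>, folded N_eq]
    obtain \<Lambda> a where lam: "downward_closed d \<Lambda>" "finite \<Lambda>" "card \<Lambda> = m"
      "\<And>y. y \<in> param_domain d \<Longrightarrow>
        norm (u y - (\<Sum>\<nu>\<in>\<Lambda>. monomial \<nu> y *\<^sub>R a \<nu>)) \<le> 2 * M0 * real m powr (- r)"
      using approx_class_sparse[OF hu assms(2) m(1)] by blast
    interpret greedy_sampling d N u sel \<Lambda> a
    proof
      show "u \<in> strongly_measurable (param_measure d)"
        using approx_class_strongly_measurable[OF hu assms(2)] assms(1) by simp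
      show "sel n \<in> (\<Pi>\<^sub>M i\<in>{..n}. \<Pi>\<^sub>M k\<in>{..<N}. param_measure d) \<rightarrow>\<^sub>M param_measure d" for n
        using rule by (simp add: greedy_rule_def)
    qed (use lam m(1) in auto)
    define A where "A = space (sample_measure d N) - (\<Union>n<m\<^sup>2. bad n)"
    have A: "A \<in> sets (sample_measure d N)" "measure (sample_measure d N) A > 1 - \<eta>"
      using good_event[of "m\<^sup>2" \<eta>, unfolded lam(3), OF N(2)] unfolding A_def by auto
    have "dist_set (u ` param_domain d) (greedy_space u (selected sel \<omega>) n) \<le> ereal \<epsilon> \<and>
        (\<forall>s>0. \<forall>C0>0. (\<forall>k. kolmogorov_width V k (u ` param_domain d) \<le> ereal (C0 * max 1 (real k) powr (- s))) \<longrightarrow>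
          real n \<le> C s C0 * \<epsilon> powr (- (1 / s + 3 / (s * (r - 2)))) \<and>
          real (n * N) \<le> C s C0 * \<epsilon> powr (- ((2 * s + r + 1) / (s * (r - 2)))) * max 1 (\<bar>ln \<eta>\<bar> + \<bar>ln \<epsilon>\<bar>))"
      if \<omega>: "\<omega> \<in> A" and n: "n = terminal_step \<epsilon> m N u \<omega> (selected sel \<omega>)" for \<omega> n
    proof -
      define ys where "ys = selected sel \<omega>"
      have space: "\<omega> \<in> space (sample_measure d N)" using \<omega> by (simp add: A_def)
      interpret run: greedy_run r M0 \<epsilon> d u ys "computed_err N u \<omega> ys" m n
      proof
        show "residual (greedy_space u ys i) (u y)
            \<le> 2 * real m * computed_err N u \<omega> ys i + 6 * real m * (M0 * real m powr (- r))"
          if i: "i < m\<^sup>2" and y: "y \<in> param_domain d" for i y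
        proof -
          let ?\<kappa> = "2 * M0 * real m powr (- r)"
          have "greedy_err u ys i y \<le> 2 * real m * (computed_err N u \<omega> ys i + ?\<kappa>) + ?\<kappa>"
            using greedy_err_good_training[OF space, of i ?\<kappa> y] \<omega> i y lam(3,4)
            by (auto simp: A_def P_def ys_def)
          \<comment> \<open>The two approximation errors 2 m \<kappa> and \<kappa> merge into 3 m
            \<kappa> = 6 m M0 m^(-r), the form used in \<open>greedy_run\<close>.\<close>
          moreover have "?\<kappa> \<le> real m * ?\<kappa>"
            using m(1) assms(2) mult_right_mono[of 1 "real m" ?\<kappa>] by simp
          ultimately show ?thesis by (simp add: greedy_err_eq_residual algebra_simps)
        qed
        show "computed_err N u \<omega> ys i = residual (greedy_space u ys i) (u (ys i))" for i
          using computed_err_selected(2)[OF rule space] by (simp add: ys_def greedy_err_eq_residual)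
        show "ys i \<in> param_domain d" for i
          using computed_err_selected(1)[OF rule space] by (simp add: ys_def)
        show "n = (LEAST n. computed_err N u \<omega> ys n \<le> \<epsilon> / (8 * real m) \<or> n = m\<^sup>2)"
          by (simp add: n terminal_step_def ys_def)
        show "\<exists>W. finite W \<and> card W \<le> k \<and>
            (\<forall>w\<in>u ` param_domain d. \<exists>v\<in>span W. norm (w - v) \<le> 2 * M0 * max 1 (real k) powr (- r))" for k
          by (rule approx_class_width[OF hu assms(2)])
      qed (use assms \<epsilon> m approx_class_norm_le[OF hu] in auto)
      have c: "run.c1 = c1" "run.c2 = c2" by (simp_all add: c1_def c2_def)
      have "dist_set (u ` param_domain d) (greedy_space u ys n) \<le> ereal \<epsilon>"
        using run.error_at_termination unfolding dist_set_def
        by (auto intro!: SUP_least simp: residual_def)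
      moreover have "real n \<le> C s C0 * \<epsilon> powr (- (1 / s + 3 / (s * (r - 2)))) \<and>
          real (n * N) \<le> C s C0 * \<epsilon> powr (- ((2 * s + r + 1) / (s * (r - 2)))) * max 1 (\<bar>ln \<eta>\<bar> + \<bar>ln \<epsilon>\<bar>)"
        if s: "0 < s" and C0: "0 < C0"
          and width: "\<forall>k. kolmogorov_width V k (u ` param_domain d) \<le> ereal (C0 * max 1 (real k) powr (- s))" for s C0
      proof -
        have "\<exists>W. finite W \<and> card W \<le> k \<and>
            (\<forall>w\<in>u ` param_domain d. \<exists>v\<in>span W. norm (w - v) \<le> 2 * C0 * max 1 (real k) powr (- s))" for k
          using kolmogorov_width_span[OF width[rule_format, of k]] C0 by (simp add: mult.assoc)
        from run.step_bound[OF s C0 this]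
        have nb: "real n \<le> Cn s C0 * \<epsilon> powr (- (1 / s + 3 / (s * (r - 2))))"
          by (simp only: c Cn_def)
        have "0 \<le> Cn s C0" by (simp add: Cn_def)
        then have le: "Cn s C0 \<le> C s C0" "Cn s C0 * (c1\<^sup>2 * c2) \<le> C s C0"
          using run.c2_pos by (simp_all add: C_def c algebra_simps)
        have "real (n * N) \<le> (Cn s C0 * (c1\<^sup>2 * c2)) * \<epsilon> powr (- ((2 * s + r + 1) / (s * (r - 2))))
            * max 1 (\<bar>ln \<eta>\<bar> + \<bar>ln \<epsilon>\<bar>)"
          using run.evaluation_bound[OF s nb N(3)] by (simp only: c)
        also have "\<dots> \<le> C s C0 * \<epsilon> powr (- ((2 * s + r + 1) / (s * (r - 2)))) * max 1 (\<bar>ln \<eta>\<bar> + \<bar>ln \<epsilon>\<bar>)"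
          by (intro mult_right_mono le) auto
        finally show ?thesis
          using nb mult_right_mono[OF le(1), of "\<epsilon> powr (- (1 / s + 3 / (s * (r - 2))))"] by simp
      qed
      ultimately show ?thesis by (simp add: ys_def)
    qed
    then show "\<exists>A \<in> sets (sample_measure d N).
         measure (sample_measure d N) A > 1 - \<eta> \<and>
         (\<forall>\<omega>\<in>A.
            let M = u ` param_domain d;
                ys = selected sel \<omega>;
                n = terminal_step \<epsilon> m N u \<omega> ys
            in dist_set M (greedy_space u ys n) \<le> ereal \<epsilon> \<and>
               (\<forall>s>0. \<forall>C0>0.
                  (\<forall>k. kolmogorov_width V k M \<le> ereal (C0 * max 1 (real k) powr (- s))) \<longrightarrow>
                  real n \<le> C s C0 * \<epsilon> powr (- (1 / s + 3 / (s * (r - 2)))) \<and>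
                  real (n * N) \<le> C s C0 * \<epsilon> powr (- ((2 * s + r + 1) / (s * (r - 2))))
                                  * max 1 (\<bar>ln \<eta>\<bar> + \<bar>ln \<epsilon>\<bar>)))"
      using A unfolding Let_def by blast
  qed
qed

end
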